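(* $L/J\cong \mathrm{gr}(M_3)$ as Lie algebras over $\mathbb{Z}$. Consequently, $\mathrm{gr}(M_3)$ is a torsion-free Lie algebra (that is, torsion-free as a $\mathbb{Z}$-module).
   Context: All Lie algebras are over $\mathbb{Z}$. For a group $G$, $(a,b)=a^{-1}b^{-1}ab$, $\gamma_c(G)$ is the $c$-th term of the lower central series, and $\mathrm{gr}(G)=\bigoplus_{c\ge1}\gamma_c(G)/\gamma_{c+1}(G)$ is the associated graded Lie algebra, with bracket $[a\gamma_{c+1}(G),b\gamma_{d+1}(G)]=(a,b)\gamma_{c+d+1}(G)$ for $a\in\gamma_c(G)$, $b\in\gamma_d(G)$, extended linearly. Let $F_3$ be a free group with free generators $g_1,g_2,g_3$. For $i\ne j$ in $\{1,2,3\}$ let $\chi_{ij}\in\mathrm{Aut}(F_3)$ send $g_i\mapsto g_i(g_i,g_j)=g_j^{-1}g_ig_j$ and fix the other generators. The McCool group $M_3$ is the subgroup of $\mathrm{Aut}(F_3)$ generated by all $\chi_{ij}$, $i\neq j$. $L$ is the free Lie algebra with free generators $x_1,\dots,x_6$. Put $y_1=[x_2,x_1]$, $y_2=[x_4,x_3]$, $y_3=[x_6,x_5]$, $y_5=[x_4,x_1]$, $y_6=[x_3,x_2]$, $y_7=[x_4,x_2]$, $y_8=[x_5,x_1]$, $y_9=[x_6,x_1]$, $y_{10}=[x_5,x_2]$, $y_{12}=[x_5,x_3]$, $y_{13}=[x_6,x_3]$, $y_{15}=[x_6,x_4]$. $J$ is the ideal of $L$ generated by $y_1,y_2,y_3,y_6+y_7,y_7+y_5,y_9+y_8,y_{10}+y_8,y_{12}+y_{13},y_{15}+y_{13}$.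 *)

theory Defs
  imports "HOL-Algebra.Free_Abelian_Groups" "HOL-Algebra.Bij"
begin

section \<open>Lie rings\<close>

text \<open>
  A Lie algebra over the integers is an abelian group with a biadditive, alternating bracket that
  satisfies the Jacobi identity; the scalar action is the canonical one.  The underlying abelian
  group is written multiplicatively, so that the quotient, direct sum and free abelian group
  constructions of HOL-Algebra apply: read \<open>\<otimes>\<close> as addition, \<open>\<one>\<close> as zero
  and \<open>x [^] n\<close> as the multiple of \<open>x\<close> by the integer \<open>n\<close>.
\<close>

record 'a lie_struct = "'a monoid" +
  lbr :: "'a \<Rightarrow> 'a \<Rightarrow> 'a" (\<open>\<lbrakk>_,/ _\<rbrakk>\<index>\<close>)

locale lie_ring = comm_group L for L :: "('a, 'b) lie_struct_scheme" (structure) +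
  assumes lbr_closed: "\<lbrakk>x \<in> carrier L; y \<in> carrier L\<rbrakk> \<Longrightarrow> \<lbrakk>x, y\<rbrakk> \<in> carrier L"
    and lbr_add_left: "\<lbrakk>x \<in> carrier L; y \<in> carrier L; z \<in> carrier L\<rbrakk>
      \<Longrightarrow> \<lbrakk>x \<otimes> y, z\<rbrakk> = \<lbrakk>x, z\<rbrakk> \<otimes> \<lbrakk>y, z\<rbrakk>"
    and lbr_add_right: "\<lbrakk>x \<in> carrier L; y \<in> carrier L; z \<in> carrier L\<rbrakk>
      \<Longrightarrow> \<lbrakk>x, y \<otimes> z\<rbrakk> = \<lbrakk>x, y\<rbrakk> \<otimes> \<lbrakk>x, z\<rbrakk>"
    and lbr_self: "x \<in> carrier L \<Longrightarrow> \<lbrakk>x, x\<rbrakk> = \<one>"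
    and jacobi: "\<lbrakk>x \<in> carrier L; y \<in> carrier L; z \<in> carrier L\<rbrakk>
      \<Longrightarrow> \<lbrakk>\<lbrakk>x, y\<rbrakk>, z\<rbrakk> \<otimes> \<lbrakk>\<lbrakk>y, z\<rbrakk>, x\<rbrakk> \<otimes> \<lbrakk>\<lbrakk>z, x\<rbrakk>, y\<rbrakk> = \<one>"

definition lie_iso :: "('a, 'c) lie_struct_scheme \<Rightarrow> ('b, 'd) lie_struct_scheme \<Rightarrow> ('a \<Rightarrow> 'b) set" where
  "lie_iso L K = {h \<in> iso L K. \<forall>x \<in> carrier L. \<forall>y \<in> carrier L. h \<lbrakk>x, y\<rbrakk>\<^bsub>L\<^esub> = \<lbrakk>h x, h y\<rbrakk>\<^bsub>K\<^esub>}"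

definition lie_isomorphic :: "('a, 'c) lie_struct_scheme \<Rightarrow> ('b, 'd) lie_struct_scheme \<Rightarrow> bool" where
  "lie_isomorphic L K \<longleftrightarrow> lie_ring L \<and> lie_ring K \<and> lie_iso L K \<noteq> {}"

text \<open>The next three notions do not assume the Lie identities: the free Lie ring is obtained below
  as a quotient of a non-associative ring.\<close>

definition lie_ideal :: "'a set \<Rightarrow> ('a, 'b) lie_struct_scheme \<Rightarrow> bool" where
  "lie_ideal I L \<longleftrightarrow> subgroup I L \<and>
    (\<forall>a \<in> I. \<forall>x \<in> carrier L. \<lbrakk>a, x\<rbrakk>\<^bsub>L\<^esub> \<in> I \<and> \<lbrakk>x, a\<rbrakk>\<^bsub>L\<^esub> \<in> I)"

definition gen_lie_ideal :: "('a, 'b) lie_struct_scheme \<Rightarrow> 'a set \<Rightarrow> 'a set" where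
  "gen_lie_ideal L S = \<Inter>{I. lie_ideal I L \<and> S \<subseteq> I}"

text \<open>As in \<^const>\<open>FactGroup\<close>, the operations are given on whole cosets; for an ideal
  the union in the bracket is the single coset of \<open>\<lbrakk>a, b\<rbrakk>\<close>.\<close>

definition lie_quot :: "('a, 'b) lie_struct_scheme \<Rightarrow> 'a set \<Rightarrow> 'a set lie_struct" where
  "lie_quot L I = \<lparr>carrier = carrier (L Mod I),
    monoid.mult = monoid.mult (L Mod I),
    one = one (L Mod I),
    lbr = (\<lambda>A B. \<Union>a\<in>A. \<Union>b\<in>B. I #>\<^bsub>L\<^esub> \<lbrakk>a, b\<rbrakk>\<^bsub>L\<^esub>)\<rparr>"

definition torsion_free :: "('a, 'b) monoid_scheme \<Rightarrow> bool" where
  "torsion_free A \<longleftrightarrow>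
    (\<forall>x \<in> carrier A. \<forall>n::int. n \<noteq> 0 \<longrightarrow> x [^]\<^bsub>A\<^esub> n = \<one>\<^bsub>A\<^esub> \<longrightarrow> x = \<one>\<^bsub>A\<^esub>)"


section \<open>Free Lie rings\<close>

text \<open>
  The free non-associative ring on \<open>X\<close> has the non-associative monomials in \<open>X\<close> as
  integral basis.  The free Lie ring is its quotient by the ideal generated by all squares and all
  Jacobi expressions.
\<close>

datatype 'a magma = Gen 'a | Br "'a magma" "'a magma"

definition free_nonassoc :: "'a set \<Rightarrow> ('a magma \<Rightarrow>\<^sub>0 int) lie_struct" where
  "free_nonassoc X = (let A = free_Abelian_group {t. set_magma t \<subseteq> X} in
    \<lparr>carrier = carrier A, monoid.mult = monoid.mult A, one = one A,
     lbr = (\<lambda>p q. frag_extend (\<lambda>s. frag_extend (\<lambda>t. frag_of (Br s t)) q) p)\<rparr>)"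

definition lie_relators :: "('a, 'b) lie_struct_scheme \<Rightarrow> 'a set" where
  "lie_relators N = {\<lbrakk>a, a\<rbrakk>\<^bsub>N\<^esub> | a. a \<in> carrier N} \<union>
    {\<lbrakk>\<lbrakk>a, b\<rbrakk>\<^bsub>N\<^esub>, c\<rbrakk>\<^bsub>N\<^esub> \<otimes>\<^bsub>N\<^esub> \<lbrakk>\<lbrakk>b, c\<rbrakk>\<^bsub>N\<^esub>, a\<rbrakk>\<^bsub>N\<^esub> \<otimes>\<^bsub>N\<^esub> \<lbrakk>\<lbrakk>c, a\<rbrakk>\<^bsub>N\<^esub>, b\<rbrakk>\<^bsub>N\<^esub> | a b c.
      a \<in> carrier N \<and> b \<in> carrier N \<and> c \<in> carrier N}"

definition free_lie_kernel :: "'a set \<Rightarrow> ('a magma \<Rightarrow>\<^sub>0 int) set" where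
  "free_lie_kernel X = gen_lie_ideal (free_nonassoc X) (lie_relators (free_nonassoc X))"

definition free_lie :: "'a set \<Rightarrow> ('a magma \<Rightarrow>\<^sub>0 int) set lie_struct" where
  "free_lie X = lie_quot (free_nonassoc X) (free_lie_kernel X)"

definition free_lie_gen :: "'a set \<Rightarrow> 'a \<Rightarrow> ('a magma \<Rightarrow>\<^sub>0 int) set" where
  "free_lie_gen X x = free_lie_kernel X #>\<^bsub>free_nonassoc X\<^esub> frag_of (Gen x)"


section \<open>The associated graded Lie ring of a group\<close>

definition commutator :: "('a, 'b) monoid_scheme \<Rightarrow> 'a \<Rightarrow> 'a \<Rightarrow> 'a" where
  "commutator G a b = inv\<^bsub>G\<^esub> a \<otimes>\<^bsub>G\<^esub> inv\<^bsub>G\<^esub> b \<otimes>\<^bsub>G\<^esub> a \<otimes>\<^bsub>G\<^esub> b"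

text \<open>Only the indices \<open>c \<ge> 1\<close> are meaningful; the value at 0 is a dummy.\<close>

fun lower_central :: "('a, 'b) monoid_scheme \<Rightarrow> nat \<Rightarrow> 'a set" where
  "lower_central G 0 = carrier G"
| "lower_central G (Suc 0) = carrier G"
| "lower_central G (Suc (Suc c)) =
    generate G {commutator G a b | a b. a \<in> lower_central G (Suc c) \<and> b \<in> carrier G}"

definition gr_piece :: "('a, 'b) monoid_scheme \<Rightarrow> nat \<Rightarrow> 'a set monoid" where
  "gr_piece G c = G\<lparr>carrier := lower_central G c\<rparr> Mod lower_central G (Suc c)"

text \<open>All cosets in this union coincide when \<open>A\<close> and \<open>B\<close> are elements of the
  pieces of degrees \<open>c\<close> and \<open>d\<close>.\<close>

definition gr_piece_lbr :: "('a, 'b) monoid_scheme \<Rightarrow> nat \<Rightarrow> nat \<Rightarrow> 'a set \<Rightarrow> 'a set \<Rightarrow> 'a set" where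
  "gr_piece_lbr G c d A B =
    (\<Union>a\<in>A. \<Union>b\<in>B. lower_central G (Suc (c + d)) #>\<^bsub>G\<^esub> commutator G a b)"

definition gr :: "('a, 'b) monoid_scheme \<Rightarrow> (nat \<Rightarrow> 'a set) lie_struct" where
  "gr G = (let S = sum_group {1..} (gr_piece G) in
    \<lparr>carrier = carrier S, monoid.mult = monoid.mult S, one = one S,
     lbr = (\<lambda>f g. \<lambda>n\<in>{1..}. finprod (gr_piece G n)
       (\<lambda>c. gr_piece_lbr G c (n - c) (f c) (g (n - c))) {1..<n})\<rparr>)"


section \<open>Free groups and the McCool group\<close>

text \<open>The letter \<open>(x, True)\<close> stands for the generator \<open>x\<close> and
  \<open>(x, False)\<close> for its inverse.\<close>

inductive free_group_eq :: "('a \<times> bool) list \<Rightarrow> ('a \<times> bool) list \<Rightarrow> bool" where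
  cancel: "free_group_eq (u @ [(x, e), (x, \<not> e)] @ v) (u @ v)"
| refl: "free_group_eq u u"
| sym: "free_group_eq u v \<Longrightarrow> free_group_eq v u"
| trans: "free_group_eq u v \<Longrightarrow> free_group_eq v w \<Longrightarrow> free_group_eq u w"

definition free_group_rel :: "'a set \<Rightarrow> (('a \<times> bool) list \<times> ('a \<times> bool) list) set" where
  "free_group_rel X =
    {(u, v). u \<in> lists (X \<times> UNIV) \<and> v \<in> lists (X \<times> UNIV) \<and> free_group_eq u v}"

definition free_group :: "'a set \<Rightarrow> ('a \<times> bool) list set monoid" where
  "free_group X = \<lparr>carrier = lists (X \<times> UNIV) // free_group_rel X,
    monoid.mult = (\<lambda>A B. \<Union>u\<in>A. \<Union>v\<in>B. free_group_rel X `` {u @ v}),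
    one = free_group_rel X `` {[]}\<rparr>"

definition free_group_gen :: "'a set \<Rightarrow> 'a \<Rightarrow> ('a \<times> bool) list set" where
  "free_group_gen X x = free_group_rel X `` {[(x, True)]}"

definition F3 :: "(nat \<times> bool) list set monoid" where
  "F3 = free_group {1, 2, 3}"

definition F3_gen :: "nat \<Rightarrow> (nat \<times> bool) list set" where
  "F3_gen i = free_group_gen {1, 2, 3} i"

text \<open>Elements of \<^const>\<open>AutoGroup\<close> are extensional on the carrier, so an automorphism is
  determined by its values on the free generators.\<close>

definition chi :: "nat \<Rightarrow> nat \<Rightarrow> (nat \<times> bool) list set \<Rightarrow> (nat \<times> bool) list set" where
  "chi i j = (THE \<phi>. \<phi> \<in> carrier (AutoGroup F3) \<and>
    \<phi> (F3_gen i) = F3_gen i \<otimes>\<^bsub>F3\<^esub> commutator F3 (F3_gen i) (F3_gen j) \<and>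
    (\<forall>k \<in> {1, 2, 3} - {i}. \<phi> (F3_gen k) = F3_gen k))"

definition McCool3 :: "((nat \<times> bool) list set \<Rightarrow> (nat \<times> bool) list set) monoid" where
  "McCool3 = subgroup_generated (AutoGroup F3)
    {chi i j | i j. i \<in> {1, 2, 3} \<and> j \<in> {1, 2, 3} \<and> i \<noteq> j}"


section \<open>The presented Lie ring\<close>

definition L6 :: "(nat magma \<Rightarrow>\<^sub>0 int) set lie_struct" where
  "L6 = free_lie {1..6}"

definition J6 :: "(nat magma \<Rightarrow>\<^sub>0 int) set set" where
  "J6 = (let
      x = free_lie_gen {1..6};
      y1 = \<lbrakk>x 2, x 1\<rbrakk>\<^bsub>L6\<^esub>; y2 = \<lbrakk>x 4, x 3\<rbrakk>\<^bsub>L6\<^esub>; y3 = \<lbrakk>x 6, x 5\<rbrakk>\<^bsub>L6\<^esub>;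
      y5 = \<lbrakk>x 4, x 1\<rbrakk>\<^bsub>L6\<^esub>; y6 = \<lbrakk>x 3, x 2\<rbrakk>\<^bsub>L6\<^esub>; y7 = \<lbrakk>x 4, x 2\<rbrakk>\<^bsub>L6\<^esub>;
      y8 = \<lbrakk>x 5, x 1\<rbrakk>\<^bsub>L6\<^esub>; y9 = \<lbrakk>x 6, x 1\<rbrakk>\<^bsub>L6\<^esub>; y10 = \<lbrakk>x 5, x 2\<rbrakk>\<^bsub>L6\<^esub>;
      y12 = \<lbrakk>x 5, x 3\<rbrakk>\<^bsub>L6\<^esub>; y13 = \<lbrakk>x 6, x 3\<rbrakk>\<^bsub>L6\<^esub>; y15 = \<lbrakk>x 6, x 4\<rbrakk>\<^bsub>L6\<^esub>
    in gen_lie_ideal L6 {y1, y2, y3,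
      y6 \<otimes>\<^bsub>L6\<^esub> y7, y7 \<otimes>\<^bsub>L6\<^esub> y5, y9 \<otimes>\<^bsub>L6\<^esub> y8,
      y10 \<otimes>\<^bsub>L6\<^esub> y8, y12 \<otimes>\<^bsub>L6\<^esub> y13, y15 \<otimes>\<^bsub>L6\<^esub> y13})"

end

theory Submission
  imports Defs "HOL-Library.List_Lexorder"
begin

text \<open>
  Write $F$ for the free group on $g_1, g_2, g_3$ and $M$ for the McCool group.  The generators
  $x_1, \ldots, x_6$ of the presentation correspond to
  $\chi_{21}, \chi_{31}, \chi_{12}, \chi_{32}, \chi_{23}, \chi_{13}$ in this order.  The products
  $\chi_{ij}\chi_{kj}$ with $\{i, j, k\} = \{1, 2, 3\}$ are the inner automorphisms
  $g \mapsto g_j^{-1} g g_j$; on the side of Lie rings they give $s_1 = x_1 + x_2$,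
  $s_2 = x_3 + x_4$, $s_3 = x_5 + x_6$.  Put $t_1 = x_1$, $t_2 = x_3$, $t_3 = x_5$.  The group $M$ is
  an extension of a free group of rank 3, the group of outer classes, by the inner automorphisms,
  and it acts trivially on the abelianisation of the latter.  Both sides of the theorem therefore
  should be the sum of a free Lie ring in the $s_i$ and one in the $t_j$, and the proof shows this
  by exhibiting one family that spans on the left and is independent on the right.

  Upper bound.  In any Lie ring with generators that satisfy the nine relations, each
  $[t_j, s_i]$ is $0$ or a bracket $[s_a, s_b]$.  So the Lie subring generated by the $t_j$ acts by
  derivations on the one generated by the $s_i$, and their sum is everything
  (\<open>mccool_relators_decomposition\<close>).  Each of the two subrings is spanned additively by the
  standard brackets of Lyndon words (\<open>lyndon_bracket_below\<close>).  The relations do hold in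
  the associated graded Lie ring of $M$, which is generated in degree one; this gives a surjective
  homomorphism onto it from the presented Lie ring.

  Lower bound.  The images of the Lyndon brackets in the $s_i$ and in the $t_j$ are linearly
  independent (\<open>gr_McCool3_independence\<close>), so that the homomorphism is injective and its
  target is a free abelian group.  Two filtrations by degree prove the independence.
  First, there is a homomorphism from $M$ to the units of the ring of noncommutative power series
  that is trivial on inner automorphisms and sends $\chi_{21}, \chi_{12}, \chi_{23}$ to
  $1 + X_1, 1 + X_2, 1 + X_3$.  On leading terms it sends a bracket in the $t_j$ to the
  same bracket of variables, and Lyndon brackets of variables are independent, because the
  lexicographically least word in each of them is the Lyndon word itself with coefficient 1.  That
  the homomorphism exists means that the outer classes of these three automorphisms are free; this
  is proved by ping-pong on triples of transvections of the plane.
  Secondly, a combination of brackets in the $s_i$ alone is the class of an inner automorphism by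
  some $w \in \gamma_n(F)$.  If it vanishes, that automorphism lies in $\gamma_{n+1}(M)$, which moves
  every $g_i$ by an element of $\gamma_{n+2}(F)$ (\<open>raises_filtration_lower_central\<close>).
  Hence the leading term of the Magnus expansion of $w$ commutes with every variable, and only $0$
  does so in positive degree.
\<close>

section \<open>Noncommutative power series\<close>

text \<open>
  A type of its own, so that the product can be convolution over all ways to cut a word in two.
\<close>

datatype series = Series (coeff: "nat list \<Rightarrow> int")

lemma series_eqI: "(\<And>w. coeff f w = coeff g w) \<Longrightarrow> f = g"
  by (cases f; cases g) auto

instantiation series :: ring_1
begin

definition "0 = Series (\<lambda>_. 0)"
definition "1 = Series (\<lambda>w. if w = [] then 1 else 0)"
definition "f + g = Series (\<lambda>w. coeff f w + coeff g w)"
definition "- f = Series (\<lambda>w. - coeff f w)"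
definition "f - g = Series (\<lambda>w. coeff f w - coeff g w)"
definition "f * g = Series (\<lambda>w. \<Sum>k\<le>length w. coeff f (take k w) * coeff g (drop k w))"

instance
proof
  fix f g h :: series
  show "f * g * h = f * (g * h)"
  proof (rule series_eqI)
    fix w :: "nat list"
    let ?n = "length w"
    let ?t = "\<lambda>j k. coeff f (take j w) * coeff g (take k (drop j w)) * coeff h (drop (j + k) w)"
    have "coeff (f * g * h) w = (\<Sum>m\<le>?n. \<Sum>j\<le>m. ?t j (m - j))"
      by (auto simp: times_series_def sum_distrib_right min_def drop_take intro!: sum.cong)
    also have "\<dots> = (\<Sum>j\<le>?n. \<Sum>k\<le>?n - j. ?t j k)"
      by (simp add: sum.nested_swap' sum.Sigma)
         (rule sum.reindex_bij_witness[where i = "\<lambda>(j, k). (j + k, j)" and j = "\<lambda>(m, j). (j, m - j)"], auto)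
    also have "\<dots> = coeff (f * (g * h)) w"
      by (auto simp: times_series_def sum_distrib_left mult.assoc add.commute intro!: sum.cong)
    finally show "coeff (f * g * h) w = coeff (f * (g * h)) w" .
  qed
  show "1 * f = f"
  proof (rule series_eqI)
    fix w :: "nat list"
    have "coeff (1 * f) w = (\<Sum>k\<le>length w. if k = 0 then coeff f w else 0)"
      unfolding times_series_def one_series_def series.sel by (intro sum.cong) auto
    then show "coeff (1 * f) w = coeff f w" by simp
  qed
  show "f * 1 = f"
  proof (rule series_eqI)
    fix w :: "nat list"
    have "coeff (f * 1) w = (\<Sum>k\<le>length w. if k = length w then coeff f w else 0)"
      unfolding times_series_def one_series_def series.sel by (intro sum.cong) auto
    then show "coeff (f * 1) w = coeff f w" by simp
  qed
  show "(f + g) * h = f * h + g * h" "f * (g + h) = f * g + f * h"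
    by (rule series_eqI, simp add: times_series_def plus_series_def algebra_simps sum.distrib)+
  show "(0::series) \<noteq> 1"
    by (auto simp: zero_series_def one_series_def dest: fun_cong[of _ _ "[]"])
qed (auto intro!: series_eqI simp: zero_series_def plus_series_def uminus_series_def minus_series_def)

end

lemma coeff_simps [simp]:
  "coeff 0 w = 0" "coeff (f + g) w = coeff f w + coeff g w"
  "coeff (- f) w = - coeff f w" "coeff (f - g) w = coeff f w - coeff g w"
  by (simp_all add: zero_series_def plus_series_def uminus_series_def minus_series_def)

lemma coeff_one: "coeff 1 w = (if w = [] then 1 else 0)"
  by (simp add: one_series_def)

lemma coeff_mult: "coeff (f * g) w = (\<Sum>k\<le>length w. coeff f (take k w) * coeff g (drop k w))"
  by (simp add: times_series_def)

lemma coeff_of_int_mult: "coeff (of_int n * f) w = n * coeff f w"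
  by (induction n rule: int_induct[where k = 0]) (simp_all add: algebra_simps)

definition order_ge :: "nat \<Rightarrow> series set" where
  "order_ge n = {f. \<forall>w. length w < n \<longrightarrow> coeff f w = 0}"

lemma order_geD: "f \<in> order_ge n \<Longrightarrow> length w < n \<Longrightarrow> coeff f w = 0"
  by (simp add: order_ge_def)

lemma order_ge_simps [simp]: "f \<in> order_ge 0" "0 \<in> order_ge n"
  by (auto simp: order_ge_def)

lemma order_ge_arith:
  assumes "f \<in> order_ge n" "g \<in> order_ge n"
  shows "f + g \<in> order_ge n" "f - g \<in> order_ge n" "- f \<in> order_ge n"
  using assms by (auto simp: order_ge_def)

lemma order_ge_mult:
  assumes "f \<in> order_ge m" "g \<in> order_ge n"
  shows "f * g \<in> order_ge (m + n)"
proof -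
  have "coeff f (take k w) * coeff g (drop k w) = 0" if "length w < m + n" "k \<le> length w" for k w
  proof (cases "k < m")
    case True
    then show ?thesis using assms(1) that by (simp add: order_ge_def)
  next
    case False
    then show ?thesis using assms(2) that by (simp add: order_ge_def)
  qed
  then show ?thesis
    unfolding order_ge_def coeff_mult mem_Collect_eq by (intro allI impI sum.neutral ballI) simp
qed

definition homogeneous_part :: "nat \<Rightarrow> series \<Rightarrow> series" where
  "homogeneous_part n f = Series (\<lambda>w. if length w = n then coeff f w else 0)"

definition indet :: "nat \<Rightarrow> series" where
  "indet i = Series (\<lambda>w. if w = [i] then 1 else 0)"

lemma coeff_indet: "coeff (indet i) w = (if w = [i] then 1 else 0)"
  by (simp add: indet_def)

lemma coeff_indet_mult: "coeff (indet i * f) w = (case w of [] \<Rightarrow> 0 | j # v \<Rightarrow> if j = i then coeff f v else 0)"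
proof (cases w)
  case (Cons j v)
  have "coeff (indet i * f) w = (\<Sum>k\<le>length w. if k = 1 then (if j = i then coeff f v else 0) else 0)"
    unfolding coeff_mult
  proof (rule sum.cong)
    fix k assume "k \<in> {..length w}"
    then show "coeff (indet i) (take k w) * coeff f (drop k w) = (if k = 1 then (if j
        = i then coeff f v else 0) else 0)"
      by (cases k) (auto simp: Cons coeff_indet)
  qed simp
  also have "\<dots> = (if j = i then coeff f v else 0)" by (subst sum.delta) (auto simp: Cons)
  finally show ?thesis by (simp add: Cons)
qed (simp add: coeff_mult coeff_indet)

lemma coeff_mult_indet: "coeff (f * indet i) (v @ [j]) = (if j = i then coeff f v else 0)"
proof -
  have "coeff (f * indet i) (v @ [j]) = (\<Sum>k\<le>Suc (length v). if k = length v then (if j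
      = i then coeff f v else 0) else 0)"
    unfolding coeff_mult
  proof (rule sum.cong)
    fix k assume k: "k \<in> {..Suc (length v)}"
    show "coeff f (take k (v @ [j])) * coeff (indet i) (drop k (v @ [j])) = (if k = length v then (if j
        = i then coeff f v else 0) else 0)"
    proof (cases "k \<le> length v")
      case True
      then have "drop k (v @ [j]) = [i] \<longleftrightarrow> k = length v \<and> j = i"
        by (auto simp: append_eq_Cons_conv)
      then show ?thesis by (auto simp: coeff_indet)
    next
      case False
      with k have "k = Suc (length v)" by auto
      then show ?thesis by (simp add: coeff_indet)
    qed
  qed simp
  then show ?thesis by simp
qed

text \<open>
  For a word $w$ choose a variable $k$, out of the two, that differs from the first letter of $w$.  The
      coefficient of
  $wk$ is that of $w$ in $fX_k$, and it is $0$ in $X_kf$.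
\<close>

lemma central_series_zero:
  assumes comm: "indet i * f = f * indet i" "indet j * f = f * indet j" and "i \<noteq> j" and "coeff f [] = 0"
  shows "f = 0"
proof (rule series_eqI)
  fix w
  show "coeff f w = coeff 0 w"
  proof (cases w)
    case (Cons l v)
    obtain k where k: "k \<noteq> l" "indet k * f = f * indet k"
      using comm \<open>i \<noteq> j\<close> by metis
    have "coeff f w = coeff (f * indet k) (w @ [k])" by (simp add: coeff_mult_indet)
    also have "\<dots> = coeff (indet k * f) (w @ [k])" using k(2) by simp
    also have "\<dots> = 0" using k(1) by (simp add: Cons coeff_indet_mult)
    finally show ?thesis by simp
  qed (use assms in simp)
qed

definition indet_unit :: "nat \<Rightarrow> series" where
  "indet_unit i = 1 + indet i"

definition indet_unit_inv :: "nat \<Rightarrow> series" where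
  "indet_unit_inv i = Series (\<lambda>w. if set w \<subseteq> {i} then (-1) ^ length w else 0)"

lemma indet_unit_inv: "indet_unit i * indet_unit_inv i = 1" "indet_unit_inv i * indet_unit i = 1"
proof -
  show "indet_unit i * indet_unit_inv i = 1"
    by (rule series_eqI)
       (auto simp: indet_unit_def distrib_right coeff_indet_mult coeff_one indet_unit_inv_def split: list.split)
  show "indet_unit_inv i * indet_unit i = 1"
  proof (rule series_eqI)
    fix w show "coeff (indet_unit_inv i * indet_unit i) w = coeff 1 w"
    proof (cases w rule: rev_cases)
      case Nil
      then show ?thesis by (simp add: coeff_mult indet_unit_inv_def indet_unit_def coeff_one coeff_indet)
    next
      case (snoc v j)
      then show ?thesis
        by (auto simp: indet_unit_def distrib_left coeff_mult_indet coeff_one indet_unit_inv_def)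
    qed
  qed
qed

section \<open>Lyndon trees\<close>

fun foliage :: "'a magma \<Rightarrow> 'a list" where
  "foliage (Gen a) = [a]"
| "foliage (Br s t) = foliage s @ foliage t"

lemma foliage_nonempty [simp]: "foliage t \<noteq> []"
  by (induction t) auto

text \<open>
  These are the Hall trees for the lexicographic order of foliages.  The condition on the right child of
  the left child is what makes a tree the standard bracketing of its foliage, which is a Lyndon word.
\<close>

fun lyndon :: "'a::linorder magma \<Rightarrow> bool" where
  "lyndon (Gen a) = True"
| "lyndon (Br s t) = (lyndon s \<and> lyndon t \<and> foliage s < foliage t \<and>
     (case s of Gen _ \<Rightarrow> True | Br _ s'' \<Rightarrow> foliage t \<le> foliage s''))"

lemma less_append: "v \<noteq> [] \<Longrightarrow> u < u @ (v :: 'a::linorder list)"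
  by (induction u) (cases v, auto)

lemma le_append: "u \<le> u @ (v :: 'a::linorder list)"
  using less_append[of v u] by (cases "v = []") auto

lemma append_less_cancel [simp]: "u @ v < u @ w \<longleftrightarrow> v < (w :: 'a::linorder list)"
  by (induction u) auto

text \<open>
  Either the smaller word is a prefix, or the words differ at some position, and then whatever is appended
  does not change their order.
\<close>

lemma less_cases:
  assumes "u < (v :: 'a::linorder list)"
  shows "(\<exists>z. z \<noteq> [] \<and> v = u @ z) \<or> (\<forall>x y. u @ x < v @ y)"
  using assms
proof (induction u arbitrary: v)
  case Nil then show ?case by (cases v) auto
next
  case (Cons a u)
  then obtain b v' where v: "v = b # v'" by (cases v) auto
  show ?case
  proof (cases "a < b")
    case True then show ?thesis by (simp add: v)
  next
    case False
    with Cons.prems v have "a = b" "u < v'" by auto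
    with Cons.IH[of v'] show ?thesis by (auto simp: v)
  qed
qed

lemma less_append_same_length:
  assumes "u < (v :: 'a::linorder list)" "length u = length v"
  shows "u @ x < v @ y"
  using less_cases[OF assms(1)] assms(2) by auto

lemma append_mono_same_length:
  assumes "u \<le> (u' :: 'a::linorder list)" "length u' = length u" "v \<le> v'"
  shows "u @ v \<le> u' @ v'"
proof (cases "u = u'")
  case True
  have "\<not> u @ v' < u @ v" using assms(3) by simp
  with True show ?thesis by (simp only: not_less)
next
  case False
  with assms have "u < u'" "length u = length u'" by simp_all
  then have "u @ v < u' @ v'" by (rule less_append_same_length)
  then show ?thesis by (rule less_imp_le)
qed

lemma less_append_le: "s < (t :: 'a::linorder list) \<Longrightarrow> s < t @ u"
  using le_append less_le_trans by blast

definition lyndon_word :: "'a::linorder list \<Rightarrow> bool" where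
  "lyndon_word w \<longleftrightarrow> (\<forall>u v. w = u @ v \<longrightarrow> u \<noteq> [] \<longrightarrow> v \<noteq> [] \<longrightarrow> w < v)"

lemma lyndon_append_less:
  assumes "lyndon_word b" "a < b" "a \<noteq> []"
  shows "a @ b < (b :: 'a::linorder list)"
  using less_cases[OF assms(2)]
proof
  assume "\<exists>z. z \<noteq> [] \<and> b = a @ z"
  then obtain z where z: "z \<noteq> []" "b = a @ z" by auto
  then have "b < z" using assms by (auto simp: lyndon_word_def)
  then have "a @ b < a @ z" by simp
  then show ?thesis using z by simp
next
  assume "\<forall>x y. a @ x < b @ y"
  then have "a @ b < b @ []" by blast
  then show ?thesis by simp
qed

text \<open>
  The second conjunct, that the foliage of the right child is the least proper suffix, strengthens the
  induction: a suffix of $ab$ that starts inside $a$ is $zb$ with $z$ a proper suffix of $a$, hence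
  $z \ge a'' \ge b$ where $a''$ is the right child of $a$.
\<close>

lemma lyndon_foliage:
  assumes "lyndon t"
  shows "lyndon_word (foliage t) \<and>
    (\<forall>t' t'' u v. t = Br t' t'' \<longrightarrow> foliage t = u @ v \<longrightarrow> u \<noteq> [] \<longrightarrow> v \<noteq> [] \<longrightarrow> foliage t'' \<le> v)"
  using assms
proof (induction t)
  case (Gen a)
  then show ?case by (auto simp: lyndon_word_def Cons_eq_append_conv)
next
  case (Br s t)
  let ?a = "foliage s" and ?b = "foliage t"
  from Br have st: "lyndon s" "lyndon t" "?a < ?b" and
    lw: "lyndon_word ?a" "lyndon_word ?b"
    by auto
  have min: "?b \<le> v" if uv: "foliage (Br s t) = u @ v" "u \<noteq> []" "v \<noteq> []" for u v
  proof -
    from uv(1) consider z where "?a = u @ z" "v = z @ ?b" | z where "u = ?a @ z" "?b = z @ v"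
      by (auto simp: append_eq_append_conv2)
    then show ?thesis
    proof cases
      case 1
      show ?thesis
      proof (cases "z = []")
        case False
        from 1 False uv obtain s' s'' where s: "s = Br s' s''"
          by (cases s) (auto simp: Cons_eq_append_conv)
        with Br 1 False uv have "foliage s'' \<le> z" by auto
        moreover from s Br have "?b \<le> foliage s''" by auto
        ultimately show ?thesis using 1 by (meson le_append order_trans)
      qed (use 1 in simp)
    next
      case 2
      show ?thesis
      proof (cases "z = []")
        case False
        with 2 uv lw show ?thesis by (auto simp: lyndon_word_def less_imp_le)
      qed (use 2 in simp)
    qed
  qed
  have "?a @ ?b < ?b" using lyndon_append_less[OF lw(2) st(3)] by simp
  then have "lyndon_word (foliage (Br s t))"
    using min unfolding lyndon_word_def by (metis foliage.simps(2) less_le_trans)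
  with min show ?case by auto
qed

lemma lyndon_Br_less_right:
  assumes "lyndon (Br s t)"
  shows "foliage (Br s t) < foliage t"
  using lyndon_append_less[of "foliage t" "foliage s"] lyndon_foliage[of t] assms by simp

text \<open>
  The right child is recovered from the word as its least proper suffix.
\<close>

lemma lyndon_foliage_inj:
  assumes "lyndon s" "lyndon t" "foliage s = foliage t"
  shows "s = t"
  using assms
proof (induction s arbitrary: t)
  case (Gen a)
  then show ?case
    by (cases t) (auto simp: Cons_eq_append_conv)
next
  case (Br s1 s2)
  then obtain t1 t2 where t: "t = Br t1 t2"
    by (cases t) (auto simp: append_eq_Cons_conv)
  have "foliage s2 \<le> foliage t2" "foliage t2 \<le> foliage s2"
    using lyndon_foliage[OF Br.prems(1)] lyndon_foliage[OF Br.prems(2)] Br.prems(3) t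
    by (metis foliage.simps(2) foliage_nonempty)+
  then have "foliage s2 = foliage t2" by simp
  with Br t show ?case by auto
qed

definition assoc_lie :: "'r::ring lie_struct" where
  "assoc_lie = \<lparr>carrier = UNIV, monoid.mult = (+), one = 0, lbr = (\<lambda>a b. a * b - b * a)\<rparr>"

lemma assoc_lie_simps [simp]:
  "carrier assoc_lie = UNIV" "x \<otimes>\<^bsub>assoc_lie\<^esub> y = x + y" "\<one>\<^bsub>assoc_lie\<^esub> = 0" "\<lbrakk>x, y\<rbrakk>\<^bsub>assoc_lie\<^esub> = x * y - y * x"
  by (simp_all add: assoc_lie_def)

fun tree_eval :: "('b, 'c) lie_struct_scheme \<Rightarrow> ('a \<Rightarrow> 'b) \<Rightarrow> 'a magma \<Rightarrow> 'b" where
  "tree_eval K x (Gen a) = x a"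
| "tree_eval K x (Br s t) = lbr K (tree_eval K x s) (tree_eval K x t)"

abbreviation bracket_poly :: "nat magma \<Rightarrow> series" where
  "bracket_poly \<equiv> tree_eval assoc_lie indet"

lemma bracket_poly_Br:
  "bracket_poly (Br s t) = bracket_poly s * bracket_poly t - bracket_poly t * bracket_poly s"
  by simp

text \<open>
  Words of a fixed length are ordered compatibly with concatenation, so least words multiply.
\<close>

lemma lead_mult:
  assumes "\<And>w. coeff f w \<noteq> 0 \<Longrightarrow> length w = length u \<and> u \<le> w" "coeff f u = 1"
    and "\<And>w. coeff g w \<noteq> 0 \<Longrightarrow> length w = length v \<and> v \<le> w" "coeff g v = 1"
  shows "\<And>w. coeff (f * g) w \<noteq> 0 \<Longrightarrow> length w = length (u @ v) \<and> u @ v \<le> w"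
    and "coeff (f * g) (u @ v) = 1"
proof -
  fix w assume "coeff (f * g) w \<noteq> 0"
  then obtain k where k: "k \<le> length w" "coeff f (take k w) \<noteq> 0" "coeff g (drop k w) \<noteq> 0"
    unfolding coeff_mult by (rule sum.not_neutral_contains_not_neutral) auto
  have 1: "length (take k w) = length u" "u \<le> take k w" "length (drop k w) = length v" "v \<le> drop k w"
    using assms(1)[OF k(2)] assms(3)[OF k(3)] by blast+
  have "u @ v \<le> take k w @ drop k w"
    using append_mono_same_length 1 by metis
  moreover have "length w = length (u @ v)" using 1 k by simp
  ultimately show "length w = length (u @ v) \<and> u @ v \<le> w" by simp
next
  have "coeff (f * g) (u @ v) = (\<Sum>k\<le>length (u @ v). if k = length u then 1 else 0)"
    unfolding coeff_mult
  proof (rule sum.cong)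
    fix k assume k: "k \<in> {..length (u @ v)}"
    show "coeff f (take k (u @ v)) * coeff g (drop k (u @ v)) = (if k = length u then 1 else 0)"
    proof (cases "k = length u")
      case False
      then have "length (take k (u @ v)) \<noteq> length u" using k by auto
      then have "coeff f (take k (u @ v)) = 0" using assms(1)[of "take k (u @ v)"] by blast
      then show ?thesis using False by simp
    qed (use assms(2,4) in simp)
  qed simp
  then show "coeff (f * g) (u @ v) = 1" by simp
qed

text \<open>
  In $[s, t] = st - ts$ the least words of the two products are $uv$ and $vu$, and $uv < vu$ because
  $uv < v$ for Lyndon words $u < v$.
\<close>

lemma bracket_poly_leading:
  assumes "lyndon t"
  shows "(\<forall>w. coeff (bracket_poly t) w \<noteq> 0 \<longrightarrow> length w = length (foliage t) \<and> foliage t \<le> w) \<and>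
    coeff (bracket_poly t) (foliage t) = 1"
  using assms
proof (induction t)
  case (Gen a)
  then show ?case by (auto simp: coeff_indet)
next
  case (Br s t)
  let ?f = "bracket_poly s" and ?g = "bracket_poly t" and ?u = "foliage s" and ?v = "foliage t"
  from Br.prems have st: "lyndon s" "lyndon t" "?u < ?v" by auto
  have f: "\<And>w. coeff ?f w \<noteq> 0 \<Longrightarrow> length w = length ?u \<and> ?u \<le> w" "coeff ?f ?u = 1"
    and g: "\<And>w. coeff ?g w \<noteq> 0 \<Longrightarrow> length w = length ?v \<and> ?v \<le> w" "coeff ?g ?v = 1"
    using Br.IH st by blast+
  note fg = lead_mult[OF f g] and gf = lead_mult[OF g f]
  have less: "?u @ ?v < ?v @ ?u"
    using less_append_le[OF lyndon_append_less[OF _ st(3)]] lyndon_foliage[OF st(2)] by simp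
  have "coeff (?g * ?f) (?u @ ?v) = 0"
    using gf(1)[of "?u @ ?v"] less by force
  then have "coeff (bracket_poly (Br s t)) (foliage (Br s t)) = 1"
    using fg(2) by simp
  moreover have "length w = length (foliage (Br s t)) \<and> foliage (Br s t) \<le> w" if
      "coeff (bracket_poly (Br s t)) w \<noteq> 0" for w
  proof -
    from that consider "coeff (?f * ?g) w \<noteq> 0" | "coeff (?g * ?f) w \<noteq> 0"
      unfolding bracket_poly_Br by fastforce
    then show ?thesis
    proof cases
      case 1
      then show ?thesis using fg(1)[of w] by simp
    next
      case 2
      with gf(1)[of w] less show ?thesis by auto
    qed
  qed
  ultimately show ?case by blast
qed

text \<open>
  Look at the coefficient of the least foliage that occurs: distinct Lyndon trees have distinct foliages,
  so only one tree contributes to it.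
\<close>

lemma lyndon_bracket_polys_independent:
  assumes lyn: "Poly_Mapping.keys p \<subseteq> {t. lyndon t}"
    and zero: "(\<Sum>t \<in> Poly_Mapping.keys p. of_int (Poly_Mapping.lookup p t) * bracket_poly t) = 0"
  shows "p = 0"
proof (rule ccontr)
  let ?K = "Poly_Mapping.keys p"
  assume "p \<noteq> 0"
  then have K: "finite (foliage ` ?K)" "foliage ` ?K \<noteq> {}" by auto
  then obtain t where t: "t \<in> ?K" and min: "\<And>s. s \<in> ?K \<Longrightarrow> foliage t \<le> foliage s"
  proof -
    from Min_in[OF K] obtain t where "t \<in> ?K" "foliage t = Min (foliage ` ?K)" by force
    with Min_le[OF K(1)] that show thesis by auto
  qed
  have at_t: "coeff (bracket_poly s) (foliage t) = (if s = t then 1 else 0)" if "s \<in> ?K" for s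
  proof (cases "s = t")
    case False
    with lyndon_foliage_inj that t lyn have "foliage s \<noteq> foliage t" by blast
    with min[OF that] have "\<not> foliage s \<le> foliage t" by simp
    then show ?thesis using False bracket_poly_leading[of s] lyn that by auto
  qed (use bracket_poly_leading lyn t in auto)
  have "coeff (\<Sum>s \<in> ?K. of_int (Poly_Mapping.lookup p s) * bracket_poly s) (foliage t)
    = (\<Sum>s \<in> ?K. if s = t then Poly_Mapping.lookup p s else 0)"
  proof -
    have "coeff (sum g A) w = (\<Sum>a\<in>A. coeff (g a) w)" for g :: "nat magma \<Rightarrow> series" and A w
      by (induction A rule: infinite_finite_induct) auto
    then show ?thesis
      by (auto simp: coeff_of_int_mult at_t intro!: sum.cong simp del: sum.delta sum.delta')
  qed
  also have "\<dots> = Poly_Mapping.lookup p t" using t by simp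
  finally show False using zero t by (simp add: in_keys_iff)
qed

section \<open>Brackets of Lyndon trees span Lie subrings\<close>

text \<open>
  The free Lie ring is a quotient of a ring in which the bracket satisfies no identity, so the
  theory of ideals and quotients is developed at this generality.
\<close>

locale nonassoc_ring = comm_group L for L :: "('a, 'b) lie_struct_scheme" (structure) +
  assumes lbr_closed: "\<lbrakk>x \<in> carrier L; y \<in> carrier L\<rbrakk> \<Longrightarrow> \<lbrakk>x, y\<rbrakk> \<in> carrier L"
    and lbr_add_left: "\<lbrakk>x \<in> carrier L; y \<in> carrier L; z \<in> carrier L\<rbrakk>
      \<Longrightarrow> \<lbrakk>x \<otimes> y, z\<rbrakk> = \<lbrakk>x, z\<rbrakk> \<otimes> \<lbrakk>y, z\<rbrakk>"
    and lbr_add_right: "\<lbrakk>x \<in> carrier L; y \<in> carrier L; z \<in> carrier L\<rbrakk>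
      \<Longrightarrow> \<lbrakk>x, y \<otimes> z\<rbrakk> = \<lbrakk>x, y\<rbrakk> \<otimes> \<lbrakk>x, z\<rbrakk>"
begin

lemma lbr_one_left: "x \<in> carrier L \<Longrightarrow> \<lbrakk>\<one>, x\<rbrakk> = \<one>"
  using lbr_add_left[of \<one> \<one> x] lbr_closed by simp

lemma lbr_one_right: "x \<in> carrier L \<Longrightarrow> \<lbrakk>x, \<one>\<rbrakk> = \<one>"
  using lbr_add_right[of x \<one> \<one>] lbr_closed by simp

lemma lbr_inv_left:
  assumes "x \<in> carrier L" "y \<in> carrier L"
  shows "\<lbrakk>inv x, y\<rbrakk> = inv \<lbrakk>x, y\<rbrakk>"
  using lbr_add_left[of "inv x" x y] assms
  by (intro inv_equality[symmetric]) (simp_all add: lbr_closed lbr_one_left)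

lemma lbr_inv_right:
  assumes "x \<in> carrier L" "y \<in> carrier L"
  shows "\<lbrakk>x, inv y\<rbrakk> = inv \<lbrakk>x, y\<rbrakk>"
  using lbr_add_right[of x "inv y" y] assms
  by (intro inv_equality[symmetric]) (simp_all add: lbr_closed lbr_one_right)

lemma lbr_generate_left:
  assumes "B \<subseteq> carrier L" "subgroup H L" "y \<in> carrier L" "\<And>b. b \<in> B \<Longrightarrow> \<lbrakk>b, y\<rbrakk> \<in> H" "x \<in> generate L B"
  shows "\<lbrakk>x, y\<rbrakk> \<in> H"
  using assms(5)
proof (induction x rule: generate.induct)
  case one
  then show ?case using assms(2,3) subgroup.one_closed by (simp add: lbr_one_left)
next
  case (inv h)
  then show ?case using assms(1-4) subgroup.m_inv_closed by (force simp: lbr_inv_left subset_iff)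
next
  case (eng h1 h2)
  then have "h1 \<in> carrier L" "h2 \<in> carrier L" using generate_in_carrier[OF assms(1)] by auto
  then show ?case using eng assms(3) subgroup.m_closed[OF assms(2)] by (simp add: lbr_add_left)
qed (use assms in simp)

lemma lbr_generate_right:
  assumes "B \<subseteq> carrier L" "subgroup H L" "y \<in> carrier L" "\<And>b. b \<in> B \<Longrightarrow> \<lbrakk>y, b\<rbrakk> \<in> H" "x \<in> generate L B"
  shows "\<lbrakk>y, x\<rbrakk> \<in> H"
  using assms(5)
proof (induction x rule: generate.induct)
  case one
  then show ?case using assms(2,3) subgroup.one_closed by (simp add: lbr_one_right)
next
  case (inv h)
  then show ?case using assms(1-4) subgroup.m_inv_closed by (force simp: lbr_inv_right subset_iff)
next
  case (eng h1 h2)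
  then have "h1 \<in> carrier L" "h2 \<in> carrier L" using generate_in_carrier[OF assms(1)] by auto
  then show ?case using eng assms(3) subgroup.m_closed[OF assms(2)] by (simp add: lbr_add_right)
qed (use assms in simp)

lemma lbr_generate:
  assumes B: "B \<subseteq> carrier L" and C: "C \<subseteq> carrier L" and H: "subgroup H L"
    and bc: "\<And>b c. \<lbrakk>b \<in> B; c \<in> C\<rbrakk> \<Longrightarrow> \<lbrakk>b, c\<rbrakk> \<in> H" and x: "x \<in> generate L B" and y: "y \<in> generate L C"
  shows "\<lbrakk>x, y\<rbrakk> \<in> H"
proof (rule lbr_generate_left[OF B H _ _ x])
  show "y \<in> carrier L" using generate_in_carrier[OF C y] .
  show "\<lbrakk>b, y\<rbrakk> \<in> H" if "b \<in> B" for b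
    using lbr_generate_right[OF C H _ _ y, of b] B bc that by auto
qed

lemma tree_eval_closed: "range x \<subseteq> carrier L \<Longrightarrow> tree_eval L x t \<in> carrier L"
  by (induction t) (auto intro: lbr_closed)

end

lemma lie_ring_nonassoc: "lie_ring L \<Longrightarrow> nonassoc_ring L"
  by (simp add: lie_ring_def lie_ring_axioms_def nonassoc_ring_def nonassoc_ring_axioms_def)

sublocale lie_ring \<subseteq> nonassoc_ring
  using lie_ring_axioms by (rule lie_ring_nonassoc)

context lie_ring
begin

lemma lbr_antisym:
  assumes "x \<in> carrier L" "y \<in> carrier L"
  shows "\<lbrakk>y, x\<rbrakk> = inv \<lbrakk>x, y\<rbrakk>"
proof -
  have "\<lbrakk>x \<otimes> y, x \<otimes> y\<rbrakk> = \<lbrakk>y, x\<rbrakk> \<otimes> \<lbrakk>x, y\<rbrakk>"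
    using assms lbr_add_left[of x y "x \<otimes> y"] by (simp add: lbr_add_right lbr_closed lbr_self m_comm)
  then show ?thesis
    using assms lbr_self[of "x \<otimes> y"] by (intro inv_equality[symmetric]) (simp_all add: lbr_closed)
qed

lemma lbr_leibniz_right:
  assumes "x \<in> carrier L" "y \<in> carrier L" "z \<in> carrier L"
  shows "\<lbrakk>\<lbrakk>x, y\<rbrakk>, z\<rbrakk> = \<lbrakk>\<lbrakk>x, z\<rbrakk>, y\<rbrakk> \<otimes> \<lbrakk>x, \<lbrakk>y, z\<rbrakk>\<rbrakk>"
proof -
  let ?a = "\<lbrakk>\<lbrakk>x, y\<rbrakk>, z\<rbrakk>" and ?b = "\<lbrakk>\<lbrakk>y, z\<rbrakk>, x\<rbrakk>" and ?c = "\<lbrakk>\<lbrakk>z, x\<rbrakk>, y\<rbrakk>"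
  have "?a \<otimes> (?b \<otimes> ?c) = \<one>"
    using jacobi[OF assms] assms by (simp add: m_assoc lbr_closed)
  then have "?a = inv (?b \<otimes> ?c)"
    using assms by (intro inv_equality[symmetric]) (simp_all add: lbr_closed)
  also have "\<dots> = inv ?c \<otimes> inv ?b" using assms by (simp add: inv_mult_group lbr_closed)
  also have "inv ?c = \<lbrakk>\<lbrakk>x, z\<rbrakk>, y\<rbrakk>"
    using assms lbr_antisym[of z x] by (simp add: lbr_inv_left lbr_closed)
  also have "inv ?b = \<lbrakk>x, \<lbrakk>y, z\<rbrakk>\<rbrakk>"
    using assms lbr_antisym[of "\<lbrakk>y, z\<rbrakk>" x] by (simp add: lbr_closed)
  finally show ?thesis .
qed

lemma lbr_leibniz_left:
  assumes "x \<in> carrier L" "y \<in> carrier L" "z \<in> carrier L"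
  shows "\<lbrakk>x, \<lbrakk>y, z\<rbrakk>\<rbrakk> = \<lbrakk>\<lbrakk>x, y\<rbrakk>, z\<rbrakk> \<otimes> \<lbrakk>y, \<lbrakk>x, z\<rbrakk>\<rbrakk>"
proof -
  have "\<lbrakk>y, \<lbrakk>x, z\<rbrakk>\<rbrakk> = inv \<lbrakk>\<lbrakk>x, z\<rbrakk>, y\<rbrakk>" using assms lbr_antisym[of "\<lbrakk>x, z\<rbrakk>" y] by (simp add: lbr_closed)
  then show ?thesis
    using lbr_leibniz_right[OF assms] assms by (simp add: lbr_closed m_ac)
qed

text \<open>
  The bound by a word keeps track of how far Jacobi rewriting has progressed; it is what makes the
  induction below terminate.
\<close>

definition lyndon_below :: "('c::linorder \<Rightarrow> 'a) \<Rightarrow> 'c set \<Rightarrow> nat \<Rightarrow> 'c list \<Rightarrow> 'a set" where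
  "lyndon_below x A n w = tree_eval L x ` {h. lyndon h \<and> set (foliage h) \<subseteq> A \<and> length (foliage h) = n
      \<and> foliage h < w}"

text \<open>
  Hall's rewriting.  If $s < t$ and $[s, t]$ is not itself a Lyndon tree, then $s = [s', s'']$ with
  $s'' < t$, and $[[s', s''], t] = [[s', t], s''] + [s', [s'', t]]$.  The inner brackets have smaller
  degree and are combinations of trees below $t$.  The outer brackets then have the old degree, but the
  larger of their two entries is below $t$.  So the induction is on the degree and then on the larger
  entry.
\<close>

lemma lyndon_bracket_below:
  assumes x: "range x \<subseteq> carrier L" and A: "finite (A :: 'c::linorder set)"
    and "lyndon s" "lyndon t" "set (foliage s) \<subseteq> A" "set (foliage t) \<subseteq> A"
  shows "\<lbrakk>tree_eval L x s, tree_eval L x t\<rbrakk> \<in>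
    generate L (lyndon_below x A (length (foliage s) + length (foliage t)) (max (foliage s) (foliage t)))"
proof -
  \<comment> \<open>Over a finite alphabet only finitely many words are short enough to occur, so the order of words has
      a rank.\<close>
  define words where "words n = {u :: 'c list. set u \<subseteq> A \<and> length u \<le> n}" for n
  have words: "finite (words n)" for n
    unfolding words_def by (rule finite_lists_length_le[OF A])
  define rank where "rank n w = card {u \<in> words n. u < w}" for n w
  have rank: "rank n u < rank n w" if "u \<in> words n" "u < w" for n u w
    unfolding rank_def by (rule psubset_card_mono) (use words that in auto)
  let ?B = "\<lambda>n w. lyndon_below x A n w"
  have B: "?B n w \<subseteq> carrier L" for n w
    unfolding lyndon_below_def using tree_eval_closed[of x] x by blast
  have sub: "subgroup (generate L (?B n w)) L" for n w
    by (rule generate_is_subgroup[OF B])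
  have mono: "generate L (?B n u) \<subseteq> generate L (?B n w)" if "u \<le> w" for n u w
  proof (rule mono_generate)
    show "?B n u \<subseteq> ?B n w"
      unfolding lyndon_below_def using order.strict_trans2[OF _ that] by blast
  qed
  have ev: "tree_eval L x u \<in> carrier L" for u by (rule tree_eval_closed[OF x])
  have main: "\<lbrakk>tree_eval L x s, tree_eval L x t\<rbrakk> \<in> generate L (?B n (max (foliage s) (foliage t)))"
    if "rank n (max (foliage s) (foliage t)) = k" "length (foliage s) + length (foliage t) = n"
      "lyndon s" "lyndon t" "set (foliage s) \<subseteq> A" "set (foliage t) \<subseteq> A" for n k s t
    using that
  proof (induction n arbitrary: k s t rule: less_induct)
    case (less n)
    note outer = less.IH
    from less.prems show ?case
    proof (induction k arbitrary: s t rule: less_induct)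
      case (less k)
      note inner = less.IH[OF _ HOL.refl]
      have *: "\<lbrakk>tree_eval L x s, tree_eval L x t\<rbrakk> \<in> generate L (?B n (foliage t))"
        if st: "lyndon s" "lyndon t" "set (foliage s) \<subseteq> A" "set (foliage t) \<subseteq> A" "foliage s < foliage t"
          "length (foliage s) + length (foliage t) = n" "rank n (foliage t) = k" for s t
      proof (cases "lyndon (Br s t)")
        case True
        then have "tree_eval L x (Br s t) \<in> ?B n (foliage t)"
          unfolding lyndon_below_def using lyndon_Br_less_right[OF True] st by (intro imageI) simp
        then show ?thesis by (simp add: generate.incl)
      next
        case False
        with st obtain s' s'' where s: "s = Br s' s''" and less_t: "foliage s'' < foliage t"
          by (cases s) auto
        let ?e = "tree_eval L x"
        have parts: "lyndon s'" "lyndon s''" "foliage s' < foliage s''" "set (foliage s') \<subseteq> A"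
            "set (foliage s'') \<subseteq> A"
          using st s by auto
        have s't: "foliage s' < foliage t" using parts(3) less_t by (rule less_trans)
        have step: "\<lbrakk>?e h, ?e r\<rbrakk> \<in> generate L (?B n (foliage t))"
          if h: "lyndon h" "set (foliage h) \<subseteq> A" "foliage h < foliage t"
            and r: "lyndon r" "set (foliage r) \<subseteq> A" "foliage r < foliage t"
            and n: "length (foliage h) + length (foliage r) = n" for h r
        proof -
          have m: "max (foliage h) (foliage r) < foliage t" using h r by simp
          have "max (foliage h) (foliage r) \<in> words n" using h r n by (auto simp: words_def max_def)
          then have "rank n (max (foliage h) (foliage r)) < k" using rank m st(7) by blast
          from inner[OF this n h(1) r(1) h(2) r(2)] show ?thesis using mono[of
              "max (foliage h) (foliage r)" "foliage t" n] m by (auto simp: less_imp_le)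
        qed
        have "\<lbrakk>?e s', ?e t\<rbrakk> \<in> generate L (?B (length (foliage s')
            + length (foliage t)) (max (foliage s') (foliage t)))"
          by (rule outer) (use parts st s in auto)
        then have 1: "\<lbrakk>?e s', ?e t\<rbrakk> \<in> generate L (?B (length (foliage s') + length (foliage t)) (foliage t))"
          using max_absorb2[OF less_imp_le[OF s't]] by simp
        have "\<lbrakk>?e s'', ?e t\<rbrakk> \<in> generate L (?B (length (foliage s'')
            + length (foliage t)) (max (foliage s'') (foliage t)))"
          by (rule outer) (use parts st s in auto)
        then have 2: "\<lbrakk>?e s'', ?e t\<rbrakk> \<in> generate L (?B (length (foliage s'') + length (foliage t)) (foliage t))"
          using max_absorb2[OF less_imp_le[OF less_t]] by simp
        have "\<lbrakk>\<lbrakk>?e s', ?e t\<rbrakk>, ?e s''\<rbrakk> \<in> generate L (?B n (foliage t))"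
        proof (rule lbr_generate_left[OF B sub ev _ 1])
          fix b assume "b \<in> ?B (length (foliage s') + length (foliage t)) (foliage t)"
          then show "\<lbrakk>b, ?e s''\<rbrakk> \<in> generate L (?B n (foliage t))"
            unfolding lyndon_below_def[of _ _ "length (foliage s') + length (foliage t)"]
            using step parts less_t st(6) s by auto
        qed
        moreover have "\<lbrakk>?e s', \<lbrakk>?e s'', ?e t\<rbrakk>\<rbrakk> \<in> generate L (?B n (foliage t))"
        proof (rule lbr_generate_right[OF B sub ev _ 2])
          fix b assume "b \<in> ?B (length (foliage s'') + length (foliage t)) (foliage t)"
          then show "\<lbrakk>?e s', b\<rbrakk> \<in> generate L (?B n (foliage t))"
            unfolding lyndon_below_def[of _ _ "length (foliage s'') + length (foliage t)"]
            using step parts s't st(6) s by auto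
        qed
        ultimately show ?thesis
          using lbr_leibniz_right[OF ev ev ev, of s' s'' t] generate.eng by (simp add: s)
      qed
      consider "foliage s < foliage t" | "foliage t < foliage s" | "foliage s = foliage t" by fastforce
      then show ?case
      proof cases
        case 1
        then show ?thesis using *[of s t] less.prems max_absorb2[OF less_imp_le[OF 1]] by simp
      next
        case 2
        then have "\<lbrakk>tree_eval L x t, tree_eval L x s\<rbrakk> \<in> generate L (?B n (foliage s))"
          using *[of t s] less.prems max_absorb1[OF less_imp_le[OF 2]] by (simp add: add.commute)
        then have "inv \<lbrakk>tree_eval L x t, tree_eval L x s\<rbrakk> \<in> generate L (?B n (foliage s))"
          using subgroup.m_inv_closed[OF sub] by blast
        then show ?thesis using lbr_antisym[OF ev[of t] ev[of s]] max_absorb1[OF less_imp_le[OF 2]]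
            by (simp only:)
      next
        case 3
        then have "s = t" using less.prems lyndon_foliage_inj by blast
        then show ?thesis using lbr_self[OF ev] generate.one by simp
      qed
    qed
  qed
  show ?thesis by (rule main[OF HOL.refl HOL.refl assms(3-6)])
qed

definition lyndon_span :: "('c::linorder \<Rightarrow> 'a) \<Rightarrow> 'c set \<Rightarrow> 'a set" where
  "lyndon_span x A = generate L (tree_eval L x ` {h. lyndon h \<and> set (foliage h) \<subseteq> A})"

lemma
  assumes "range x \<subseteq> carrier L"
  shows subgroup_lyndon_span: "subgroup (lyndon_span x A) L"
    and lyndon_span_lbr: "finite A \<Longrightarrow> u \<in> lyndon_span x A \<Longrightarrow> v \<in> lyndon_span x A \<Longrightarrow> \<lbrakk>u, v\<rbrakk> \<in> lyndon_span x A"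
proof -
  let ?B = "tree_eval L x ` {h. lyndon h \<and> set (foliage h) \<subseteq> A}"
  have B: "?B \<subseteq> carrier L" using tree_eval_closed[of x] assms by blast
  show sub: "subgroup (lyndon_span x A) L"
    unfolding lyndon_span_def by (rule generate_is_subgroup[OF B])
  show "\<lbrakk>u, v\<rbrakk> \<in> lyndon_span x A" if A: "finite A" and uv: "u \<in> lyndon_span x A" "v \<in> lyndon_span x A"
  proof (rule lbr_generate[OF B B sub _ uv[unfolded lyndon_span_def]])
    fix b c assume "b \<in> ?B" "c \<in> ?B"
    then obtain s t where st: "b = tree_eval L x s" "c = tree_eval L x t" "lyndon s" "lyndon t"
        "set (foliage s) \<subseteq> A" "set (foliage t) \<subseteq> A"
      by auto
    have "lyndon_below x A n w \<subseteq> ?B" for n w unfolding lyndon_below_def by blast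
    then have "generate L (lyndon_below x A n w) \<subseteq> lyndon_span x A" for n w
      unfolding lyndon_span_def by (rule mono_generate)
    then show "\<lbrakk>b, c\<rbrakk> \<in> lyndon_span x A"
      using lyndon_bracket_below[OF assms A st(3-6)] st(1,2) by blast
  qed
qed

lemma tree_eval_in_lyndon_span:
  assumes x: "range x \<subseteq> carrier L" and A: "finite A"
  shows "set (foliage t) \<subseteq> A \<Longrightarrow> tree_eval L x t \<in> lyndon_span x A"
proof (induction t)
  case (Gen a)
  then have "tree_eval L x (Gen a) \<in> tree_eval L x ` {h. lyndon h \<and> set (foliage h) \<subseteq> A}"
    by (intro imageI) simp
  then show ?case unfolding lyndon_span_def by (rule generate.incl)
next
  case (Br s t)
  then show ?case using lyndon_span_lbr[OF x A] by simp
qed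

text \<open>
  $[y, \cdot]$ is a derivation, so it maps the subring generated by the $x_i$ into itself as soon as it does so
  with the generators.
\<close>

lemma lbr_derivation_span:
  assumes x: "range x \<subseteq> carrier L" and y: "y \<in> carrier L" and A: "finite A"
    and gen: "\<And>i. i \<in> A \<Longrightarrow> \<lbrakk>y, x i\<rbrakk> \<in> lyndon_span x A"
    and u: "u \<in> lyndon_span x A"
  shows "\<lbrakk>y, u\<rbrakk> \<in> lyndon_span x A"
proof -
  have tree: "\<lbrakk>y, tree_eval L x t\<rbrakk> \<in> lyndon_span x A" if "set (foliage t) \<subseteq> A" for t
    using that
  proof (induction t)
    case (Gen a)
    then show ?case using gen by simp
  next
    case (Br s t)
    then have mem: "tree_eval L x s \<in> lyndon_span x A" "tree_eval L x t \<in> lyndon_span x A"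
      using tree_eval_in_lyndon_span[OF x A] by auto
    have "\<lbrakk>\<lbrakk>y, tree_eval L x s\<rbrakk>, tree_eval L x t\<rbrakk> \<in> lyndon_span x A"
        "\<lbrakk>tree_eval L x s, \<lbrakk>y, tree_eval L x t\<rbrakk>\<rbrakk> \<in> lyndon_span x A"
      using lyndon_span_lbr[OF x A] mem Br by auto
    then show ?case
      using lbr_leibniz_left[OF y tree_eval_closed[OF x, of s] tree_eval_closed[OF x, of t]]
        subgroup.m_closed[OF subgroup_lyndon_span[OF x]] by simp
  qed
  have B: "tree_eval L x ` {h. lyndon h \<and> set (foliage h) \<subseteq> A} \<subseteq> carrier L"
    using tree_eval_closed[of x] x by blast
  show ?thesis
    by (rule lbr_generate_right[OF B subgroup_lyndon_span[OF x] y _ u[unfolded lyndon_span_def]]) (use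
        tree in auto)
qed

lemma lbr_spans_mixed:
  assumes x: "range x \<subseteq> carrier L" and z: "range z \<subseteq> carrier L" and A: "finite A"
    and gen: "\<And>i j. i \<in> A \<Longrightarrow> j \<in> A \<Longrightarrow> \<lbrakk>z j, x i\<rbrakk> \<in> lyndon_span x A"
    and v: "v \<in> lyndon_span z A" and u: "u \<in> lyndon_span x A"
  shows "\<lbrakk>v, u\<rbrakk> \<in> lyndon_span x A"
proof -
  note sub = subgroup_lyndon_span[OF x]
  have tree: "\<lbrakk>tree_eval L z t, u\<rbrakk> \<in> lyndon_span x A" if "set (foliage t) \<subseteq> A" "u \<in> lyndon_span x A" for t u
    using that
  proof (induction t arbitrary: u)
    case (Gen a)
    have "z a \<in> carrier L" using z by blast
    with Gen show ?case using lbr_derivation_span[OF x _ A, of "z a" u] gen by simp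
  next
    case (Br s t)
    have u: "u \<in> carrier L" using Br.prems subgroup.subset[OF sub] by blast
    let ?s = "tree_eval L z s" and ?t = "tree_eval L z t"
    have c: "?s \<in> carrier L" "?t \<in> carrier L" using tree_eval_closed z by auto
    have "\<lbrakk>?t, \<lbrakk>?s, u\<rbrakk>\<rbrakk> \<in> lyndon_span x A" "\<lbrakk>?s, \<lbrakk>?t, u\<rbrakk>\<rbrakk> \<in> lyndon_span x A"
      using Br by auto
    then have "inv \<lbrakk>?t, \<lbrakk>?s, u\<rbrakk>\<rbrakk> \<otimes> \<lbrakk>?s, \<lbrakk>?t, u\<rbrakk>\<rbrakk> \<in> lyndon_span x A"
      using subgroup.m_closed[OF sub] subgroup.m_inv_closed[OF sub] by auto
    also have "inv \<lbrakk>?t, \<lbrakk>?s, u\<rbrakk>\<rbrakk> \<otimes> \<lbrakk>?s, \<lbrakk>?t, u\<rbrakk>\<rbrakk> = \<lbrakk>\<lbrakk>?s, ?t\<rbrakk>, u\<rbrakk>"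
      using lbr_leibniz_right[OF c u] lbr_antisym[of ?t "\<lbrakk>?s, u\<rbrakk>"] c u by (simp add: lbr_closed)
    finally show ?case by simp
  qed
  have B: "tree_eval L z ` {h. lyndon h \<and> set (foliage h) \<subseteq> A} \<subseteq> carrier L"
    using tree_eval_closed[of z] z by blast
  have "u \<in> carrier L" using u subgroup.subset[OF sub] by blast
  then show ?thesis
    by (rule lbr_generate_left[OF B sub _ _ v[unfolded lyndon_span_def]]) (use tree u in auto)
qed

text \<open>
  A subring acting by derivations on another one has a semidirect sum with it.
\<close>

lemma span_sum_closed:
  assumes x: "range x \<subseteq> carrier L" and z: "range z \<subseteq> carrier L" and A: "finite A"
    and gen: "\<And>i j. i \<in> A \<Longrightarrow> j \<in> A \<Longrightarrow> \<lbrakk>z j, x i\<rbrakk> \<in> lyndon_span x A"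
  defines "H \<equiv> {u \<otimes> v | u v. u \<in> lyndon_span x A \<and> v \<in> lyndon_span z A}"
  shows "subgroup H L" and "p \<in> H \<Longrightarrow> q \<in> H \<Longrightarrow> \<lbrakk>p, q\<rbrakk> \<in> H"
proof -
  note sx = subgroup_lyndon_span[OF x] and sz = subgroup_lyndon_span[OF z]
  have cx: "u \<in> carrier L" if "u \<in> lyndon_span x A" for u using that subgroup.subset[OF sx] by blast
  have cz: "u \<in> carrier L" if "u \<in> lyndon_span z A" for u using that subgroup.subset[OF sz] by blast
  have HI: "u \<otimes> v \<in> H" if "u \<in> lyndon_span x A" "v \<in> lyndon_span z A" for u v
    using that unfolding H_def by blast
  have mult: "p \<otimes> q \<in> H" if "p \<in> H" "q \<in> H" for p q
  proof -
    from that obtain u v u' v' where *: "p = u \<otimes> v" "q = u' \<otimes> v'" "u \<in> lyndon_span x A" "u' \<in> lyndon_span x A"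
      "v \<in> lyndon_span z A" "v' \<in> lyndon_span z A" unfolding H_def by blast
    then have "p \<otimes> q = (u \<otimes> u') \<otimes> (v \<otimes> v')" using cx cz by (simp add: m_ac)
    then show ?thesis using * HI subgroup.m_closed[OF sx] subgroup.m_closed[OF sz] by simp
  qed
  show sub: "subgroup H L"
  proof (rule subgroupI)
    show "H \<subseteq> carrier L" unfolding H_def using cx cz by auto
    show "H \<noteq> {}" using HI[OF subgroup.one_closed[OF sx] subgroup.one_closed[OF sz]] by blast
    fix p assume "p \<in> H"
    then obtain u v where *: "p = u \<otimes> v" "u \<in> lyndon_span x A" "v \<in> lyndon_span z A" unfolding H_def by blast
    then have "inv p = inv u \<otimes> inv v" using cx cz by (simp add: inv_mult)
    then show "inv p \<in> H" using * HI subgroup.m_inv_closed[OF sx] subgroup.m_inv_closed[OF sz] by simp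
  qed (rule mult)
  have xz: "u \<in> H" if "u \<in> lyndon_span x A" for u
    using HI[OF that subgroup.one_closed[OF sz]] cx that by simp
  have zz: "u \<in> H" if "u \<in> lyndon_span z A" for u
    using HI[OF subgroup.one_closed[OF sx] that] cz that by simp
  show "\<lbrakk>p, q\<rbrakk> \<in> H" if pq: "p \<in> H" "q \<in> H"
  proof -
    from pq obtain u v u' v' where *: "p = u \<otimes> v" "q = u' \<otimes> v'" "u \<in> lyndon_span x A" "u' \<in> lyndon_span x A"
      "v \<in> lyndon_span z A" "v' \<in> lyndon_span z A" unfolding H_def by blast
    then have c: "u \<in> carrier L" "v \<in> carrier L" "u' \<in> carrier L" "v' \<in> carrier L" using cx cz by auto
    have 1: "\<lbrakk>u, u'\<rbrakk> \<in> H" "\<lbrakk>v, v'\<rbrakk> \<in> H" "\<lbrakk>v, u'\<rbrakk> \<in> H"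
      using xz[OF lyndon_span_lbr[OF x A]] zz[OF lyndon_span_lbr[OF z A]] xz[OF lbr_spans_mixed[OF x z A
          gen]] * by auto
    have "inv \<lbrakk>v', u\<rbrakk> \<in> H"
      using subgroup.m_inv_closed[OF sub] xz[OF lbr_spans_mixed[OF x z A gen]] * by auto
    then have 2: "\<lbrakk>u, v'\<rbrakk> \<in> H" using lbr_antisym[of v' u] c by simp
    have "\<lbrakk>p, q\<rbrakk> = (\<lbrakk>u, u'\<rbrakk> \<otimes> \<lbrakk>u, v'\<rbrakk>) \<otimes> (\<lbrakk>v, u'\<rbrakk> \<otimes> \<lbrakk>v, v'\<rbrakk>)"
      using c by (simp add: * lbr_add_left lbr_add_right lbr_closed m_ac)
    then show ?thesis using mult[OF mult[OF 1(1) 2] mult[OF 1(3) 1(2)]] by simp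
  qed
qed

end

section \<open>Integral combinations of trees\<close>

text \<open>
  The additive extension of evaluation at trees; the free abelian group has exactly one such homomorphism.
\<close>

definition lie_eval :: "('b, 'c) lie_struct_scheme \<Rightarrow> ('a \<Rightarrow> 'b) \<Rightarrow> ('a magma \<Rightarrow>\<^sub>0 int) \<Rightarrow> 'b" where
  "lie_eval K x = (SOME h. h \<in> hom (free_Abelian_group UNIV) K \<and> (\<forall>t. h (frag_of t) = tree_eval K x t))"

context nonassoc_ring
begin

lemma
  assumes "range x \<subseteq> carrier L"
  shows lie_eval_hom: "lie_eval L x \<in> hom (free_Abelian_group UNIV) L"
    and lie_eval_frag_of: "lie_eval L x (frag_of t) = tree_eval L x t"
proof -
  have rng: "range (tree_eval L x) \<subseteq> carrier L" using tree_eval_closed[OF assms] by blast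
  then obtain h where "h \<in> hom (free_Abelian_group UNIV) L" "\<And>t. h (frag_of t) = tree_eval L x t"
    using free_Abelian_group_universal[OF rng] by (metis (no_types) UNIV_I)
  then have "\<exists>h. h \<in> hom (free_Abelian_group UNIV) L \<and> (\<forall>t. h (frag_of t) = tree_eval L x t)" by blast
  from someI_ex[OF this]
  show "lie_eval L x \<in> hom (free_Abelian_group UNIV) L" "lie_eval L x (frag_of t) = tree_eval L x t"
    unfolding lie_eval_def by auto
qed

lemma lie_eval_simps:
  assumes "range x \<subseteq> carrier L"
  shows "lie_eval L x p \<in> carrier L" "lie_eval L x (p + q) = lie_eval L x p \<otimes> lie_eval L x q"
    "lie_eval L x 0 = \<one>" "lie_eval L x (- p) = inv (lie_eval L x p)"
    "lie_eval L x (p - q) = lie_eval L x p \<otimes> inv (lie_eval L x q)"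
proof -
  interpret group_hom "free_Abelian_group UNIV" L "lie_eval L x"
    using lie_eval_hom[OF assms] by (simp add: group_hom_def group_hom_axioms_def)
  show "lie_eval L x p \<in> carrier L" for p using hom_closed[of p] by simp
  show add: "lie_eval L x (p + q) = lie_eval L x p \<otimes> lie_eval L x q" for p q using hom_mult[of p q] by simp
  show "lie_eval L x 0 = \<one>" using hom_one by simp
  show minus: "lie_eval L x (- p) = inv (lie_eval L x p)" for p using hom_inv[of p] by simp
  show "lie_eval L x (p - q) = lie_eval L x p \<otimes> inv (lie_eval L x q)"
    using add[of p "- q"] minus by simp
qed

end

lemma (in lie_ring) lyndon_span_lie_eval:
  assumes x: "range x \<subseteq> carrier L" and "u \<in> lyndon_span x A"
  shows "\<exists>p. Poly_Mapping.keys p \<subseteq> {t. lyndon t \<and> set (foliage t) \<subseteq> A} \<and> u = lie_eval L x p"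
  using assms(2) unfolding lyndon_span_def
proof (induction u rule: generate.induct)
  case one
  then show ?case using lie_eval_simps(3)[OF x] by (intro exI[of _ 0]) simp
next
  case (incl h)
  then obtain t where t: "lyndon t" "set (foliage t) \<subseteq> A" "h = tree_eval L x t" by blast
  then show ?case using lie_eval_frag_of[OF x] by (intro exI[of _ "frag_of t"]) simp
next
  case (inv h)
  then obtain t where t: "lyndon t" "set (foliage t) \<subseteq> A" "h = tree_eval L x t" by blast
  then show ?case using lie_eval_frag_of[OF x] lie_eval_simps(4)[OF x] by (intro exI[of _ "- frag_of t"]) simp
next
  case (eng h1 h2)
  then obtain p q where pq: "Poly_Mapping.keys p \<subseteq> {t. lyndon t \<and> set (foliage t) \<subseteq> A}" "h1 = lie_eval L x p"
    "Poly_Mapping.keys q \<subseteq> {t. lyndon t \<and> set (foliage t) \<subseteq> A}" "h2 = lie_eval L x q" by blast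
  then have "Poly_Mapping.keys (p + q) \<subseteq> {t. lyndon t \<and> set (foliage t) \<subseteq> A}"
    using keys_add[of p q] by blast
  then show ?case using pq lie_eval_simps(2)[OF x] by (intro exI[of _ "p + q"]) simp
qed

lemma (in nonassoc_ring) lie_eval_cong:
  assumes x: "range x \<subseteq> carrier L" and y: "range y \<subseteq> carrier L"
    and p: "Poly_Mapping.keys p \<subseteq> {t. lyndon t \<and> set (foliage t) \<subseteq> A}" and eq: "\<And>i. i \<in> A \<Longrightarrow> x i = y i"
  shows "lie_eval L x p = lie_eval L y p"
proof -
  have tree: "tree_eval L x t = tree_eval L y t" if "set (foliage t) \<subseteq> A" for t
    using that eq by (induction t) auto
  show ?thesis
    using p
  proof (induction p rule: frag_induction)
    case (one t)
    then show ?case using tree by (simp add: lie_eval_frag_of[OF x] lie_eval_frag_of[OF y])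
  qed (simp_all add: lie_eval_simps[OF x] lie_eval_simps[OF y])
qed

definition lie_hom :: "('a, 'c) lie_struct_scheme \<Rightarrow> ('b, 'd) lie_struct_scheme \<Rightarrow> ('a \<Rightarrow> 'b) set" where
  "lie_hom L K = {h \<in> hom L K. \<forall>x \<in> carrier L. \<forall>y \<in> carrier L. h \<lbrakk>x, y\<rbrakk>\<^bsub>L\<^esub> = \<lbrakk>h x, h y\<rbrakk>\<^bsub>K\<^esub>}"

lemma lie_eval_lie_hom:
  assumes "nonassoc_ring L" "nonassoc_ring K" and f: "f \<in> lie_hom L K" and x: "range x \<subseteq> carrier L"
  shows "f (lie_eval L x p) = lie_eval K (\<lambda>i. f (x i)) p"
proof -
  interpret L: nonassoc_ring L by fact
  interpret K: nonassoc_ring K by fact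
  interpret f: group_hom L K f
    using f by (simp add: lie_hom_def group_hom_def group_hom_axioms_def L.is_group K.is_group)
  have fx: "range (\<lambda>i. f (x i)) \<subseteq> carrier K" using x by auto
  have tree: "f (tree_eval L x t) = tree_eval K (\<lambda>i. f (x i)) t" for t
    using f L.tree_eval_closed[OF x] by (induction t) (auto simp: lie_hom_def)
  have "Poly_Mapping.keys p \<subseteq> UNIV" by simp
  then show ?thesis
  proof (induction p rule: frag_induction)
    case zero
    show ?case using L.lie_eval_simps(3)[OF x] K.lie_eval_simps(3)[OF fx] by simp
  next
    case (one t)
    show ?case using L.lie_eval_frag_of[OF x] K.lie_eval_frag_of[OF fx] tree by simp
  next
    case (diff a b)
    then show ?case
      using L.lie_eval_simps[OF x] K.lie_eval_simps[OF fx] by simp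
  qed
qed

lemma lie_ring_assoc_lie: "lie_ring (assoc_lie :: 'r::ring lie_struct)"
proof -
  have "comm_group (assoc_lie :: 'r lie_struct)"
    by (rule comm_groupI) (auto simp: algebra_simps intro: exI[of _ "- x" for x])
  then show ?thesis
    by (simp add: lie_ring_def lie_ring_axioms_def algebra_simps)
qed

text \<open>
  The Magnus embedding of the free Lie ring, read on its spanning set of Lyndon trees.
\<close>

lemma lyndon_eval_injective:
  assumes "Poly_Mapping.keys p \<subseteq> {t. lyndon t}" "lie_eval assoc_lie indet p = 0"
  shows "p = 0"
proof -
  interpret S: lie_ring "assoc_lie :: series lie_struct" by (rule lie_ring_assoc_lie)
  let ?e = "lie_eval assoc_lie indet"
  have add: "?e (p + q) = ?e p + ?e q" "?e 0 = 0" for p q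
    using S.lie_eval_simps[of indet] by simp_all
  have diff: "?e (p - q) = ?e p - ?e q" for p q
    using add(1)[of "p - q" q] by (simp add: algebra_simps)
  have sum: "?e (sum g I) = (\<Sum>i\<in>I. ?e (g i))" for g :: "nat magma \<Rightarrow> _" and I
    by (induction I rule: infinite_finite_induct) (auto simp: add)
  have cmul: "?e (frag_cmul n q) = of_int n * ?e q" for n q
    by (induction n rule: int_induct[where k = 0]) (simp_all add: frag_cmul_distrib frag_cmul_diff_distrib
        add diff algebra_simps)
  have "?e p = ?e (frag_extend frag_of p)" by (simp flip: frag_expansion)
  also have "\<dots> = (\<Sum>t \<in> Poly_Mapping.keys p. of_int (Poly_Mapping.lookup p t) * bracket_poly t)"
    using S.lie_eval_frag_of[of indet] by (simp add: frag_extend_def sum cmul)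
  finally show ?thesis using lyndon_bracket_polys_independent assms by simp
qed

section \<open>Quotients and the free Lie ring\<close>

lemma comm_group_truncate:
  assumes "comm_group A"
  shows "comm_group \<lparr>carrier = carrier A, monoid.mult = monoid.mult A, one = one A, \<dots> = z\<rparr>"
proof -
  interpret comm_group A by fact
  show ?thesis
    by (rule comm_groupI) (simp_all add: m_ac l_inv_ex)
qed

context nonassoc_ring
begin

lemma lie_ideal_Inter:
  assumes "\<And>I. I \<in> F \<Longrightarrow> lie_ideal I L" "F \<noteq> {}"
  shows "lie_ideal (\<Inter>F) L"
  using assms subgroups_Inter[of F] unfolding lie_ideal_def by blast

lemma lie_ideal_gen:
  assumes "S \<subseteq> carrier L"
  shows "lie_ideal (gen_lie_ideal L S) L" "S \<subseteq> gen_lie_ideal L S"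
proof -
  have "lie_ideal (carrier L) L"
    unfolding lie_ideal_def using lbr_closed subgroup_self by auto
  then have "{I. lie_ideal I L \<and> S \<subseteq> I} \<noteq> {}" using assms by blast
  then show "lie_ideal (gen_lie_ideal L S) L"
    unfolding gen_lie_ideal_def by (intro lie_ideal_Inter) auto
  show "S \<subseteq> gen_lie_ideal L S" unfolding gen_lie_ideal_def by blast
qed

lemma gen_lie_ideal_least: "lie_ideal I L \<Longrightarrow> S \<subseteq> I \<Longrightarrow> gen_lie_ideal L S \<subseteq> I"
  unfolding gen_lie_ideal_def by blast

lemma lie_ideal_normal: "lie_ideal I L \<Longrightarrow> I \<lhd> L"
  unfolding lie_ideal_def using subgroup_imp_normal by blast

end

lemma carrier_lie_quot: "carrier (lie_quot L I) = (\<lambda>a. I #>\<^bsub>L\<^esub> a) ` carrier L"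
  by (simp add: lie_quot_def carrier_FactGroup)

lemma one_lie_quot: "\<one>\<^bsub>lie_quot L I\<^esub> = I"
  by (simp add: lie_quot_def)

context nonassoc_ring
begin

lemma coset_eq_iff:
  assumes "lie_ideal I L" "a \<in> carrier L" "b \<in> carrier L"
  shows "I #> a = I #> b \<longleftrightarrow> (\<exists>k \<in> I. a = k \<otimes> b)"
proof
  have sub: "subgroup I L" using assms(1) by (simp add: lie_ideal_def)
  show "\<exists>k \<in> I. a = k \<otimes> b" if "I #> a = I #> b"
    using rcos_self[OF assms(2) sub] that unfolding r_coset_def by auto
  show "I #> a = I #> b" if "\<exists>k \<in> I. a = k \<otimes> b"
  proof -
    from that have "a \<in> I #> b" unfolding r_coset_def by auto
    then show ?thesis using repr_independence[OF _ assms(3) sub] by blast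
  qed
qed

lemma mult_lie_quot:
  assumes "lie_ideal I L" "a \<in> carrier L" "b \<in> carrier L"
  shows "(I #> a) \<otimes>\<^bsub>lie_quot L I\<^esub> (I #> b) = I #> (a \<otimes> b)"
  using normal.rcos_sum[OF lie_ideal_normal[OF assms(1)] assms(2,3)] by (simp add: lie_quot_def)

lemma lbr_lie_quot:
  assumes I: "lie_ideal I L" and a: "a \<in> carrier L" and b: "b \<in> carrier L"
  shows "\<lbrakk>I #> a, I #> b\<rbrakk>\<^bsub>lie_quot L I\<^esub> = I #> \<lbrakk>a, b\<rbrakk>"
proof -
  have sub: "subgroup I L" and ideal: "\<And>k x. k \<in> I \<Longrightarrow> x \<in> carrier L \<Longrightarrow> \<lbrakk>k, x\<rbrakk> \<in> I \<and> \<lbrakk>x, k\<rbrakk> \<in> I"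
    using I by (auto simp: lie_ideal_def)
  have Ic: "\<And>k. k \<in> I \<Longrightarrow> k \<in> carrier L" using subgroup.subset[OF sub] by blast
  have same: "I #> \<lbrakk>a', b'\<rbrakk> = I #> \<lbrakk>a, b\<rbrakk>" if ab: "a' \<in> I #> a" "b' \<in> I #> b" for a' b'
  proof -
    from ab obtain k l where k: "k \<in> I" "a' = k \<otimes> a" and l: "l \<in> I" "b' = l \<otimes> b"
      unfolding r_coset_def by blast
    have kl: "k \<in> carrier L" "l \<in> carrier L" using k l Ic by auto
    have mem: "\<lbrakk>k, l\<rbrakk> \<otimes> \<lbrakk>k, b\<rbrakk> \<otimes> \<lbrakk>a, l\<rbrakk> \<in> I"
      using subgroup.m_closed[OF sub] ideal k l a b kl by simp
    have "\<lbrakk>a', b'\<rbrakk> = (\<lbrakk>k, l\<rbrakk> \<otimes> \<lbrakk>k, b\<rbrakk> \<otimes> \<lbrakk>a, l\<rbrakk>) \<otimes> \<lbrakk>a, b\<rbrakk>"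
      using kl a b by (simp add: k(2) l(2) lbr_add_left lbr_add_right lbr_closed m_ac)
    then show ?thesis
      using coset_eq_iff[OF I, of "\<lbrakk>a', b'\<rbrakk>" "\<lbrakk>a, b\<rbrakk>"] mem kl a b by (auto simp: k(2) l(2) lbr_closed)
  qed
  have "I #> a \<noteq> {}" "I #> b \<noteq> {}" using rcos_self sub a b by blast+
  moreover have "(\<Union>a' \<in> I #> a. \<Union>b' \<in> I #> b. I #> \<lbrakk>a', b'\<rbrakk>) = (\<Union>a' \<in> I #> a. \<Union>b' \<in> I #> b. I #> \<lbrakk>a, b\<rbrakk>)"
    using same by (intro SUP_cong HOL.refl)
  ultimately show ?thesis by (simp add: lie_quot_def)
qed

theorem lie_ring_lie_quot:
  assumes I: "lie_ideal I L" and rel: "lie_relators L \<subseteq> I"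
  shows "lie_ring (lie_quot L I)"
proof -
  let ?Q = "lie_quot L I"
  have "comm_group (L Mod I)"
    using I by (intro abelian_FactGroup) (simp add: lie_ideal_def)
  then have "comm_group ?Q" unfolding lie_quot_def by (rule comm_group_truncate)
  then interpret Q: comm_group ?Q .
  have one: "I #> a = I" if "a \<in> I" for a
    using that I subgroup.subset coset_join2[of a I] unfolding lie_ideal_def by blast
  show ?thesis
  proof unfold_locales
    fix x y z assume "x \<in> carrier ?Q" "y \<in> carrier ?Q" "z \<in> carrier ?Q"
    then obtain a b c where abc: "x = I #> a" "y = I #> b" "z = I #> c" "a \<in> carrier L" "b \<in> carrier L"
        "c \<in> carrier L"
      by (auto simp: carrier_lie_quot)
    have "\<lbrakk>\<lbrakk>a, b\<rbrakk>, c\<rbrakk> \<otimes> \<lbrakk>\<lbrakk>b, c\<rbrakk>, a\<rbrakk> \<otimes> \<lbrakk>\<lbrakk>c, a\<rbrakk>, b\<rbrakk> \<in> I"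
      using rel abc unfolding lie_relators_def by blast
    then show "\<lbrakk>\<lbrakk>x, y\<rbrakk>\<^bsub>?Q\<^esub>, z\<rbrakk>\<^bsub>?Q\<^esub> \<otimes>\<^bsub>?Q\<^esub> \<lbrakk>\<lbrakk>y, z\<rbrakk>\<^bsub>?Q\<^esub>, x\<rbrakk>\<^bsub>?Q\<^esub> \<otimes>\<^bsub>?Q\<^esub> \<lbrakk>\<lbrakk>z, x\<rbrakk>\<^bsub>?Q\<^esub>, y\<rbrakk>\<^bsub>?Q\<^esub> = \<one>\<^bsub>?Q\<^esub>"
      using abc by (simp add: lbr_lie_quot[OF I] mult_lie_quot[OF I] lbr_closed one_lie_quot one)
    show "\<lbrakk>x, y\<rbrakk>\<^bsub>?Q\<^esub> \<in> carrier ?Q"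
      using abc by (auto simp: lbr_lie_quot[OF I] carrier_lie_quot lbr_closed)
    show "\<lbrakk>x \<otimes>\<^bsub>?Q\<^esub> y, z\<rbrakk>\<^bsub>?Q\<^esub> = \<lbrakk>x, z\<rbrakk>\<^bsub>?Q\<^esub> \<otimes>\<^bsub>?Q\<^esub> \<lbrakk>y, z\<rbrakk>\<^bsub>?Q\<^esub>"
      "\<lbrakk>x, y \<otimes>\<^bsub>?Q\<^esub> z\<rbrakk>\<^bsub>?Q\<^esub> = \<lbrakk>x, y\<rbrakk>\<^bsub>?Q\<^esub> \<otimes>\<^bsub>?Q\<^esub> \<lbrakk>x, z\<rbrakk>\<^bsub>?Q\<^esub>"
      using abc by (simp_all add: lbr_lie_quot[OF I] mult_lie_quot[OF I] lbr_closed lbr_add_left lbr_add_right)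
  next
    fix x assume "x \<in> carrier ?Q"
    then obtain a where a: "x = I #> a" "a \<in> carrier L" by (auto simp: carrier_lie_quot)
    then have "\<lbrakk>a, a\<rbrakk> \<in> I" using rel unfolding lie_relators_def by blast
    then show "\<lbrakk>x, x\<rbrakk>\<^bsub>?Q\<^esub> = \<one>\<^bsub>?Q\<^esub>"
      using a by (simp add: lbr_lie_quot[OF I] one_lie_quot one)
  qed
qed

lemma quot_map_lie_hom:
  assumes I: "lie_ideal I L"
  shows "(\<lambda>a. I #> a) \<in> lie_hom L (lie_quot L I)"
  unfolding lie_hom_def hom_def
  using lbr_lie_quot[OF I] mult_lie_quot[OF I] by (auto simp: carrier_lie_quot)

lemma lie_hom_kernel_ideal:
  assumes "nonassoc_ring K" "f \<in> lie_hom L K"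
  shows "lie_ideal {a \<in> carrier L. f a = \<one>\<^bsub>K\<^esub>} L"
proof -
  interpret K: nonassoc_ring K by fact
  interpret f: group_hom L K f
    using assms(2) by (simp add: lie_hom_def group_hom_def group_hom_axioms_def is_group K.is_group)
  have "subgroup {a \<in> carrier L. f a = \<one>\<^bsub>K\<^esub>} L"
    using f.subgroup_kernel by (simp add: kernel_def)
  then show ?thesis
    using assms(2) by (auto simp: lie_ideal_def lie_hom_def lbr_closed K.lbr_one_left K.lbr_one_right)
qed

lemma lie_quot_universal:
  assumes I: "lie_ideal I L" and K: "nonassoc_ring K" and f: "f \<in> lie_hom L K"
    and ker: "\<And>a. a \<in> I \<Longrightarrow> f a = \<one>\<^bsub>K\<^esub>"
  obtains g where "g \<in> lie_hom (lie_quot L I) K" "\<And>a. a \<in> carrier L \<Longrightarrow> g (I #> a) = f a"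
proof -
  interpret K: nonassoc_ring K by fact
  interpret f: group_hom L K f
    using f by (simp add: lie_hom_def group_hom_def group_hom_axioms_def is_group K.is_group)
  have Ic: "\<And>k. k \<in> I \<Longrightarrow> k \<in> carrier L" using I subgroup.subset unfolding lie_ideal_def by blast
  define g where "g A = f (SOME a. a \<in> carrier L \<and> A = I #> a)" for A
  have g: "g (I #> a) = f a" if a: "a \<in> carrier L" for a
  proof -
    let ?b = "SOME b. b \<in> carrier L \<and> I #> a = I #> b"
    have b: "?b \<in> carrier L \<and> I #> a = I #> ?b" by (rule someI[of _ a]) (use a in simp)
    then obtain k where k: "k \<in> I" "a = k \<otimes> ?b" using coset_eq_iff[OF I a, of ?b] by blast
    have "f a = f k \<otimes>\<^bsub>K\<^esub> f ?b" using f.hom_mult[of k ?b] Ic k b by metis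
    then show ?thesis unfolding g_def using ker k b by simp
  qed
  have "g \<in> lie_hom (lie_quot L I) K"
    using f unfolding lie_hom_def hom_def
    by (auto simp: carrier_lie_quot g mult_lie_quot[OF I] lbr_lie_quot[OF I] lbr_closed)
  with g show thesis using that by blast
qed

end

lemma (in lie_ring) lie_relators_trivial: "lie_ideal I L \<Longrightarrow> lie_relators L \<subseteq> I"
  unfolding lie_relators_def lie_ideal_def using subgroup.one_closed lbr_self jacobi by fastforce

text \<open>
  The bracket of the free non-associative ring extends twice; this gives additivity in its second argument.
\<close>

lemma frag_extend_add_fun:
  "frag_extend (\<lambda>s. a s + b s) p = frag_extend a p + frag_extend b p"
  by (simp add: frag_extend_def frag_cmul_distrib2 sum.distrib)

lemma free_nonassoc_simps [simp]:
  "carrier (free_nonassoc X) = {p. Poly_Mapping.keys p \<subseteq> {t. set_magma t \<subseteq> X}}"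
  "p \<otimes>\<^bsub>free_nonassoc X\<^esub> q = p + q" "\<one>\<^bsub>free_nonassoc X\<^esub> = 0"
  "\<lbrakk>p, q\<rbrakk>\<^bsub>free_nonassoc X\<^esub> = frag_extend (\<lambda>s. frag_extend (\<lambda>t. frag_of (Br s t)) q) p"
proof -
  show "carrier (free_nonassoc X) = {p. Poly_Mapping.keys p \<subseteq> {t. set_magma t \<subseteq> X}}"
    by (simp add: set_eq_iff free_nonassoc_def Let_def)
qed (simp_all add: free_nonassoc_def Let_def)

lemma nonassoc_ring_free: "nonassoc_ring (free_nonassoc X)"
proof -
  have "comm_group (free_nonassoc X)"
    unfolding free_nonassoc_def Let_def by (rule comm_group_truncate[OF abelian_free_Abelian_group])
  moreover have "\<lbrakk>p, q\<rbrakk>\<^bsub>free_nonassoc X\<^esub> \<in> carrier (free_nonassoc X)"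
    if pq: "p \<in> carrier (free_nonassoc X)" "q \<in> carrier (free_nonassoc X)" for p q
  proof -
    have q: "\<forall>t \<in> Poly_Mapping.keys q. set_magma t \<subseteq> X" and p: "\<forall>t \<in> Poly_Mapping.keys p. set_magma t \<subseteq> X"
      using pq by auto
    have 1: "Poly_Mapping.keys (frag_extend (\<lambda>t. frag_of (Br s t)) q) \<subseteq> {t. set_magma t \<subseteq> X}" if
        "set_magma s \<subseteq> X" for s
      by (intro order.trans[OF keys_frag_extend] UN_least) (use q that in simp)
    have "Poly_Mapping.keys (frag_extend (\<lambda>s. frag_extend (\<lambda>t. frag_of (Br s t)) q) p) \<subseteq> {t. set_magma t \<subseteq> X}"
      by (intro order.trans[OF keys_frag_extend] UN_least 1) (use p in simp)
    then show ?thesis by simp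
  qed
  ultimately show ?thesis
    by (simp add: nonassoc_ring_def nonassoc_ring_axioms_def frag_extend_add frag_extend_add_fun)
qed

lemma lie_eval_lie_hom_free:
  assumes "lie_ring K" and x: "range x \<subseteq> carrier K"
  shows "lie_eval K x \<in> lie_hom (free_nonassoc X) K"
proof -
  interpret K: lie_ring K by fact
  note e = K.lie_eval_simps[OF x] and e1 = K.lie_eval_frag_of[OF x]
  have 1: "lie_eval K x (frag_extend (\<lambda>t. frag_of (Br s t)) q) = \<lbrakk>tree_eval K x s, lie_eval K x q\<rbrakk>\<^bsub>K\<^esub>" for s q
  proof -
    have "Poly_Mapping.keys q \<subseteq> UNIV" by simp
    then show ?thesis
    proof (induction q rule: frag_induction)
      case zero
      show ?case using K.tree_eval_closed[OF x] by (simp add: e K.lbr_one_right)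
    next
      case (diff a b)
      then show ?case
        using K.tree_eval_closed[OF x] by (simp add: e frag_extend_diff K.lbr_add_right K.lbr_inv_right)
    qed (simp add: e1)
  qed
  have "lie_eval K x (frag_extend (\<lambda>s. frag_extend (\<lambda>t. frag_of (Br s t)) q) p)
      = \<lbrakk>lie_eval K x p, lie_eval K x q\<rbrakk>\<^bsub>K\<^esub>" for p q
  proof -
    have "Poly_Mapping.keys p \<subseteq> UNIV" by simp
    then show ?thesis
    proof (induction p rule: frag_induction)
      case zero
      show ?case by (simp add: e K.lbr_one_left)
    next
      case (diff a b)
      then show ?case
        by (simp add: e frag_extend_diff K.lbr_add_left K.lbr_inv_left)
    qed (simp add: e1 1)
  qed
  then show ?thesis
    unfolding lie_hom_def hom_def by (simp add: e)
qed

lemma lie_relators_closed: "nonassoc_ring N \<Longrightarrow> lie_relators N \<subseteq> carrier N"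
proof -
  assume "nonassoc_ring N"
  then interpret nonassoc_ring N .
  show ?thesis unfolding lie_relators_def using lbr_closed by auto
qed

text \<open>
  The relators are the left-hand sides of identities that hold in the target.
\<close>

lemma lie_hom_lie_relators:
  assumes "nonassoc_ring N" "lie_ring K" and f: "f \<in> lie_hom N K" and r: "r \<in> lie_relators N"
  shows "f r = \<one>\<^bsub>K\<^esub>"
proof -
  interpret N: nonassoc_ring N by fact
  interpret K: lie_ring K by fact
  have fl: "\<And>a b. a \<in> carrier N \<Longrightarrow> b \<in> carrier N \<Longrightarrow> f \<lbrakk>a, b\<rbrakk>\<^bsub>N\<^esub> = \<lbrakk>f a, f b\<rbrakk>\<^bsub>K\<^esub>"
    and fm: "\<And>a b. a \<in> carrier N \<Longrightarrow> b \<in> carrier N \<Longrightarrow> f (a \<otimes>\<^bsub>N\<^esub> b) = f a \<otimes>\<^bsub>K\<^esub> f b"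
    and fc: "\<And>a. a \<in> carrier N \<Longrightarrow> f a \<in> carrier K"
    using f by (auto simp: lie_hom_def hom_def)
  show ?thesis
    using r unfolding lie_relators_def by (auto simp: fl fm fc N.lbr_closed K.lbr_self K.jacobi)
qed

lemma lie_ideal_free_lie_kernel: "lie_ideal (free_lie_kernel X) (free_nonassoc X)"
  "lie_relators (free_nonassoc X) \<subseteq> free_lie_kernel X"
  using nonassoc_ring.lie_ideal_gen[OF nonassoc_ring_free lie_relators_closed[OF nonassoc_ring_free], of X]
  by (simp_all add: free_lie_kernel_def)

lemma lie_ring_free_lie: "lie_ring (free_lie X)"
  unfolding free_lie_def using nonassoc_ring.lie_ring_lie_quot[OF nonassoc_ring_free
      lie_ideal_free_lie_kernel] .

lemma free_lie_gen_closed: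
  assumes "i \<in> X" shows "free_lie_gen X i \<in> carrier (free_lie X)"
  unfolding free_lie_gen_def free_lie_def carrier_lie_quot using assms by (intro imageI) simp

lemma free_lie_universal:
  assumes "lie_ring K" and x: "range x \<subseteq> carrier K"
  obtains g where "g \<in> lie_hom (free_lie X) K" "\<And>i. i \<in> X \<Longrightarrow> g (free_lie_gen X i) = x i"
proof -
  interpret K: lie_ring K by fact
  interpret N: nonassoc_ring "free_nonassoc X" by (rule nonassoc_ring_free)
  note f = lie_eval_lie_hom_free[OF assms, of X]
  have K: "nonassoc_ring K" using assms(1) by (rule lie_ring_nonassoc)
  have "free_lie_kernel X \<subseteq> {a \<in> carrier (free_nonassoc X). lie_eval K x a = \<one>\<^bsub>K\<^esub>}"
    unfolding free_lie_kernel_def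
    using lie_hom_lie_relators[OF nonassoc_ring_free assms(1) f] lie_relators_closed[OF nonassoc_ring_free]
    by (intro N.gen_lie_ideal_least N.lie_hom_kernel_ideal[OF K f]) blast
  then have ker: "lie_eval K x a = \<one>\<^bsub>K\<^esub>" if "a \<in> free_lie_kernel X" for a using that by blast
  obtain g where g: "g \<in> lie_hom (free_lie X) K"
    "\<And>a. a \<in> carrier (free_nonassoc X) \<Longrightarrow> g (free_lie_kernel X #>\<^bsub>free_nonassoc X\<^esub> a) = lie_eval K x a"
    unfolding free_lie_def using N.lie_quot_universal[OF lie_ideal_free_lie_kernel(1) K f ker] by blast
  have "g (free_lie_gen X i) = x i" if "i \<in> X" for i
    using g(2)[of "frag_of (Gen i)"] that K.lie_eval_frag_of[OF x, of "Gen i"] by (simp add: free_lie_gen_def)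
  with g(1) show thesis using that by blast
qed

lemma free_lie_generated:
  assumes H: "subgroup H (free_lie X)" and lbr: "\<And>a b. a \<in> H \<Longrightarrow> b \<in> H \<Longrightarrow> \<lbrakk>a, b\<rbrakk>\<^bsub>free_lie X\<^esub> \<in> H"
    and gen: "\<And>i. i \<in> X \<Longrightarrow> free_lie_gen X i \<in> H"
  shows "H = carrier (free_lie X)"
proof -
  interpret N: nonassoc_ring "free_nonassoc X" by (rule nonassoc_ring_free)
  interpret L: lie_ring "free_lie X" by (rule lie_ring_free_lie)
  let ?q = "\<lambda>a. free_lie_kernel X #>\<^bsub>free_nonassoc X\<^esub> a"
  have q: "?q \<in> lie_hom (free_nonassoc X) (free_lie X)"
    unfolding free_lie_def by (rule N.quot_map_lie_hom[OF lie_ideal_free_lie_kernel(1)])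
  interpret q: group_hom "free_nonassoc X" "free_lie X" ?q
    using q by (simp add: lie_hom_def group_hom_def group_hom_axioms_def N.is_group L.is_group)
  have tree: "?q (frag_of t) \<in> H" if "set_magma t \<subseteq> X" for t
    using that
  proof (induction t)
    case (Gen i)
    then show ?case using gen[of i] by (simp add: free_lie_gen_def)
  next
    case (Br s t)
    then have "\<lbrakk>?q (frag_of s), ?q (frag_of t)\<rbrakk>\<^bsub>free_lie X\<^esub> \<in> H" using lbr by simp
    moreover have "\<lbrakk>?q (frag_of s), ?q (frag_of t)\<rbrakk>\<^bsub>free_lie X\<^esub> = ?q \<lbrakk>frag_of s, frag_of t\<rbrakk>\<^bsub>free_nonassoc X\<^esub>"
      unfolding free_lie_def
      by (rule N.lbr_lie_quot[OF lie_ideal_free_lie_kernel(1)]) (use Br.prems in simp_all)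
    ultimately show ?case by simp
  qed
  have "?q p \<in> H" if "Poly_Mapping.keys p \<subseteq> {t. set_magma t \<subseteq> X}" for p
  proof -
    have "Poly_Mapping.keys p \<subseteq> {t. set_magma t \<subseteq> X} \<and> ?q p \<in> H"
      using that
    proof (induction p rule: frag_induction)
      case zero
      then show ?case using q.hom_one subgroup.one_closed[OF H] by simp
    next
      case (one t)
      then show ?case using tree by simp
    next
      case (diff a b)
      then have ab: "a \<in> carrier (free_nonassoc X)" "b \<in> carrier (free_nonassoc X)" by auto
      have minus: "inv\<^bsub>free_nonassoc X\<^esub> b = - b"
        using ab by (intro N.inv_equality) auto
      have "?q (a \<otimes>\<^bsub>free_nonassoc X\<^esub> inv\<^bsub>free_nonassoc X\<^esub> b) = ?q a \<otimes>\<^bsub>free_lie X\<^esub> inv\<^bsub>free_lie X\<^esub> ?q b"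
        using q.hom_mult[OF ab(1) N.inv_closed[OF ab(2)]] q.hom_inv[OF ab(2)] by simp
      then have "?q (a - b) = ?q a \<otimes>\<^bsub>free_lie X\<^esub> inv\<^bsub>free_lie X\<^esub> ?q b" by (simp add: minus)
      moreover have "Poly_Mapping.keys (a - b) \<subseteq> {t. set_magma t \<subseteq> X}"
        using ab keys_diff[of a b] by (simp; blast)
      ultimately show ?case
        using diff subgroup.m_closed[OF H] subgroup.m_inv_closed[OF H] by simp
    qed
    then show ?thesis by simp
  qed
  then have "carrier (free_lie X) \<subseteq> H" by (auto simp: free_lie_def carrier_lie_quot)
  then show ?thesis using subgroup.subset[OF H] by blast
qed

lemma lie_quot_generated:
  assumes L: "lie_ring L" and I: "lie_ideal I L"
    and gen: "\<And>H. subgroup H L \<Longrightarrow> (\<And>a b. a \<in> H \<Longrightarrow> b \<in> H \<Longrightarrow> \<lbrakk>a, b\<rbrakk>\<^bsub>L\<^esub> \<in> H) \<Longrightarrow> S \<subseteq> H \<Longrightarrow> H = carrier L"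
    and S: "S \<subseteq> carrier L"
    and H: "subgroup H (lie_quot L I)" "\<And>a b. a \<in> H \<Longrightarrow> b \<in> H \<Longrightarrow> \<lbrakk>a, b\<rbrakk>\<^bsub>lie_quot L I\<^esub> \<in> H"
    and SH: "\<And>s. s \<in> S \<Longrightarrow> I #>\<^bsub>L\<^esub> s \<in> H"
  shows "H = carrier (lie_quot L I)"
proof -
  interpret L: lie_ring L by fact
  interpret Q: lie_ring "lie_quot L I" by (rule L.lie_ring_lie_quot[OF I L.lie_relators_trivial[OF I]])
  let ?q = "\<lambda>a. I #>\<^bsub>L\<^esub> a"
  have q: "?q \<in> lie_hom L (lie_quot L I)" by (rule L.quot_map_lie_hom[OF I])
  interpret q: group_hom L "lie_quot L I" ?q
    using q by (simp add: lie_hom_def group_hom_def group_hom_axioms_def L.is_group Q.is_group)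
  let ?P = "{a \<in> carrier L. ?q a \<in> H}"
  have "subgroup ?P L"
  proof (rule L.subgroupI)
    show "?P \<noteq> {}" using subgroup.one_closed[OF H(1)] q.hom_one by auto
    show "inv\<^bsub>L\<^esub> a \<in> ?P" if "a \<in> ?P" for a
      using that subgroup.m_inv_closed[OF H(1)] q.hom_inv by auto
    show "a \<otimes>\<^bsub>L\<^esub> b \<in> ?P" if "a \<in> ?P" "b \<in> ?P" for a b
      using that subgroup.m_closed[OF H(1)] q.hom_mult by auto
  qed auto
  then have "?P = carrier L"
  proof (rule gen)
    show "\<lbrakk>a, b\<rbrakk>\<^bsub>L\<^esub> \<in> ?P" if "a \<in> ?P" "b \<in> ?P" for a b
      using that H(2)[of "?q a" "?q b"] L.lbr_lie_quot[OF I, of a b] by (simp add: L.lbr_closed)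
    show "S \<subseteq> ?P" using S SH by auto
  qed
  then have "carrier (lie_quot L I) \<subseteq> H" by (auto simp: carrier_lie_quot)
  then show ?thesis using subgroup.subset[OF H(1)] by blast
qed

section \<open>The lower central series\<close>

context group
begin

lemma cancel_left [simp]:
  "\<lbrakk>x \<in> carrier G; y \<in> carrier G\<rbrakk> \<Longrightarrow> x \<otimes> (inv x \<otimes> y) = y"
  "\<lbrakk>x \<in> carrier G; y \<in> carrier G\<rbrakk> \<Longrightarrow> inv x \<otimes> (x \<otimes> y) = y"
  by (simp_all flip: m_assoc)

lemma commutator_closed [simp]:
  "\<lbrakk>a \<in> carrier G; b \<in> carrier G\<rbrakk> \<Longrightarrow> commutator G a b \<in> carrier G"
  by (simp add: commutator_def)

lemma commutator_mult_right:
  assumes "a \<in> carrier G" "b \<in> carrier G" "b' \<in> carrier G"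
  shows "commutator G a (b \<otimes> b') = commutator G a b' \<otimes> (inv b' \<otimes> commutator G a b \<otimes> b')"
  using assms by (simp add: commutator_def m_assoc inv_mult_group)

lemma inv_commutator:
  "\<lbrakk>a \<in> carrier G; b \<in> carrier G\<rbrakk> \<Longrightarrow> inv (commutator G a b) = commutator G b a"
  by (simp add: commutator_def m_assoc inv_mult_group)

text \<open>
  The group identity behind the Jacobi identity.
\<close>

lemma hall_witt:
  assumes "x \<in> carrier G" "y \<in> carrier G" "z \<in> carrier G"
  shows "(inv y \<otimes> commutator G (commutator G x (inv y)) z \<otimes> y) \<otimes>
    (inv z \<otimes> commutator G (commutator G y (inv z)) x \<otimes> z) \<otimes>
    (inv x \<otimes> commutator G (commutator G z (inv x)) y \<otimes> x) = \<one>"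
  using assms by (simp add: commutator_def m_assoc inv_mult_group)

lemma conj_eq_commutator:
  "\<lbrakk>a \<in> carrier G; g \<in> carrier G\<rbrakk> \<Longrightarrow> inv g \<otimes> a \<otimes> g = a \<otimes> commutator G a g"
  by (simp add: commutator_def m_assoc)

lemma lower_central_le_1: "c \<le> 1 \<Longrightarrow> lower_central G c = carrier G"
  by (cases c rule: nat.exhaust[case_names 0 Suc]) auto

lemma lower_central_Suc:
  assumes "c \<ge> 1"
  shows "lower_central G (Suc c) = generate G {commutator G a b | a b. a \<in> lower_central G c \<and> b \<in> carrier G}"
  using assms by (cases c) auto

lemma subgroup_lower_central: "subgroup (lower_central G c) G"
proof (induction c)
  case (Suc c)
  show ?case
  proof (cases "c = 0")
    case False
    then have "c \<ge> 1" by simp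
    have "{commutator G a b | a b. a \<in> lower_central G c \<and> b \<in> carrier G} \<subseteq> carrier G"
      using subgroup.subset[OF Suc] by auto
    then show ?thesis
      unfolding lower_central_Suc[OF \<open>c \<ge> 1\<close>] by (rule generate_is_subgroup)
  qed (simp add: subgroup_self)
qed (simp add: subgroup_self)

lemmas lower_central_mult = subgroup.m_closed[OF subgroup_lower_central]
  and lower_central_inv = subgroup.m_inv_closed[OF subgroup_lower_central]
  and lower_central_one = subgroup.one_closed[OF subgroup_lower_central]

lemma lower_central_carrier: "a \<in> lower_central G c \<Longrightarrow> a \<in> carrier G"
  using subgroup.subset[OF subgroup_lower_central] by auto

lemma commutator_lower_central_1:
  assumes "a \<in> lower_central G c" "b \<in> carrier G"
  shows "commutator G a b \<in> lower_central G (Suc c)"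
proof (cases "c = 0")
  case False
  then show ?thesis
    using assms by (subst lower_central_Suc) (auto intro!: generate.incl)
qed (use assms in simp)

text \<open>
  Normality and monotonicity are proved together: $a^g = a(a, g)$ needs that the series decreases, and
  $(a, b) = a^{-1}a^b$ needs normality.
\<close>

lemma lower_central_normal_decreasing:
  "(\<forall>a \<in> lower_central G c. \<forall>g \<in> carrier G. inv g \<otimes> a \<otimes> g \<in> lower_central G c) \<and>
   lower_central G (Suc c) \<subseteq> lower_central G c"
proof (induction c)
  case (Suc c)
  have normal: "inv g \<otimes> a \<otimes> g \<in> lower_central G (Suc c)"
    if "a \<in> lower_central G (Suc c)" "g \<in> carrier G" for a g
  proof -
    have "a \<otimes> commutator G a g \<in> lower_central G (Suc c)"
      using Suc that by (intro lower_central_mult commutator_lower_central_1) auto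
    then show ?thesis
      using that lower_central_carrier by (simp add: conj_eq_commutator)
  qed
  have "commutator G a b \<in> lower_central G (Suc c)"
    if "a \<in> lower_central G (Suc c)" "b \<in> carrier G" for a b
  proof -
    have "inv a \<otimes> (inv b \<otimes> a \<otimes> b) \<in> lower_central G (Suc c)"
      by (rule lower_central_mult[OF lower_central_inv[OF that(1)] normal[OF that]])
    then show ?thesis
      using that lower_central_carrier by (simp add: commutator_def m_assoc)
  qed
  then have "{commutator G a b | a b. a \<in> lower_central G (Suc c) \<and> b \<in> carrier G} \<subseteq> lower_central G (Suc c)"
    by blast
  from generate_subgroup_incl[OF this subgroup_lower_central]
  have "lower_central G (Suc (Suc c)) \<subseteq> lower_central G (Suc c)"
    by simp
  with normal show ?case by blast
qed simp

lemma lower_central_conj: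
  "\<lbrakk>a \<in> lower_central G c; g \<in> carrier G\<rbrakk> \<Longrightarrow> inv g \<otimes> a \<otimes> g \<in> lower_central G c"
  using lower_central_normal_decreasing by blast

lemma lower_central_antimono: "c \<le> d \<Longrightarrow> lower_central G d \<subseteq> lower_central G c"
  by (rule lift_Suc_antimono_le) (use lower_central_normal_decreasing in blast)

lemma lower_central_normal: "lower_central G c \<lhd> G"
proof (rule normal_invI[OF subgroup_lower_central])
  fix x h assume "x \<in> carrier G" "h \<in> lower_central G c"
  then show "x \<otimes> h \<otimes> inv x \<in> lower_central G c"
    using lower_central_conj[of h c "inv x"] by simp
qed

lemma lower_central_conj': 
  "\<lbrakk>a \<in> carrier G; g \<in> carrier G\<rbrakk> \<Longrightarrow> inv g \<otimes> a \<otimes> g \<in> lower_central G c \<longleftrightarrow> a \<in> lower_central G c"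
  using lower_central_conj[of a c g] lower_central_conj[of "inv g \<otimes> a \<otimes> g" c "inv g"]
  by (auto simp: m_assoc)

text \<open>
  The three subgroups lemma, by induction on $d$ for all $c$ at once: for $b = (x, y)$ with
  $x \in \gamma_d$ the Hall--Witt identity expresses $(b, a)$ by conjugates of commutators of
  $(y^{-1}, a^{-1}) \in \gamma_{c+1}$ with $x$ and of $(a, x^{-1}) \in \gamma_{c+d}$ with $y^{-1}$.
\<close>

lemma commutator_lower_central:
  assumes "c \<ge> 1" "d \<ge> 1" "a \<in> lower_central G c" "b \<in> lower_central G d"
  shows "commutator G a b \<in> lower_central G (c + d)"
  using assms(2,1,3,4)
proof (induction d arbitrary: a b c rule: nat_induct_at_least)
  case base
  then show ?case using commutator_lower_central_1[of a c b] lower_central_carrier by simp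
next
  case (Suc d)
  let ?S = "{commutator G a b | a b. a \<in> lower_central G d \<and> b \<in> carrier G}"
  have a: "a \<in> carrier G" using Suc lower_central_carrier by blast
  have S: "?S \<subseteq> carrier G" using lower_central_carrier by auto
  have sub: "\<lbrakk>x \<in> lower_central G (c + Suc d); g \<in> carrier G\<rbrakk> \<Longrightarrow> inv g \<otimes> x \<otimes> g \<in> lower_central G (c
      + Suc d)" for x g
    by (rule lower_central_conj)
  have base: "commutator G a (commutator G x y) \<in> lower_central G (c + Suc d)"
    if x: "x \<in> lower_central G d" and y: "y \<in> carrier G" for x y
  proof -
    have xc: "x \<in> carrier G" using x lower_central_carrier by blast
    define u v w where "u = commutator G (commutator G x y) a"
      and "v = commutator G (commutator G (inv y) (inv a)) x"
      and "w = commutator G (commutator G a (inv x)) (inv y)"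
    have "commutator G (inv a) (inv y) \<in> lower_central G (Suc c)"
      using Suc y by (intro commutator_lower_central_1 lower_central_inv) auto
    then have "commutator G (inv y) (inv a) \<in> lower_central G (Suc c)"
      using lower_central_inv inv_commutator a y by fastforce
    with Suc.IH[of "Suc c" _ x] x have v: "v \<in> lower_central G (c + Suc d)"
      unfolding v_def by simp
    have "commutator G a (inv x) \<in> lower_central G (c + d)"
      using Suc x by (intro Suc.IH lower_central_inv) auto
    then have w: "w \<in> lower_central G (c + Suc d)"
      unfolding w_def using commutator_lower_central_1 y by fastforce
    have uvw: "u \<in> carrier G" "v \<in> carrier G" "w \<in> carrier G"
      using a y xc by (auto simp: u_def v_def w_def)
    let ?u = "inv (inv y) \<otimes> u \<otimes> inv y" and ?v = "inv a \<otimes> v \<otimes> a" and ?w = "inv x \<otimes> w \<otimes> x"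
    have "?u \<otimes> ?v \<otimes> ?w = \<one>"
      using hall_witt[of x "inv y" a] a y xc by (simp add: u_def v_def w_def)
    then have "?u = inv (?v \<otimes> ?w)"
      using uvw a y xc by (intro inv_equality[symmetric]) (simp_all add: m_assoc)
    moreover have "inv (?v \<otimes> ?w) \<in> lower_central G (c + Suc d)"
      using v w a xc by (intro lower_central_inv lower_central_mult sub) auto
    ultimately have "u \<in> lower_central G (c + Suc d)"
      using lower_central_conj'[of u "inv y"] uvw y by simp
    then show ?thesis
      using lower_central_inv inv_commutator a y xc unfolding u_def by fastforce
  qed
  have "b \<in> generate G ?S"
    using Suc lower_central_Suc by simp
  then show ?case
  proof (induction b rule: generate.induct)
    case one
    then show ?case using a lower_central_one by (simp add: commutator_def)
  next
    case (incl h)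
    then show ?case using base by auto
  next
    case (inv h)
    then obtain x y where h: "h = commutator G x y" "x \<in> lower_central G d" "y \<in> carrier G" by auto
    then have hc: "h \<in> carrier G" using lower_central_carrier by auto
    have "commutator G a (inv h) = inv (inv (inv h) \<otimes> commutator G a h \<otimes> inv h)"
      using a hc by (simp add: commutator_def m_assoc inv_mult_group)
    moreover have "inv (inv h) \<otimes> commutator G a h \<otimes> inv h \<in> lower_central G (c + Suc d)"
      using base[OF h(2,3)] hc h(1) by (intro sub) auto
    ultimately show ?case using lower_central_inv by metis
  next
    case (eng h1 h2)
    then have "h1 \<in> carrier G" "h2 \<in> carrier G"
      using generate_in_carrier[OF S] by auto
    moreover from this have "commutator G a h2 \<otimes> (inv h2 \<otimes> commutator G a h1 \<otimes> h2) \<in> lower_central G (c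
        + Suc d)"
      using eng by (intro lower_central_mult sub) auto
    ultimately show ?case using a by (simp add: commutator_mult_right)
  qed
qed

section \<open>The associated graded Lie ring\<close>

lemma coset_absorb:
  assumes "N \<lhd> G" "k \<in> N" "x \<in> carrier G" "y \<in> carrier G"
  shows "N #> (x \<otimes> k \<otimes> y) = N #> (x \<otimes> y)"
proof -
  interpret N: normal N G by fact
  have "x \<otimes> k \<otimes> inv x \<in> N" using assms N.inv_op_closed2 by blast
  then have "x \<otimes> k \<otimes> y \<in> N #> (x \<otimes> y)"
    using assms N.mem_carrier unfolding r_coset_def
    by (auto intro!: bexI[of _ "x \<otimes> k \<otimes> inv x"] simp: m_assoc)
  then show ?thesis
    using assms N.is_subgroup by (intro repr_independence[symmetric]) auto
qed

end

text \<open>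
  Defined for all elements of the group; it lies in the piece of degree \<open>c\<close> for those of the \<open>c\<close>-th term.
\<close>

definition gr_class :: "('a, 'b) monoid_scheme \<Rightarrow> nat \<Rightarrow> 'a \<Rightarrow> 'a set" where
  "gr_class G c a = lower_central G (Suc c) #>\<^bsub>G\<^esub> a"

context group
begin

lemma gr_class_absorb:
  assumes "k \<in> lower_central G (Suc c)" "x \<in> carrier G" "y \<in> carrier G"
  shows "gr_class G c (x \<otimes> k \<otimes> y) = gr_class G c (x \<otimes> y)"
  unfolding gr_class_def using coset_absorb[OF lower_central_normal] assms by auto

lemma gr_class_eq_iff:
  assumes "a \<in> carrier G" "b \<in> carrier G"
  shows "gr_class G c a = gr_class G c b \<longleftrightarrow> (\<exists>k \<in> lower_central G (Suc c). a = k \<otimes> b)"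
proof
  assume "gr_class G c a = gr_class G c b"
  moreover have "a \<in> gr_class G c a"
    unfolding gr_class_def using assms(1) subgroup_lower_central by (rule rcos_self)
  ultimately show "\<exists>k \<in> lower_central G (Suc c). a = k \<otimes> b"
    unfolding gr_class_def r_coset_def by auto
next
  assume "\<exists>k \<in> lower_central G (Suc c). a = k \<otimes> b"
  then obtain k where k: "k \<in> lower_central G (Suc c)" "a = k \<otimes> b" by blast
  then show "gr_class G c a = gr_class G c b"
    using gr_class_absorb[of k c \<one> b] assms lower_central_carrier by auto
qed

lemma gr_class_one: "gr_class G c \<one> = lower_central G (Suc c)"
  unfolding gr_class_def using coset_join2[OF one_closed subgroup_lower_central lower_central_one] .

lemma gr_class_eq_one_iff:
  assumes "a \<in> carrier G"
  shows "gr_class G c a = lower_central G (Suc c) \<longleftrightarrow> a \<in> lower_central G (Suc c)"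
  using gr_class_eq_iff[of a \<one>] assms lower_central_carrier by (fastforce simp: gr_class_one)

lemma gr_class_mult:
  assumes "a \<in> carrier G" "b \<in> carrier G"
  shows "gr_class G c a <#> gr_class G c b = gr_class G c (a \<otimes> b)"
  unfolding gr_class_def using normal.rcos_sum[OF lower_central_normal assms] .

lemma carrier_gr_piece: "carrier (gr_piece G c) = gr_class G c ` lower_central G c"
  by (simp add: gr_piece_def carrier_FactGroup gr_class_def r_coset_def)

lemma mult_gr_piece: "A \<otimes>\<^bsub>gr_piece G c\<^esub> B = A <#> B"
  by (simp add: gr_piece_def set_mult_def)

lemma one_gr_piece: "\<one>\<^bsub>gr_piece G c\<^esub> = lower_central G (Suc c)"
  by (simp add: gr_piece_def)

lemma comm_group_gr_piece:
  assumes "c \<ge> 1"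
  shows "comm_group (gr_piece G c)"
proof -
  let ?G = "G\<lparr>carrier := lower_central G c\<rparr>"
  have sub: "lower_central G (Suc c) \<subseteq> lower_central G c" by (rule lower_central_antimono) simp
  interpret S: group ?G by (rule subgroup.subgroup_is_group[OF subgroup_lower_central is_group])
  have "lower_central G (Suc c) \<lhd> ?G"
  proof (rule S.normal_invI)
    show "subgroup (lower_central G (Suc c)) ?G"
      using subgroup_incl[OF subgroup_lower_central subgroup_lower_central sub] .
    show "x \<otimes>\<^bsub>?G\<^esub> h \<otimes>\<^bsub>?G\<^esub> inv\<^bsub>?G\<^esub> x \<in> lower_central G (Suc c)"
      if "x \<in> carrier ?G" "h \<in> lower_central G (Suc c)" for x h
      using that lower_central_conj[of h "Suc c" "inv x"] lower_central_carrier[of x c]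
      by (simp add: m_inv_consistent[OF subgroup_lower_central])
  qed
  then have grp: "group (gr_piece G c)"
    unfolding gr_piece_def by (rule normal.factorgroup_is_group)
  have "A \<otimes>\<^bsub>gr_piece G c\<^esub> B = B \<otimes>\<^bsub>gr_piece G c\<^esub> A"
    if AB: "A \<in> carrier (gr_piece G c)" "B \<in> carrier (gr_piece G c)" for A B
  proof -
    from AB obtain a b where ab: "A = gr_class G c a" "B = gr_class G c b" "a \<in> lower_central G c"
        "b \<in> lower_central G c"
      by (auto simp: carrier_gr_piece)
    then have abc: "a \<in> carrier G" "b \<in> carrier G" using lower_central_carrier by auto
    have "commutator G a b \<in> lower_central G (Suc c)"
      using commutator_lower_central_1 ab abc by blast
    moreover have "a \<otimes> b = (b \<otimes> a) \<otimes> commutator G a b \<otimes> \<one>"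
      using abc by (simp add: commutator_def m_assoc)
    ultimately have "gr_class G c (a \<otimes> b) = gr_class G c (b \<otimes> a)"
      using gr_class_absorb[of "commutator G a b" c "b \<otimes> a" \<one>] abc by simp
    then show ?thesis by (simp add: mult_gr_piece gr_class_mult ab abc)
  qed
  then show ?thesis
    by (intro group.group_comm_groupI grp)
qed

lemma commutator_class_add_left:
  assumes "c \<ge> 1" "d \<ge> 1" "a \<in> lower_central G c" "a' \<in> lower_central G c" "b \<in> lower_central G d"
  shows "gr_class G (c + d) (commutator G (a \<otimes> a') b)
    = gr_class G (c + d) (commutator G a b \<otimes> commutator G a' b)"
proof -
  have car: "a \<in> carrier G" "a' \<in> carrier G" "b \<in> carrier G" using assms lower_central_carrier by auto
  have "commutator G (commutator G a b) a' \<in> lower_central G (Suc (c + d))"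
    using assms car commutator_lower_central by (intro commutator_lower_central_1) auto
  moreover have "commutator G (a \<otimes> a') b = commutator G a b \<otimes> commutator G (commutator G a b) a'
      \<otimes> commutator G a' b"
    using car by (simp add: commutator_def m_assoc inv_mult_group)
  ultimately show ?thesis
    using car by (simp add: gr_class_absorb)
qed

lemma commutator_class_add_right:
  assumes "c \<ge> 1" "d \<ge> 1" "a \<in> lower_central G c" "b \<in> lower_central G d" "b' \<in> lower_central G d"
  shows "gr_class G (c + d) (commutator G a (b \<otimes> b'))
    = gr_class G (c + d) (commutator G a b' \<otimes> commutator G a b)"
proof -
  have car: "a \<in> carrier G" "b \<in> carrier G" "b' \<in> carrier G" using assms lower_central_carrier by auto
  have "commutator G (commutator G a b) b' \<in> lower_central G (Suc (c + d))"
    using assms car commutator_lower_central by (intro commutator_lower_central_1) auto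
  moreover have "commutator G a (b \<otimes> b') = (commutator G a b' \<otimes> commutator G a b)
      \<otimes> commutator G (commutator G a b) b' \<otimes> \<one>"
    using car by (simp add: commutator_def m_assoc inv_mult_group)
  ultimately show ?thesis
    using car gr_class_absorb[of "commutator G (commutator G a b) b'" "c + d"
        "commutator G a b' \<otimes> commutator G a b" \<one>] by simp
qed

text \<open>
  The union in the definition of the bracket runs over representatives $ka$ and $lb$ with $k$, $l$ one step
  deeper in the series; biadditivity modulo the next term removes $k$ and $l$.
\<close>

lemma gr_piece_lbr_class:
  assumes "c \<ge> 1" "d \<ge> 1" "a \<in> lower_central G c" "b \<in> lower_central G d"
  shows "gr_piece_lbr G c d (gr_class G c a) (gr_class G d b) = gr_class G (c + d) (commutator G a b)"
proof -
  have car: "a \<in> carrier G" "b \<in> carrier G" using assms lower_central_carrier by auto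
  have "gr_class G (c + d) (commutator G a' b') = gr_class G (c + d) (commutator G a b)"
    if reps: "a' \<in> gr_class G c a" "b' \<in> gr_class G d b" for a' b'
  proof -
    obtain k l where k: "k \<in> lower_central G (Suc c)" "a' = k \<otimes> a"
      and l: "l \<in> lower_central G (Suc d)" "b' = l \<otimes> b"
      using reps unfolding gr_class_def r_coset_def by blast
    have kl: "k \<in> lower_central G c" "l \<in> lower_central G d"
      using k l lower_central_antimono[of c "Suc c"] lower_central_antimono[of d "Suc d"] by auto
    then have a': "a' \<in> lower_central G c" using k assms lower_central_mult by auto
    have klc: "k \<in> carrier G" "l \<in> carrier G" "a' \<in> carrier G" using kl a' lower_central_carrier by auto
    have "commutator G k b \<in> lower_central G (Suc (c + d))" "commutator G a' l \<in> lower_central G (Suc (c + d))"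
      using commutator_lower_central[of "Suc c" d k b] commutator_lower_central[of c
          "Suc d" a' l] assms k l a' by auto
    then show ?thesis
      using commutator_class_add_right[OF assms(1,2) a' kl(2) assms(4)]
        commutator_class_add_left[OF assms(1,2) kl(1) assms(3,4)]
        gr_class_absorb[of "commutator G a' l" "c + d" "commutator G a' b" \<one>]
        gr_class_absorb[of "commutator G k b" "c + d" \<one> "commutator G a b"] car klc
      by (simp add: k(2) l(2))
  qed
  moreover have "gr_class G c a \<noteq> {}" "gr_class G d b \<noteq> {}"
    unfolding gr_class_def using car rcos_self subgroup_lower_central by blast+
  ultimately show ?thesis
    unfolding gr_piece_lbr_def gr_class_def[of G "c + d", symmetric] by auto
qed

end

text \<open>
  The homogeneous element of degree \<open>n\<close> given by the class of \<open>a\<close>.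
\<close>

definition gr_elem :: "('a, 'b) monoid_scheme \<Rightarrow> nat \<Rightarrow> 'a \<Rightarrow> nat \<Rightarrow> 'a set" where
  "gr_elem G n a = (\<lambda>i\<in>{1..}. if i = n then gr_class G n a else lower_central G (Suc i))"

lemma comm_group_sum_group:
  assumes "\<And>i. i \<in> I \<Longrightarrow> comm_group (A i)"
  shows "comm_group (sum_group I A)"
proof -
  have grp: "\<And>i. i \<in> I \<Longrightarrow> group (A i)" using assms comm_group.axioms(2) by blast
  show ?thesis
  proof (rule group.group_comm_groupI)
    show "group (sum_group I A)" using grp by (rule sum_group)
    fix x y assume xy: "x \<in> carrier (sum_group I A)" "y \<in> carrier (sum_group I A)"
    have "x i \<otimes>\<^bsub>A i\<^esub> y i = y i \<otimes>\<^bsub>A i\<^esub> x i" if "i \<in> I" for i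
    proof -
      interpret comm_group "A i" using assms that .
      show ?thesis using xy that by (intro m_comm) (auto simp: carrier_sum_group grp)
    qed
    then show "x \<otimes>\<^bsub>sum_group I A\<^esub> y = y \<otimes>\<^bsub>sum_group I A\<^esub> x"
      by (simp cong: restrict_cong)
  qed
qed

context group
begin

lemma group_gr_piece: "c \<ge> 1 \<Longrightarrow> group (gr_piece G c)"
  using comm_group_gr_piece comm_group.axioms(2) by blast

lemma carrier_gr:
  "carrier (gr G) = {f \<in> \<Pi>\<^sub>E i\<in>{1..}. carrier (gr_piece G i). finite {i
      \<in> {1..}. f i \<noteq> lower_central G (Suc i)}}"
  using carrier_sum_group[of "{1..}" "gr_piece G"] group_gr_piece
  by (simp add: gr_def Let_def one_gr_piece)

lemma mult_gr: "f \<otimes>\<^bsub>gr G\<^esub> g = (\<lambda>i\<in>{1..}. f i <#> g i)"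
  by (auto simp: gr_def Let_def mult_gr_piece)

lemma one_gr: "\<one>\<^bsub>gr G\<^esub> = (\<lambda>i\<in>{1..}. lower_central G (Suc i))"
  by (simp add: gr_def Let_def one_gr_piece)

lemma lbr_gr: "\<lbrakk>f, g\<rbrakk>\<^bsub>gr G\<^esub> = (\<lambda>n\<in>{1..}. finprod (gr_piece G n)
       (\<lambda>c. gr_piece_lbr G c (n - c) (f c) (g (n - c))) {1..<n})"
  by (simp add: gr_def Let_def)

lemma comm_group_gr: "comm_group (gr G)"
  unfolding gr_def Let_def
  by (intro comm_group_truncate comm_group_sum_group comm_group_gr_piece) simp

lemma gr_component:
  assumes "f \<in> carrier (gr G)" "n \<ge> 1"
  obtains a where "a \<in> lower_central G n" "f n = gr_class G n a"
proof -
  have "f n \<in> carrier (gr_piece G n)" using assms by (auto simp: carrier_gr)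
  then show thesis using that by (auto simp: carrier_gr_piece)
qed

lemma gr_component_finite:
  assumes "f \<in> carrier (gr G)"
  obtains N where "\<And>n. n > N \<Longrightarrow> f n = lower_central G (Suc n)"
proof -
  have fin: "finite {i \<in> {1..}. f i \<noteq> lower_central G (Suc i)}" using assms by (simp add: carrier_gr)
  have "f n = lower_central G (Suc n)" if n: "n > Max (insert 0 {i
      \<in> {1..}. f i \<noteq> lower_central G (Suc i)})" for n
  proof (rule ccontr)
    assume "\<not> ?thesis"
    with n have "n \<in> insert 0 {i \<in> {1..}. f i \<noteq> lower_central G (Suc i)}" by auto
    with fin have "n \<le> Max (insert 0 {i \<in> {1..}. f i \<noteq> lower_central G (Suc i)})" by (intro Max_ge) auto
    with n show False by simp
  qed
  then show thesis using that by blast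
qed

lemma gr_elem_closed:
  assumes "n \<ge> 1" "a \<in> lower_central G n"
  shows "gr_elem G n a \<in> carrier (gr G)"
proof -
  have "{i \<in> {1..}. gr_elem G n a i \<noteq> lower_central G (Suc i)} \<subseteq> {n}" by (auto simp: gr_elem_def)
  then have "finite {i \<in> {1..}. gr_elem G n a i \<noteq> lower_central G (Suc i)}" by (rule finite_subset) simp
  moreover have "lower_central G (Suc i) \<in> carrier (gr_piece G i)" for i
    by (metis carrier_gr_piece gr_class_one imageI lower_central_one)
  ultimately show ?thesis
    using assms by (auto simp: carrier_gr gr_elem_def carrier_gr_piece)
qed

lemma lower_central_set_mult:
  "lower_central G (Suc c) <#> lower_central G (Suc c) = lower_central G (Suc c)"
  using gr_class_mult[of \<one> \<one> c] by (simp add: gr_class_one)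

lemma gr_elem_mult:
  assumes "n \<ge> 1" "a \<in> lower_central G n" "b \<in> lower_central G n"
  shows "gr_elem G n a \<otimes>\<^bsub>gr G\<^esub> gr_elem G n b = gr_elem G n (a \<otimes> b)"
  using assms lower_central_carrier
  unfolding mult_gr gr_elem_def[of G n "a \<otimes> b"]
  by (intro restrict_ext) (simp add: gr_elem_def gr_class_mult lower_central_set_mult del: lower_central.simps)

lemma gr_elem_one: "gr_elem G n \<one> = \<one>\<^bsub>gr G\<^esub>"
  unfolding gr_elem_def one_gr by (intro restrict_ext) (simp add: gr_class_one)

lemma gr_elem_eq_one_iff:
  assumes "n \<ge> 1" "a \<in> carrier G"
  shows "gr_elem G n a = \<one>\<^bsub>gr G\<^esub> \<longleftrightarrow> a \<in> lower_central G (Suc n)"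
proof
  assume "gr_elem G n a = \<one>\<^bsub>gr G\<^esub>"
  from fun_cong[OF this, of n] show "a \<in> lower_central G (Suc n)"
    using assms by (simp add: gr_elem_def one_gr gr_class_eq_one_iff)
next
  assume "a \<in> lower_central G (Suc n)"
  then show "gr_elem G n a = \<one>\<^bsub>gr G\<^esub>"
    unfolding gr_elem_def one_gr using assms gr_class_eq_one_iff[of a n]
    by (intro restrict_ext) (simp del: lower_central.simps)
qed

lemma gr_elem_inv:
  assumes "n \<ge> 1" "a \<in> lower_central G n"
  shows "inv\<^bsub>gr G\<^esub> (gr_elem G n a) = gr_elem G n (inv a)"
proof -
  interpret gr: comm_group "gr G" by (rule comm_group_gr)
  show ?thesis
    using assms lower_central_inv lower_central_carrier
    by (intro gr.inv_equality) (auto simp: gr_elem_mult gr_elem_one gr_elem_closed)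
qed

text \<open>
  Every element is a finite sum of homogeneous ones.  Identities that are additive in each argument need
  only be checked on these.
\<close>

lemma gr_induct [consumes 1, case_names one mult elem]:
  assumes "f \<in> carrier (gr G)"
    and one: "P \<one>\<^bsub>gr G\<^esub>"
    and mult: "\<And>f g. \<lbrakk>f \<in> carrier (gr G); g \<in> carrier (gr G); P f; P g\<rbrakk> \<Longrightarrow> P (f \<otimes>\<^bsub>gr G\<^esub> g)"
    and elem: "\<And>n a. \<lbrakk>n \<ge> 1; a \<in> lower_central G n\<rbrakk> \<Longrightarrow> P (gr_elem G n a)"
  shows "P f"
proof -
  have "\<forall>f \<in> carrier (gr G). (\<forall>n > N. f n = lower_central G (Suc n)) \<longrightarrow> P f" for N
  proof (induction N)
    case 0
    have "f = \<one>\<^bsub>gr G\<^esub>" if "f \<in> carrier (gr G)" "\<forall>n > 0. f n = lower_central G (Suc n)" for f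
      using that by (auto simp: one_gr carrier_gr PiE_iff extensional_def fun_eq_iff)
    then show ?case using one by auto
  next
    case (Suc N)
    show ?case
    proof (intro ballI impI)
      fix f assume f: "f \<in> carrier (gr G)" "\<forall>n > Suc N. f n = lower_central G (Suc n)"
      obtain a where a: "a \<in> lower_central G (Suc N)" "f (Suc N) = gr_class G (Suc N) a"
        using gr_component[OF f(1), of "Suc N"] by auto
      let ?g = "f \<otimes>\<^bsub>gr G\<^esub> gr_elem G (Suc N) (inv a)"
      have ac: "a \<in> carrier G" using a lower_central_carrier by blast
      interpret gr: comm_group "gr G" by (rule comm_group_gr)
      have el: "gr_elem G (Suc N) a \<in> carrier (gr G)" "gr_elem G (Suc N) (inv a) \<in> carrier (gr G)"
        using a lower_central_inv by (auto intro!: gr_elem_closed simp del: lower_central.simps)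
      have "\<forall>n > N. ?g n = lower_central G (Suc n)"
      proof (intro allI impI)
        fix n assume "n > N"
        show "?g n = lower_central G (Suc n)"
        proof (cases "n = Suc N")
          case True
          then show ?thesis
            using a ac by (simp add: mult_gr gr_elem_def gr_class_mult gr_class_one)
        next
          case False
          with \<open>n > N\<close> f(2) show ?thesis by (simp add: mult_gr gr_elem_def lower_central_set_mult)
        qed
      qed
      then have "P ?g" using Suc f el by blast
      then have "P (?g \<otimes>\<^bsub>gr G\<^esub> gr_elem G (Suc N) a)"
        by (rule mult[OF gr.m_closed[OF f(1) el(2)] el(1) _ elem[OF _ a(1)]]) simp_all
      also have "?g \<otimes>\<^bsub>gr G\<^esub> gr_elem G (Suc N) a = f"
        using f(1) el a(1) ac by (simp add: gr.m_assoc gr_elem_mult lower_central_inv gr_elem_one del: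
            lower_central.simps)
      finally show "P f" .
    qed
  qed
  then show ?thesis
    using assms(1) gr_component_finite[OF assms(1)] by metis
qed

lemma gr_piece_lbr_closed:
  assumes "c \<ge> 1" "d \<ge> 1" "A \<in> carrier (gr_piece G c)" "B \<in> carrier (gr_piece G d)"
  shows "gr_piece_lbr G c d A B \<in> carrier (gr_piece G (c + d))"
  using assms commutator_lower_central by (auto simp: carrier_gr_piece gr_piece_lbr_class)

lemma gr_piece_lbr_add_left:
  assumes "c \<ge> 1" "d \<ge> 1" "A \<in> carrier (gr_piece G c)" "A' \<in> carrier (gr_piece G c)"
      "B \<in> carrier (gr_piece G d)"
  shows "gr_piece_lbr G c d (A <#> A') B = gr_piece_lbr G c d A B <#> gr_piece_lbr G c d A' B"
  using assms lower_central_carrier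
  by (auto simp: carrier_gr_piece gr_piece_lbr_class gr_class_mult lower_central_mult commutator_class_add_left)

lemma gr_piece_lbr_add_right:
  assumes "c \<ge> 1" "d \<ge> 1" "A \<in> carrier (gr_piece G c)" "B \<in> carrier (gr_piece G d)"
      "B' \<in> carrier (gr_piece G d)"
  shows "gr_piece_lbr G c d A (B <#> B') = gr_piece_lbr G c d A B <#> gr_piece_lbr G c d A B'"
proof -
  interpret P: comm_group "gr_piece G (c + d)" using assms by (intro comm_group_gr_piece) simp
  have "gr_piece_lbr G c d A (B <#> B') = gr_piece_lbr G c d A B' <#> gr_piece_lbr G c d A B"
    using assms lower_central_carrier
    by (auto simp: carrier_gr_piece gr_piece_lbr_class gr_class_mult lower_central_mult
        commutator_class_add_right)
  then show ?thesis
    using P.m_comm[OF gr_piece_lbr_closed gr_piece_lbr_closed] assms by (simp add: mult_gr_piece)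
qed

lemma commutator_one: "a \<in> carrier G \<Longrightarrow> commutator G a \<one> = \<one>" "a \<in> carrier G \<Longrightarrow> commutator G \<one> a = \<one>"
  by (simp_all add: commutator_def)

lemma gr_piece_lbr_one:
  assumes "c \<ge> 1" "d \<ge> 1"
  shows "A \<in> carrier (gr_piece G c) \<Longrightarrow> gr_piece_lbr G c d A (lower_central G (Suc d))
      = lower_central G (Suc (c + d))"
    and "B \<in> carrier (gr_piece G d) \<Longrightarrow> gr_piece_lbr G c d (lower_central G (Suc c)) B
        = lower_central G (Suc (c + d))"
proof -
  show "gr_piece_lbr G c d A (lower_central G (Suc d)) = lower_central G (Suc (c + d))" if
      "A \<in> carrier (gr_piece G c)"
  proof -
    from that obtain a where a: "a \<in> lower_central G c" "A = gr_class G c a" by (auto simp: carrier_gr_piece)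
    have "gr_piece_lbr G c d A (gr_class G d \<one>) = gr_class G (c + d) \<one>"
      using gr_piece_lbr_class[OF assms a(1) lower_central_one] a lower_central_carrier
          by (simp add: commutator_one)
    then show ?thesis by (simp add: gr_class_one del: lower_central.simps)
  qed
  show "gr_piece_lbr G c d (lower_central G (Suc c)) B = lower_central G (Suc (c + d))" if
      "B \<in> carrier (gr_piece G d)"
  proof -
    from that obtain b where b: "b \<in> lower_central G d" "B = gr_class G d b" by (auto simp: carrier_gr_piece)
    have "gr_piece_lbr G c d (gr_class G c \<one>) B = gr_class G (c + d) \<one>"
      using gr_piece_lbr_class[OF assms lower_central_one b(1)] b lower_central_carrier
          by (simp add: commutator_one)
    then show ?thesis by (simp add: gr_class_one del: lower_central.simps)
  qed
qed

lemma gr_lbr_term_closed: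
  assumes "f \<in> carrier (gr G)" "g \<in> carrier (gr G)"
  shows "(\<lambda>c. gr_piece_lbr G c (n - c) (f c) (g (n - c))) \<in> {1..<n} \<rightarrow> carrier (gr_piece G n)"
proof
  fix c assume "c \<in> {1..<n}"
  then have "c \<ge> 1" "n - c \<ge> 1" "c + (n - c) = n" "f c \<in> carrier (gr_piece G c)"
      "g (n - c) \<in> carrier (gr_piece G (n - c))"
    using assms by (auto simp: carrier_gr)
  then show "gr_piece_lbr G c (n - c) (f c) (g (n - c)) \<in> carrier (gr_piece G n)"
    using gr_piece_lbr_closed by metis
qed

text \<open>
  If $f$ and $g$ vanish above the degrees $N$ and $M$, then the bracket vanishes above $N + M$.
\<close>

lemma gr_lbr_closed:
  assumes f: "f \<in> carrier (gr G)" and g: "g \<in> carrier (gr G)"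
  shows "\<lbrakk>f, g\<rbrakk>\<^bsub>gr G\<^esub> \<in> carrier (gr G)"
proof -
  obtain N where N: "\<And>n. n > N \<Longrightarrow> f n = lower_central G (Suc n)" using gr_component_finite[OF f] by blast
  obtain M where M: "\<And>n. n > M \<Longrightarrow> g n = lower_central G (Suc n)" using gr_component_finite[OF g] by blast
  have zero: "\<lbrakk>f, g\<rbrakk>\<^bsub>gr G\<^esub> n = lower_central G (Suc n)" if n: "n > N + M" for n
  proof -
    interpret P: comm_group "gr_piece G n" using n by (intro comm_group_gr_piece) simp
    have "gr_piece_lbr G c (n - c) (f c) (g (n - c)) = \<one>\<^bsub>gr_piece G n\<^esub>" if c: "c \<in> {1..<n}" for c
    proof -
      have "f c \<in> carrier (gr_piece G c)" "g (n - c) \<in> carrier (gr_piece G (n - c))"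
        using f g c by (auto simp: carrier_gr)
      moreover have "f c = lower_central G (Suc c) \<or> g (n - c) = lower_central G (Suc (n - c))"
        using N[of c] M[of "n - c"] n by linarith
      ultimately show ?thesis
        using gr_piece_lbr_one[of c "n - c"] c by (auto simp: one_gr_piece simp del: lower_central.simps)
    qed
    then have "finprod (gr_piece G n) (\<lambda>c. gr_piece_lbr G c (n - c) (f c) (g (n - c))) {1..<n}
        = \<one>\<^bsub>gr_piece G n\<^esub>"
      by (rule P.finprod_one_eqI)
    then show ?thesis using n by (simp add: lbr_gr one_gr_piece)
  qed
  have "{i \<in> {1..}. \<lbrakk>f, g\<rbrakk>\<^bsub>gr G\<^esub> i \<noteq> lower_central G (Suc i)} \<subseteq> {..N + M}"
    using zero not_less by auto
  then have "finite {i \<in> {1..}. \<lbrakk>f, g\<rbrakk>\<^bsub>gr G\<^esub> i \<noteq> lower_central G (Suc i)}" by (rule finite_subset) simp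
  moreover have "\<lbrakk>f, g\<rbrakk>\<^bsub>gr G\<^esub> n \<in> carrier (gr_piece G n)" if "n \<ge> 1" for n
  proof -
    interpret P: comm_group "gr_piece G n" using that by (rule comm_group_gr_piece)
    show ?thesis using that gr_lbr_term_closed[OF f g] by (simp add: lbr_gr P.finprod_closed)
  qed
  ultimately show ?thesis by (auto simp: carrier_gr lbr_gr)
qed

lemma gr_lbr_add_left:
  assumes "f \<in> carrier (gr G)" "f' \<in> carrier (gr G)" "g \<in> carrier (gr G)"
  shows "\<lbrakk>f \<otimes>\<^bsub>gr G\<^esub> f', g\<rbrakk>\<^bsub>gr G\<^esub> = \<lbrakk>f, g\<rbrakk>\<^bsub>gr G\<^esub> \<otimes>\<^bsub>gr G\<^esub> \<lbrakk>f', g\<rbrakk>\<^bsub>gr G\<^esub>"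
proof -
  interpret gr: comm_group "gr G" by (rule comm_group_gr)
  have "finprod (gr_piece G n) (\<lambda>c. gr_piece_lbr G c (n - c) ((f \<otimes>\<^bsub>gr G\<^esub> f') c) (g (n - c))) {1..<n} =
    finprod (gr_piece G n) (\<lambda>c. gr_piece_lbr G c (n - c) (f c) (g (n - c))) {1..<n} <#>
    finprod (gr_piece G n) (\<lambda>c. gr_piece_lbr G c (n - c) (f' c) (g (n - c))) {1..<n}" if n: "n \<ge> 1" for n
  proof -
    interpret P: comm_group "gr_piece G n" using n by (rule comm_group_gr_piece)
    have "finprod (gr_piece G n) (\<lambda>c. gr_piece_lbr G c (n - c) ((f \<otimes>\<^bsub>gr G\<^esub> f') c) (g (n - c))) {1..<n}
      = finprod (gr_piece G n) (\<lambda>c. gr_piece_lbr G c (n - c) (f c) (g (n - c)) \<otimes>\<^bsub>gr_piece G n\<^esub>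
        gr_piece_lbr G c (n - c) (f' c) (g (n - c))) {1..<n}"
    proof (rule P.finprod_cong')
      show "gr_piece_lbr G c (n - c) ((f \<otimes>\<^bsub>gr G\<^esub> f') c) (g (n - c)) = gr_piece_lbr G c (n - c) (f c) (g (n
          - c)) \<otimes>\<^bsub>gr_piece G n\<^esub>
        gr_piece_lbr G c (n - c) (f' c) (g (n - c))" if c: "c \<in> {1..<n}" for c
      proof -
        have "f c \<in> carrier (gr_piece G c)" "f' c \<in> carrier (gr_piece G c)"
            "g (n - c) \<in> carrier (gr_piece G (n - c))"
          using assms c by (auto simp: carrier_gr)
        then show ?thesis
          using c gr_piece_lbr_add_left[of c "n - c" "f c" "f' c" "g (n - c)"]
          by (simp add: mult_gr mult_gr_piece Suc_leI)
      qed
    qed (use gr_lbr_term_closed[OF assms(1,3), of n] gr_lbr_term_closed[OF assms(2,3), of n] in auto)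
    also have "\<dots> = finprod (gr_piece G n) (\<lambda>c. gr_piece_lbr G c (n - c) (f c) (g (n - c))) {1..<n}
        \<otimes>\<^bsub>gr_piece G n\<^esub>
      finprod (gr_piece G n) (\<lambda>c. gr_piece_lbr G c (n - c) (f' c) (g (n - c))) {1..<n}"
      by (rule P.finprod_multf[OF gr_lbr_term_closed[OF assms(1,3)] gr_lbr_term_closed[OF assms(2,3)]])
    finally show ?thesis by (simp add: mult_gr_piece)
  qed
  then show ?thesis
    unfolding lbr_gr[of "f \<otimes>\<^bsub>gr G\<^esub> f'" g] mult_gr[of "\<lbrakk>f, g\<rbrakk>\<^bsub>gr G\<^esub>"]
    by (intro restrict_ext) (simp add: lbr_gr)
qed

lemma gr_lbr_add_right:
  assumes "f \<in> carrier (gr G)" "g \<in> carrier (gr G)" "g' \<in> carrier (gr G)"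
  shows "\<lbrakk>f, g \<otimes>\<^bsub>gr G\<^esub> g'\<rbrakk>\<^bsub>gr G\<^esub> = \<lbrakk>f, g\<rbrakk>\<^bsub>gr G\<^esub> \<otimes>\<^bsub>gr G\<^esub> \<lbrakk>f, g'\<rbrakk>\<^bsub>gr G\<^esub>"
proof -
  interpret gr: comm_group "gr G" by (rule comm_group_gr)
  have "finprod (gr_piece G n) (\<lambda>c. gr_piece_lbr G c (n - c) (f c) ((g \<otimes>\<^bsub>gr G\<^esub> g') (n - c))) {1..<n} =
    finprod (gr_piece G n) (\<lambda>c. gr_piece_lbr G c (n - c) (f c) (g (n - c))) {1..<n} <#>
    finprod (gr_piece G n) (\<lambda>c. gr_piece_lbr G c (n - c) (f c) (g' (n - c))) {1..<n}" if n: "n \<ge> 1" for n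
  proof -
    interpret P: comm_group "gr_piece G n" using n by (rule comm_group_gr_piece)
    have "finprod (gr_piece G n) (\<lambda>c. gr_piece_lbr G c (n - c) (f c) ((g \<otimes>\<^bsub>gr G\<^esub> g') (n - c))) {1..<n}
      = finprod (gr_piece G n) (\<lambda>c. gr_piece_lbr G c (n - c) (f c) (g (n - c)) \<otimes>\<^bsub>gr_piece G n\<^esub>
        gr_piece_lbr G c (n - c) (f c) (g' (n - c))) {1..<n}"
    proof (rule P.finprod_cong')
      show "gr_piece_lbr G c (n - c) (f c) ((g \<otimes>\<^bsub>gr G\<^esub> g') (n - c)) = gr_piece_lbr G c (n - c) (f c) (g (n
          - c)) \<otimes>\<^bsub>gr_piece G n\<^esub>
        gr_piece_lbr G c (n - c) (f c) (g' (n - c))" if c: "c \<in> {1..<n}" for c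
      proof -
        have "f c \<in> carrier (gr_piece G c)" "g (n - c) \<in> carrier (gr_piece G (n - c))"
            "g' (n - c) \<in> carrier (gr_piece G (n - c))"
          using assms c by (auto simp: carrier_gr)
        then show ?thesis
          using c gr_piece_lbr_add_right[of c "n - c" "f c" "g (n - c)" "g' (n - c)"]
          by (simp add: mult_gr mult_gr_piece Suc_leI)
      qed
    qed (use gr_lbr_term_closed[OF assms(1,2), of n] gr_lbr_term_closed[OF assms(1,3), of n] in auto)
    also have "\<dots> = finprod (gr_piece G n) (\<lambda>c. gr_piece_lbr G c (n - c) (f c) (g (n - c))) {1..<n}
        \<otimes>\<^bsub>gr_piece G n\<^esub>
      finprod (gr_piece G n) (\<lambda>c. gr_piece_lbr G c (n - c) (f c) (g' (n - c))) {1..<n}"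
      by (rule P.finprod_multf[OF gr_lbr_term_closed[OF assms(1,2)] gr_lbr_term_closed[OF assms(1,3)]])
    finally show ?thesis by (simp add: mult_gr_piece)
  qed
  then show ?thesis
    unfolding lbr_gr[of f "g \<otimes>\<^bsub>gr G\<^esub> g'"] mult_gr[of "\<lbrakk>f, g\<rbrakk>\<^bsub>gr G\<^esub>"]
    by (intro restrict_ext) (simp add: lbr_gr)
qed

lemma gr_elem_lbr:
  assumes "c \<ge> 1" "d \<ge> 1" "a \<in> lower_central G c" "b \<in> lower_central G d"
  shows "\<lbrakk>gr_elem G c a, gr_elem G d b\<rbrakk>\<^bsub>gr G\<^esub> = gr_elem G (c + d) (commutator G a b)"
proof -
  note el = gr_elem_closed[OF assms(1,3)] gr_elem_closed[OF assms(2,4)]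
  have "finprod (gr_piece G n) (\<lambda>i. gr_piece_lbr G i (n - i) (gr_elem G c a i) (gr_elem G d b (n - i))) {1..<n}
    = (if n = c + d then gr_class G (c + d) (commutator G a b) else lower_central G (Suc n))" (is "finprod
        _ ?t _ = _") if n: "n \<ge> 1" for n
  proof -
    interpret P: comm_group "gr_piece G n" using n by (rule comm_group_gr_piece)
    have t: "?t i = (if i = c \<and> n = c + d then gr_class G (c + d) (commutator G a b) else \<one>\<^bsub>gr_piece G n\<^esub>)"
      if i: "i \<in> {1..<n}" for i
    proof (cases "i = c \<and> n = c + d")
      case True
      then show ?thesis using assms by (simp add: gr_elem_def gr_piece_lbr_class)
    next
      case False
      have "gr_elem G c a i \<in> carrier (gr_piece G i)" "gr_elem G d b (n - i) \<in> carrier (gr_piece G (n - i))"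
        using el i by (auto simp: carrier_gr)
      moreover have "gr_elem G c a i = lower_central G (Suc i) \<or> gr_elem G d b (n - i)
          = lower_central G (Suc (n - i))"
        using False i by (auto simp: gr_elem_def)
      ultimately show ?thesis
        using gr_piece_lbr_one[of i "n - i"] i False by (auto simp: one_gr_piece simp del: lower_central.simps)
    qed
    show ?thesis
    proof (cases "n = c + d")
      case True
      have "finprod (gr_piece G n) ?t {1..<n} = finprod (gr_piece G n) (\<lambda>i. if i = c then gr_class G (c
          + d) (commutator G a b) else \<one>\<^bsub>gr_piece G n\<^esub>) {1..<n}"
        using t True commutator_lower_central[OF assms] P.one_closed
        by (intro P.finprod_cong') (auto simp: carrier_gr_piece[of "c + d"])
      also have "\<dots> = gr_class G (c + d) (commutator G a b)"
        using assms True commutator_lower_central[OF assms]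
          P.finprod_singleton_swap[of c "{1..<n}" "\<lambda>_. gr_class G (c + d) (commutator G a b)"]
        by (auto simp: carrier_gr_piece)
      finally show ?thesis using True by simp
    next
      case False
      then have "finprod (gr_piece G n) ?t {1..<n} = \<one>\<^bsub>gr_piece G n\<^esub>"
        using t by (intro P.finprod_one_eqI) auto
      then show ?thesis using False by (simp add: one_gr_piece)
    qed
  qed
  then show ?thesis
    unfolding lbr_gr gr_elem_def[of G "c + d"] by (intro restrict_ext) simp
qed

lemma gr_lbr_antisym:
  assumes "x \<in> carrier (gr G)" "y \<in> carrier (gr G)"
  shows "\<lbrakk>x, y\<rbrakk>\<^bsub>gr G\<^esub> \<otimes>\<^bsub>gr G\<^esub> \<lbrakk>y, x\<rbrakk>\<^bsub>gr G\<^esub> = \<one>\<^bsub>gr G\<^esub>"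
proof -
  interpret gr: comm_group "gr G" by (rule comm_group_gr)
  note add = gr_lbr_closed gr_lbr_add_left gr_lbr_add_right
  have zero: "\<lbrakk>\<one>\<^bsub>gr G\<^esub>, z\<rbrakk>\<^bsub>gr G\<^esub> = \<one>\<^bsub>gr G\<^esub>" "\<lbrakk>z, \<one>\<^bsub>gr G\<^esub>\<rbrakk>\<^bsub>gr G\<^esub> = \<one>\<^bsub>gr G\<^esub>" if "z \<in> carrier (gr G)" for z
    using add(2)[of "\<one>\<^bsub>gr G\<^esub>" "\<one>\<^bsub>gr G\<^esub>" z] add(3)[of z "\<one>\<^bsub>gr G\<^esub>" "\<one>\<^bsub>gr G\<^esub>"] that gr_lbr_closed by auto
  have rearrange: "(a \<otimes>\<^bsub>gr G\<^esub> b) \<otimes>\<^bsub>gr G\<^esub> (c \<otimes>\<^bsub>gr G\<^esub> d) = \<one>\<^bsub>gr G\<^esub>"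
    if "a \<in> carrier (gr G)" "b \<in> carrier (gr G)" "c \<in> carrier (gr G)" "d \<in> carrier (gr G)"
      "a \<otimes>\<^bsub>gr G\<^esub> c = \<one>\<^bsub>gr G\<^esub>" "b \<otimes>\<^bsub>gr G\<^esub> d = \<one>\<^bsub>gr G\<^esub>" for a b c d
  proof -
    have "(a \<otimes>\<^bsub>gr G\<^esub> b) \<otimes>\<^bsub>gr G\<^esub> (c \<otimes>\<^bsub>gr G\<^esub> d) = (a \<otimes>\<^bsub>gr G\<^esub> c) \<otimes>\<^bsub>gr G\<^esub> (b \<otimes>\<^bsub>gr G\<^esub> d)"
      using that(1-4) by (simp add: gr.m_ac)
    then show ?thesis by (simp add: that)
  qed
  show ?thesis
    using assms
  proof (induction x rule: gr_induct)
    case one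
    then show ?case by (simp add: zero)
  next
    case (mult f g)
    then show ?case by (simp add: add rearrange)
  next
    case (elem n a)
    from elem(3) show ?case
    proof (induction y rule: gr_induct)
      case one
      then show ?case using elem gr_elem_closed by (simp add: zero)
    next
      case (mult f g)
      then show ?case using elem gr_elem_closed by (simp add: add rearrange)
    next
      case (elem m b)
      note na = \<open>1 \<le> n\<close> \<open>a \<in> lower_central G n\<close>
      have car: "a \<in> carrier G" "b \<in> carrier G" using elem na lower_central_carrier by auto
      have "commutator G b a = inv (commutator G a b)" using car by (simp add: inv_commutator)
      then show ?case
        using gr_elem_lbr[OF na(1) elem(1) na(2) elem(2)] gr_elem_lbr[OF elem(1) na(1) elem(2) na(2)]
          gr_elem_mult[of "n + m" "commutator G a b" "commutator G b a"] na elem car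
          commutator_lower_central[OF na(1) elem(1) na(2) elem(2)]
          lower_central_inv[OF commutator_lower_central[OF na(1) elem(1) na(2) elem(2)]]
        by (simp add: add.commute gr_elem_one)
    qed
  qed
qed

text \<open>
  On a sum $f + g$ the mixed terms $[f, g] + [g, f]$ cancel, so antisymmetry is proved first.
\<close>

lemma gr_lbr_self:
  assumes "x \<in> carrier (gr G)"
  shows "\<lbrakk>x, x\<rbrakk>\<^bsub>gr G\<^esub> = \<one>\<^bsub>gr G\<^esub>"
  using assms
proof (induction x rule: gr_induct)
  case one
  interpret gr: comm_group "gr G" by (rule comm_group_gr)
  show ?case using gr_lbr_add_left[of "\<one>\<^bsub>gr G\<^esub>" "\<one>\<^bsub>gr G\<^esub>" "\<one>\<^bsub>gr G\<^esub>"] gr_lbr_closed by auto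
next
  case (mult f g)
  interpret gr: comm_group "gr G" by (rule comm_group_gr)
  from mult show ?case
    using gr_lbr_antisym[of f g] gr_lbr_antisym[of g f]
        by (simp add: gr_lbr_add_left gr_lbr_add_right gr_lbr_closed)
next
  case (elem n a)
  then show ?case
    using lower_central_carrier by (simp add: gr_elem_lbr commutator_def m_assoc gr_elem_one)
qed

text \<open>
  For homogeneous elements this is the Hall--Witt identity; conjugation is invisible in the associated
      graded ring.
\<close>

lemma gr_jacobi:
  assumes "x \<in> carrier (gr G)" "y \<in> carrier (gr G)" "z \<in> carrier (gr G)"
  shows "\<lbrakk>\<lbrakk>x, y\<rbrakk>\<^bsub>gr G\<^esub>, z\<rbrakk>\<^bsub>gr G\<^esub> \<otimes>\<^bsub>gr G\<^esub> \<lbrakk>\<lbrakk>y, z\<rbrakk>\<^bsub>gr G\<^esub>, x\<rbrakk>\<^bsub>gr G\<^esub> \<otimes>\<^bsub>gr G\<^esub> \<lbrakk>\<lbrakk>z, x\<rbrakk>\<^bsub>gr G\<^esub>, y\<rbrakk>\<^bsub>gr G\<^esub> = \<one>\<^bsub>gr G\<^esub>"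
    (is "?J x y z = _")
proof -
  interpret gr: comm_group "gr G" by (rule comm_group_gr)
  note add = gr_lbr_closed gr_lbr_add_left gr_lbr_add_right
  have zero: "\<lbrakk>\<one>\<^bsub>gr G\<^esub>, z\<rbrakk>\<^bsub>gr G\<^esub> = \<one>\<^bsub>gr G\<^esub>" "\<lbrakk>z, \<one>\<^bsub>gr G\<^esub>\<rbrakk>\<^bsub>gr G\<^esub> = \<one>\<^bsub>gr G\<^esub>" if "z \<in> carrier (gr G)" for z
    using add(2)[of "\<one>\<^bsub>gr G\<^esub>" "\<one>\<^bsub>gr G\<^esub>" z] add(3)[of z "\<one>\<^bsub>gr G\<^esub>" "\<one>\<^bsub>gr G\<^esub>"] that gr_lbr_closed by auto
  have rearrange: "(a \<otimes>\<^bsub>gr G\<^esub> a') \<otimes>\<^bsub>gr G\<^esub> (b \<otimes>\<^bsub>gr G\<^esub> b') \<otimes>\<^bsub>gr G\<^esub> (c \<otimes>\<^bsub>gr G\<^esub> c')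
      = (a \<otimes>\<^bsub>gr G\<^esub> b \<otimes>\<^bsub>gr G\<^esub> c) \<otimes>\<^bsub>gr G\<^esub> (a' \<otimes>\<^bsub>gr G\<^esub> b' \<otimes>\<^bsub>gr G\<^esub> c')"
    if "a \<in> carrier (gr G)" "b \<in> carrier (gr G)" "c \<in> carrier (gr G)"
      "a' \<in> carrier (gr G)" "b' \<in> carrier (gr G)" "c' \<in> carrier (gr G)" for a b c a' b' c'
    using that by (simp add: gr.m_ac)
  have hom: "?J x y z = \<one>\<^bsub>gr G\<^esub>" if x: "x = gr_elem G i a" "1 \<le> i" "a \<in> lower_central G i"
    and y: "y = gr_elem G j b" "1 \<le> j" "b \<in> lower_central G j"
    and z: "z = gr_elem G k c" "1 \<le> k" "c \<in> lower_central G k" for x y z i j k a b c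
  proof -
    let ?n = "i + j + k"
    have car: "a \<in> carrier G" "b \<in> carrier G" "c \<in> carrier G" using x y z lower_central_carrier by auto
    have xyz: "x \<in> carrier (gr G)" "y \<in> carrier (gr G)" "z \<in> carrier (gr G)"
      using gr_elem_closed x y z by auto
    \<comment> \<open>Each of the three factors of the Hall--Witt identity is a double bracket, negated by the inner inverse.\<close>
    have double: "gr_elem G ?n (inv q \<otimes> commutator G (commutator G p (inv q)) r \<otimes> q)
      = inv\<^bsub>gr G\<^esub> \<lbrakk>\<lbrakk>gr_elem G p' p, gr_elem G q' q\<rbrakk>\<^bsub>gr G\<^esub>, gr_elem G r' r\<rbrakk>\<^bsub>gr G\<^esub>
      \<and> inv q \<otimes> commutator G (commutator G p (inv q)) r \<otimes> q \<in> lower_central G ?n"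
      if p: "p \<in> lower_central G p'" "1 \<le> p'" and q: "q \<in> lower_central G q'" "1 \<le> q'" and r:
          "r \<in> lower_central G r'" "1 \<le> r'"
        and n: "?n = p' + q' + r'" for p q r p' q' r'
    proof -
      let ?c = "commutator G (commutator G p (inv q)) r"
      have car: "p \<in> carrier G" "q \<in> carrier G" "r \<in> carrier G" using p q r lower_central_carrier by auto
      have el: "gr_elem G p' p \<in> carrier (gr G)" "gr_elem G q' q \<in> carrier (gr G)"
          "gr_elem G r' r \<in> carrier (gr G)"
        using gr_elem_closed p q r by auto
      have inv_l: "\<lbrakk>inv\<^bsub>gr G\<^esub> u, v\<rbrakk>\<^bsub>gr G\<^esub> = inv\<^bsub>gr G\<^esub> \<lbrakk>u, v\<rbrakk>\<^bsub>gr G\<^esub>"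
        and inv_r: "\<lbrakk>u, inv\<^bsub>gr G\<^esub> v\<rbrakk>\<^bsub>gr G\<^esub> = inv\<^bsub>gr G\<^esub> \<lbrakk>u, v\<rbrakk>\<^bsub>gr G\<^esub>"
        if "u \<in> carrier (gr G)" "v \<in> carrier (gr G)" for u v
        using that zero add by (auto intro!: gr.inv_equality[symmetric] simp flip: add(2,3))
      have pq: "commutator G p (inv q) \<in> lower_central G (p' + q')"
        using commutator_lower_central[OF p(2) q(2) p(1) lower_central_inv[OF q(1)]] .
      have c: "?c \<in> lower_central G ?n"
        using commutator_lower_central[OF _ r(2) pq r(1)] p n by simp
      have "inv q \<otimes> ?c \<otimes> q = ?c \<otimes> commutator G ?c q \<otimes> \<one>"
        using car by (simp add: conj_eq_commutator)
      moreover have "commutator G ?c q \<in> lower_central G (Suc ?n)"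
        using commutator_lower_central_1[OF c car(2)] .
      ultimately have "gr_class G ?n (inv q \<otimes> ?c \<otimes> q) = gr_class G ?n ?c"
        using gr_class_absorb[of "commutator G ?c q" ?n ?c \<one>] car by simp
      then have "gr_elem G ?n (inv q \<otimes> ?c \<otimes> q) = gr_elem G ?n ?c" by (simp only: gr_elem_def)
      also have "\<dots> = \<lbrakk>\<lbrakk>gr_elem G p' p, inv\<^bsub>gr G\<^esub> gr_elem G q' q\<rbrakk>\<^bsub>gr G\<^esub>, gr_elem G r' r\<rbrakk>\<^bsub>gr G\<^esub>"
        using p q r n pq lower_central_inv by (simp add: gr_elem_inv gr_elem_lbr)
      also have "\<dots> = inv\<^bsub>gr G\<^esub> \<lbrakk>\<lbrakk>gr_elem G p' p, gr_elem G q' q\<rbrakk>\<^bsub>gr G\<^esub>, gr_elem G r' r\<rbrakk>\<^bsub>gr G\<^esub>"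
        using el by (simp add: inv_l inv_r add(1))
      finally show ?thesis using lower_central_conj[OF c car(2)] by simp
    qed
    note d1 = double[OF x(3,2) y(3,2) z(3,2) HOL.refl]
      and d2 = double[OF y(3,2) z(3,2) x(3,2)] and d3 = double[OF z(3,2) x(3,2) y(3,2)]
    have "\<one>\<^bsub>gr G\<^esub> = gr_elem G ?n ((inv b \<otimes> commutator G (commutator G a (inv b)) c \<otimes> b) \<otimes>
       (inv c \<otimes> commutator G (commutator G b (inv c)) a \<otimes> c) \<otimes>
       (inv a \<otimes> commutator G (commutator G c (inv a)) b \<otimes> a))"
      using hall_witt[OF car] by (simp add: gr_elem_one)
    also have "\<dots> = gr_elem G ?n (inv b \<otimes> commutator G (commutator G a (inv b)) c \<otimes> b) \<otimes>\<^bsub>gr G\<^esub>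
       gr_elem G ?n (inv c \<otimes> commutator G (commutator G b (inv c)) a \<otimes> c) \<otimes>\<^bsub>gr G\<^esub>
       gr_elem G ?n (inv a \<otimes> commutator G (commutator G c (inv a)) b \<otimes> a)"
    proof -
      have n: "1 \<le> ?n" using x(2) by simp
      have m: "inv b \<otimes> commutator G (commutator G a (inv b)) c \<otimes> b \<in> lower_central G ?n"
        "inv c \<otimes> commutator G (commutator G b (inv c)) a \<otimes> c \<in> lower_central G ?n"
        "inv a \<otimes> commutator G (commutator G c (inv a)) b \<otimes> a \<in> lower_central G ?n"
        using d1 d2 d3 by simp_all
      show ?thesis
        by (simp only: gr_elem_mult[OF n m(1,2)] gr_elem_mult[OF n lower_central_mult[OF m(1,2)] m(3)])
    qed
    also have "\<dots> = inv\<^bsub>gr G\<^esub> \<lbrakk>\<lbrakk>x, y\<rbrakk>\<^bsub>gr G\<^esub>, z\<rbrakk>\<^bsub>gr G\<^esub> \<otimes>\<^bsub>gr G\<^esub> inv\<^bsub>gr G\<^esub> \<lbrakk>\<lbrakk>y, z\<rbrakk>\<^bsub>gr G\<^esub>, x\<rbrakk>\<^bsub>gr G\<^esub>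
        \<otimes>\<^bsub>gr G\<^esub> inv\<^bsub>gr G\<^esub> \<lbrakk>\<lbrakk>z, x\<rbrakk>\<^bsub>gr G\<^esub>, y\<rbrakk>\<^bsub>gr G\<^esub>"
      using d1 d2 d3 x(1) y(1) z(1) by simp
    also have "\<dots> = inv\<^bsub>gr G\<^esub> (?J x y z)"
      using xyz by (simp add: gr.inv_mult add)
    finally show ?thesis
      using gr.inv_eq_1_iff[of "?J x y z"] xyz by (simp add: add)
  qed
  show ?thesis
    using assms
  proof (induction x rule: gr_induct)
    case one
    then show ?case by (simp add: zero add)
  next
    case (mult f g)
    then show ?case by (simp add: add rearrange)
  next
    case (elem i a)
    note x = gr_elem_closed[OF elem(1,2)] elem(1,2)
    from elem(3,4) show ?case
    proof (induction y rule: gr_induct)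
      case one
      then show ?case by (simp add: zero add x)
    next
      case (mult f g)
      then show ?case by (simp add: add rearrange x)
    next
      case (elem j b)
      note y = gr_elem_closed[OF elem(1,2)] elem(1,2)
      from elem(3) show ?case
      proof (induction z rule: gr_induct)
        case one
        then show ?case by (simp add: zero add x y)
      next
        case (mult f g)
        then show ?case by (simp add: add rearrange x y)
      next
        case (elem k c)
        then show ?case using hom[OF HOL.refl x(2,3) HOL.refl y(2,3) HOL.refl elem] by simp
      qed
    qed
  qed
qed

theorem lie_ring_gr: "lie_ring (gr G)"
proof -
  interpret gr: comm_group "gr G" by (rule comm_group_gr)
  show ?thesis
    by unfold_locales (simp_all add: gr_lbr_closed gr_lbr_add_left gr_lbr_add_right gr_lbr_self gr_jacobi)
qed

text \<open>
  The term $\gamma_{n+1}$ is generated by commutators $(a, b)$ with $a \in \gamma_n$, and the class of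
  such a commutator is a bracket with an element of degree one.
\<close>

lemma gr_generated_in_degree_one:
  assumes sub: "subgroup H (gr G)" and lbr: "\<And>x y. \<lbrakk>x \<in> H; y \<in> H\<rbrakk> \<Longrightarrow> \<lbrakk>x, y\<rbrakk>\<^bsub>gr G\<^esub> \<in> H"
    and G: "carrier G = generate G S" and S: "S \<subseteq> carrier G" and gen: "\<And>s. s \<in> S \<Longrightarrow> gr_elem G 1 s \<in> H"
  shows "H = carrier (gr G)"
proof -
  interpret gr: comm_group "gr G" by (rule comm_group_gr)
  \<comment> \<open>In degree one the class map is a homomorphism, so generators of the group suffice.\<close>
  have one: "gr_elem G 1 g \<in> H" if "g \<in> carrier G" for g
  proof -
    from that have "g \<in> generate G S" using G by simp
    then show ?thesis
    proof (induction g rule: generate.induct)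
      case one
      then show ?case using subgroup.one_closed[OF sub] by (simp only: gr_elem_one)
    next
      case (incl h)
      then show ?case by (rule gen)
    next
      case (inv h)
      then have "inv\<^bsub>gr G\<^esub> gr_elem G 1 h \<in> H" using gen subgroup.m_inv_closed[OF sub] by blast
      then show ?case using inv S gr_elem_inv[of 1 h] by auto
    next
      case (eng h1 h2)
      then have "h1 \<in> lower_central G 1" "h2 \<in> lower_central G 1" using generate_in_carrier[OF S] by auto
      then show ?case using subgroup.m_closed[OF sub eng(3,4)] gr_elem_mult[of 1 h1 h2] by simp
    qed
  qed
  have elem: "gr_elem G n a \<in> H" if "n \<ge> 1" "a \<in> lower_central G n" for n a
    using that
  proof (induction n arbitrary: a rule: nat_induct_at_least)
    case base
    then show ?case using one by simp
  next
    case (Suc n)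
    let ?S = "{commutator G a b | a b. a \<in> lower_central G n \<and> b \<in> carrier G}"
    have comm: "gr_elem G (Suc n) (commutator G b g) \<in> H" if "b \<in> lower_central G n" "g \<in> carrier G" for b g
      using gr_elem_lbr[of n 1 b g] lbr[OF Suc.IH one, of b g] that Suc(1) by simp
    have sub': "?S \<subseteq> lower_central G (Suc n)" using commutator_lower_central_1 by blast
    have "a \<in> generate G ?S" using Suc lower_central_Suc by blast
    then show ?case
    proof (induction a rule: generate.induct)
      case one
      then show ?case using subgroup.one_closed[OF sub] by (simp only: gr_elem_one)
    next
      case (incl h)
      then show ?case using comm by blast
    next
      case (inv h)
      then have "inv\<^bsub>gr G\<^esub> gr_elem G (Suc n) h \<in> H" using comm subgroup.m_inv_closed[OF sub] by blast
      moreover have "h \<in> lower_central G (Suc n)" using inv sub' by blast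
      ultimately show ?case using gr_elem_inv[of "Suc n" h] by simp
    next
      case (eng h1 h2)
      then have "h1 \<in> lower_central G (Suc n)" "h2 \<in> lower_central G (Suc n)"
        using generate_subgroup_incl[OF sub' subgroup_lower_central] by auto
      then show ?case
        using subgroup.m_closed[OF sub eng(3,4)] gr_elem_mult[of "Suc n" h1 h2]
            by (simp del: lower_central.simps)
    qed
  qed
  have "f \<in> H" if "f \<in> carrier (gr G)" for f
    using that
  proof (induction f rule: gr_induct)
    case one
    then show ?case using subgroup.one_closed[OF sub] .
  next
    case (mult f g)
    then show ?case using subgroup.m_closed[OF sub] by blast
  qed (rule elem)
  then show ?thesis using subgroup.subset[OF sub] by blast
qed

end

section \<open>Homomorphisms between associated graded Lie rings\<close>

context group
begin

definition gr_rep :: "(nat \<Rightarrow> 'a set) \<Rightarrow> nat \<Rightarrow> 'a" where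
  "gr_rep f n = (SOME a. a \<in> lower_central G n \<and> f n = gr_class G n a)"

lemma gr_rep:
  assumes "f \<in> carrier (gr G)" "n \<ge> 1"
  shows "gr_rep f n \<in> lower_central G n" "f n = gr_class G n (gr_rep f n)"
proof -
  obtain a where "a \<in> lower_central G n" "f n = gr_class G n a" using gr_component[OF assms] by blast
  then have "\<exists>a. a \<in> lower_central G n \<and> f n = gr_class G n a" by blast
  from someI_ex[OF this] show "gr_rep f n \<in> lower_central G n" "f n = gr_class G n (gr_rep f n)"
    unfolding gr_rep_def by auto
qed

lemma gr_mult_component:
  assumes "f \<in> carrier (gr G)" "g \<in> carrier (gr G)" "n \<ge> 1"
  shows "(f \<otimes>\<^bsub>gr G\<^esub> g) n = gr_class G n (gr_rep f n \<otimes> gr_rep g n)"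
  using gr_rep[OF assms(1,3)] gr_rep[OF assms(2,3)] assms(3) lower_central_carrier
  by (simp add: mult_gr gr_class_mult)

end

lemma hom_commutator:
  assumes "group G" "group H" "h \<in> hom G H" "a \<in> carrier G" "b \<in> carrier G"
  shows "h (commutator G a b) = commutator H (h a) (h b)"
proof -
  interpret group_hom G H h using assms by (simp add: group_hom_def group_hom_axioms_def)
  show ?thesis using assms(4,5) by (simp add: commutator_def)
qed

lemma hom_lower_central:
  assumes "group G" "group H" "h \<in> hom G H" "a \<in> lower_central G c"
  shows "h a \<in> lower_central H c"
proof -
  interpret group_hom G H h using assms by (simp add: group_hom_def group_hom_axioms_def)
  show ?thesis
    using assms(4)
  proof (induction c arbitrary: a)
    case 0
    then show ?case by simp
  next
    case (Suc c)
    show ?case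
    proof (cases "c = 0")
      case True
      then show ?thesis using Suc by simp
    next
      case False
      then have c: "c \<ge> 1" by simp
      let ?S = "{commutator G a b | a b. a \<in> lower_central G c \<and> b \<in> carrier G}"
      have S: "?S \<subseteq> carrier G" using G.lower_central_carrier by auto
      have base: "h x \<in> lower_central H (Suc c)" if "x \<in> ?S" for x
      proof -
        from that obtain y z where yz: "x = commutator G y z" "y \<in> lower_central G c" "z \<in> carrier G" by blast
        then have "h x = commutator H (h y) (h z)"
          using hom_commutator[OF assms(1-3)] G.lower_central_carrier by blast
        then show ?thesis using H.commutator_lower_central_1 Suc.IH yz by simp
      qed
      have "a \<in> generate G ?S" using Suc.prems G.lower_central_Suc[OF c] by simp
      then show ?thesis
      proof (induction a rule: generate.induct)
        case one
        then show ?case using H.lower_central_one hom_one by (simp del: lower_central.simps)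
      next
        case (incl x)
        then show ?case by (rule base)
      next
        case (inv x)
        then have "inv\<^bsub>H\<^esub> h x \<in> lower_central H (Suc c)" using base H.lower_central_inv by blast
        moreover have "x \<in> carrier G" using S inv by blast
        ultimately show ?case using hom_inv[of x] by simp
      next
        case (eng x y)
        then have "x \<in> carrier G" "y \<in> carrier G" using G.generate_in_carrier[OF S] by auto
        then show ?case using H.lower_central_mult[OF eng(3,4)] by simp
      qed
    qed
  qed
qed

definition gr_map :: "('a, 'b) monoid_scheme \<Rightarrow> ('c, 'd) monoid_scheme \<Rightarrow> ('a \<Rightarrow> 'c) \<Rightarrow> (nat \<Rightarrow> 'a set) \<Rightarrow> nat \<Rightarrow>
    'c set" where
  "gr_map G H h f = (\<lambda>n\<in>{1..}. gr_class H n (h (group.gr_rep G f n)))"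

text \<open>
  Both sides of the required equation are biadditive, and homogeneous elements generate.
\<close>

lemma lie_hom_grI:
  assumes G: "group G" and K: "nonassoc_ring K"
    and closed: "\<And>f. f \<in> carrier (gr G) \<Longrightarrow> h f \<in> carrier K"
    and mult: "\<And>f g. f \<in> carrier (gr G) \<Longrightarrow> g \<in> carrier (gr G) \<Longrightarrow> h (f \<otimes>\<^bsub>gr G\<^esub> g) = h f \<otimes>\<^bsub>K\<^esub> h g"
    and lbr: "\<And>c d a b. \<lbrakk>c \<ge> 1; d \<ge> 1; a \<in> lower_central G c; b \<in> lower_central G d\<rbrakk> \<Longrightarrow>
      h (gr_elem G (c + d) (commutator G a b)) = \<lbrakk>h (gr_elem G c a), h (gr_elem G d b)\<rbrakk>\<^bsub>K\<^esub>"
  shows "h \<in> lie_hom (gr G) K"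
proof -
  interpret G: group G by fact
  interpret K: nonassoc_ring K by fact
  interpret gr: lie_ring "gr G" by (rule G.lie_ring_gr)
  interpret h: group_hom "gr G" K h
    using closed mult by (simp add: group_hom_def group_hom_axioms_def gr.is_group K.is_group hom_def)
  have elem_lbr: "h \<lbrakk>gr_elem G c a, y\<rbrakk>\<^bsub>gr G\<^esub> = \<lbrakk>h (gr_elem G c a), h y\<rbrakk>\<^bsub>K\<^esub>"
    if ca: "c \<ge> 1" "a \<in> lower_central G c" and y: "y \<in> carrier (gr G)" for c a y
    using y
  proof (induction y rule: G.gr_induct)
    case one
    then show ?case using G.gr_elem_closed[OF ca] by (simp add: gr.lbr_one_right K.lbr_one_right)
  next
    case (mult f g)
    then show ?case
      using G.gr_elem_closed[OF ca] by (simp add: gr.lbr_add_right K.lbr_add_right gr.lbr_closed)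
  next
    case (elem d b)
    then show ?case using lbr ca by (simp add: G.gr_elem_lbr)
  qed
  have "h \<lbrakk>x, y\<rbrakk>\<^bsub>gr G\<^esub> = \<lbrakk>h x, h y\<rbrakk>\<^bsub>K\<^esub>" if x: "x \<in> carrier (gr G)" and y: "y \<in> carrier (gr G)" for x y
    using x
  proof (induction x rule: G.gr_induct)
    case one
    then show ?case using y by (simp add: gr.lbr_one_left K.lbr_one_left)
  next
    case (mult f g)
    then show ?case using y by (simp add: gr.lbr_add_left K.lbr_add_left gr.lbr_closed)
  next
    case (elem c a)
    then show ?case using elem_lbr y by simp
  qed
  then show ?thesis using h.homh by (simp add: lie_hom_def)
qed

context
  fixes G :: "('a, 'b) monoid_scheme" and H :: "('c, 'd) monoid_scheme" and h
  assumes G: "group G" and H: "group H" and h: "h \<in> hom G H"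
begin

interpretation G: group G by (rule G)
interpretation H: group H by (rule H)
interpretation h: group_hom G H h using G H h by (simp add: group_hom_def group_hom_axioms_def)

lemma gr_map_component:
  assumes f: "f \<in> carrier (gr G)" and n: "n \<ge> 1" and a: "a \<in> lower_central G n" "f n = gr_class G n a"
  shows "gr_map G H h f n = gr_class H n (h a)"
proof -
  note r = G.gr_rep[OF f n]
  have c: "a \<in> carrier G" "G.gr_rep f n \<in> carrier G" using a r G.lower_central_carrier by auto
  obtain k where k: "k \<in> lower_central G (Suc n)" "G.gr_rep f n = k \<otimes>\<^bsub>G\<^esub> a"
    using r a c G.gr_class_eq_iff by metis
  then have "h (G.gr_rep f n) = h k \<otimes>\<^bsub>H\<^esub> h a" using c G.lower_central_carrier by simp
  moreover have "h k \<in> lower_central H (Suc n)" using hom_lower_central[OF G H h k(1)] .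
  ultimately have "gr_class H n (h (G.gr_rep f n)) = gr_class H n (h a)"
    using H.gr_class_eq_iff[of "h (G.gr_rep f n)" "h a" n] c by (metis h.hom_closed)
  then show ?thesis using n by (simp add: gr_map_def)
qed

lemma gr_map_elem:
  assumes n: "n \<ge> 1" and a: "a \<in> lower_central G n"
  shows "gr_map G H h (gr_elem G n a) = gr_elem H n (h a)"
proof
  fix i
  show "gr_map G H h (gr_elem G n a) i = gr_elem H n (h a) i"
  proof (cases "i \<ge> 1")
    case True
    show ?thesis
    proof (cases "i = n")
      case True
      then show ?thesis
        using gr_map_component[OF G.gr_elem_closed[OF n a] n a] n by (simp add: gr_elem_def)
    next
      case False
      then have "gr_elem G n a i = gr_class G i \<one>\<^bsub>G\<^esub>" using \<open>i \<ge> 1\<close>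
          by (simp add: gr_elem_def G.gr_class_one del: lower_central.simps)
      from gr_map_component[OF G.gr_elem_closed[OF n a] \<open>i \<ge> 1\<close> G.lower_central_one this]
      show ?thesis
        using False \<open>i \<ge> 1\<close> by (simp add: gr_elem_def[of H] H.gr_class_one del: lower_central.simps)
    qed
  qed (simp add: gr_map_def gr_elem_def)
qed

lemma gr_map_closed:
  assumes f: "f \<in> carrier (gr G)"
  shows "gr_map G H h f \<in> carrier (gr H)"
proof -
  have "gr_map G H h f i = lower_central H (Suc i)" if "f i = lower_central G (Suc i)" "i \<ge> 1" for i
    using gr_map_component[OF f that(2) G.lower_central_one] that(1)
    by (simp add: G.gr_class_one H.gr_class_one del: lower_central.simps)
  then have "{i \<in> {1..}. gr_map G H h f i \<noteq> lower_central H (Suc i)} \<subseteq> {i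
      \<in> {1..}. f i \<noteq> lower_central G (Suc i)}"
    by auto
  moreover have "finite {i \<in> {1..}. f i \<noteq> lower_central G (Suc i)}" using f by (simp add: G.carrier_gr)
  ultimately have "finite {i \<in> {1..}. gr_map G H h f i \<noteq> lower_central H (Suc i)}" by (rule finite_subset)
  moreover have "gr_map G H h f i \<in> carrier (gr_piece H i)" if "i \<ge> 1" for i
    using hom_lower_central[OF G H h G.gr_rep(1)[OF f that]] that by (auto simp: gr_map_def H.carrier_gr_piece)
  ultimately show ?thesis by (auto simp: H.carrier_gr gr_map_def)
qed

lemma gr_map_lie_hom: "gr_map G H h \<in> lie_hom (gr G) (gr H)"
proof (rule lie_hom_grI[OF G lie_ring_nonassoc[OF H.lie_ring_gr] gr_map_closed])
  fix f g assume f: "f \<in> carrier (gr G)" and g: "g \<in> carrier (gr G)"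
  interpret gr: lie_ring "gr G" by (rule G.lie_ring_gr)
  show "gr_map G H h (f \<otimes>\<^bsub>gr G\<^esub> g) = gr_map G H h f \<otimes>\<^bsub>gr H\<^esub> gr_map G H h g"
  proof
    fix n
    show "gr_map G H h (f \<otimes>\<^bsub>gr G\<^esub> g) n = (gr_map G H h f \<otimes>\<^bsub>gr H\<^esub> gr_map G H h g) n"
    proof (cases "n \<ge> 1")
      case True
      note r = G.gr_rep(1)[OF f True] G.gr_rep(1)[OF g True]
      have c: "G.gr_rep f n \<in> carrier G" "G.gr_rep g n \<in> carrier G" using r G.lower_central_carrier by auto
      have "gr_map G H h (f \<otimes>\<^bsub>gr G\<^esub> g) n = gr_class H n (h (G.gr_rep f n \<otimes>\<^bsub>G\<^esub> G.gr_rep g n))"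
        by (rule gr_map_component[OF gr.m_closed[OF f g] True G.lower_central_mult[OF r]
            G.gr_mult_component[OF f g True]])
      then show ?thesis using True c by (simp add: H.mult_gr gr_map_def H.gr_class_mult)
    qed (simp add: H.mult_gr gr_map_def)
  qed
next
  fix c d a b assume cd: "c \<ge> 1" "d \<ge> 1" "a \<in> lower_central G c" "b \<in> lower_central G d"
  have "h (commutator G a b) = commutator H (h a) (h b)"
    using hom_commutator[OF G H h] cd G.lower_central_carrier by blast
  then show "gr_map G H h (gr_elem G (c + d) (commutator G a b))
      = \<lbrakk>gr_map G H h (gr_elem G c a), gr_map G H h (gr_elem G d b)\<rbrakk>\<^bsub>gr H\<^esub>"
    using cd G.commutator_lower_central[OF cd] hom_lower_central[OF G H h]
    by (simp add: gr_map_elem H.gr_elem_lbr)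
qed

end

section \<open>Magnus representations\<close>

definition series_units :: "series monoid" where
  "series_units = units_of \<lparr>carrier = UNIV, monoid.mult = (*), one = 1\<rparr>"

lemma monoid_series: "monoid \<lparr>carrier = UNIV, monoid.mult = (*), one = (1 :: series)\<rparr>"
  by unfold_locales (auto simp: mult.assoc)

lemma group_series_units: "group series_units"
  unfolding series_units_def by (rule monoid.units_group[OF monoid_series])

lemma series_units_simps [simp]:
  "carrier series_units = {f. \<exists>g. g * f = 1 \<and> f * g = 1}"
  "f \<otimes>\<^bsub>series_units\<^esub> g = f * g" "\<one>\<^bsub>series_units\<^esub> = 1"
  by (auto simp: series_units_def units_of_def Units_def)

lemma coeff_homogeneous_part: "coeff (homogeneous_part n f) w = (if length w = n then coeff f w else 0)"
  by (simp add: homogeneous_part_def)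

lemma homogeneous_part_arith:
  "homogeneous_part n (f + g) = homogeneous_part n f + homogeneous_part n g"
  "homogeneous_part n (f - g) = homogeneous_part n f - homogeneous_part n g"
  by (auto intro!: series_eqI simp: coeff_homogeneous_part)

lemma homogeneous_part_order: "f \<in> order_ge (Suc n) \<Longrightarrow> homogeneous_part n f = 0"
  by (auto intro!: series_eqI simp: coeff_homogeneous_part order_geD)

lemma homogeneous_part_mult:
  assumes f: "f \<in> order_ge m" and g: "g \<in> order_ge n"
  shows "homogeneous_part (m + n) (f * g) = homogeneous_part m f * homogeneous_part n g"
proof (rule series_eqI)
  fix w
  show "coeff (homogeneous_part (m + n) (f * g)) w = coeff (homogeneous_part m f * homogeneous_part n g) w"
  proof (cases "length w = m + n")
    case True
    have "coeff f (take k w) * coeff g (drop k w) = coeff (homogeneous_part m f) (take k w) * coeff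
        (homogeneous_part n g) (drop k w)"
      if "k \<le> length w" for k
    proof -
      consider "k < m" | "k = m" | "k > m" by linarith
      then show ?thesis
        using True that order_geD[OF f, of "take k w"] order_geD[OF g, of "drop k w"]
        by cases (auto simp: coeff_homogeneous_part)
    qed
    then show ?thesis using True by (simp add: coeff_homogeneous_part[of "m + n"] coeff_mult)
  next
    case False
    then have "coeff (homogeneous_part m f) (take k w) * coeff (homogeneous_part n g) (drop k w) = 0" if
        "k \<le> length w" for k
      using that by (auto simp: coeff_homogeneous_part)
    then have "coeff (homogeneous_part m f * homogeneous_part n g) w = 0"
      unfolding coeff_mult by (intro sum.neutral) simp
    then show ?thesis using False by (simp add: coeff_homogeneous_part[of "m + n"])
  qed
qed

text \<open>
  A representation by series with constant coefficient 1.  It carries the lower central series into the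
      filtration of
  series by order.
\<close>

locale magnus_hom = group G for G (structure) +
  fixes \<mu>
  assumes hom: "\<mu> \<in> hom G series_units"
    and order_1: "g \<in> carrier G \<Longrightarrow> \<mu> g - 1 \<in> order_ge 1"
begin

sublocale m: group_hom G series_units \<mu>
  using hom group_series_units by (simp add: group_hom_def group_hom_axioms_def is_group)

declare m.hom_inv [simp del]

lemma mu_mult: "a \<in> carrier G \<Longrightarrow> b \<in> carrier G \<Longrightarrow> \<mu> (a \<otimes> b) = \<mu> a * \<mu> b"
  using m.hom_mult[of a b] by simp

lemma mu_one: "\<mu> \<one> = 1"
  using m.hom_one by simp

lemma mu_inv: "a \<in> carrier G \<Longrightarrow> \<mu> (inv a) * \<mu> a = 1" "a \<in> carrier G \<Longrightarrow> \<mu> a * \<mu> (inv a) = 1"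
  using mu_mult[of "inv a" a] mu_mult[of a "inv a"] mu_one by simp_all

text \<open>
  The ring commutator appears because $a^{-1}b^{-1}ab - 1 = a^{-1}b^{-1}(ab - ba)$.
\<close>

lemma mu_commutator:
  assumes "a \<in> carrier G" "b \<in> carrier G"
  shows "\<mu> (commutator G a b) - 1 = \<mu> (inv a) * \<mu> (inv b) * ((\<mu> a - 1) * (\<mu> b - 1) - (\<mu> b - 1) * (\<mu> a - 1))"
proof -
  have "\<mu> (inv a) * \<mu> (inv b) * (\<mu> b * \<mu> a) = \<mu> (inv a) * (\<mu> (inv b) * \<mu> b) * \<mu> a" by (simp only: mult.assoc)
  also have "\<dots> = 1" using assms by (simp add: mu_inv)
  finally show ?thesis
    using assms by (simp add: commutator_def mu_mult algebra_simps)
qed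

lemma order_ge_mult_any:
  assumes "g \<in> order_ge n"
  shows "f * g \<in> order_ge n" "g * f \<in> order_ge n"
  using order_ge_mult[of f 0 g n] order_ge_mult[of g n f 0] assms by simp_all

lemma order_lower_central:
  assumes "a \<in> lower_central G n"
  shows "\<mu> a - 1 \<in> order_ge n"
  using assms
proof (induction n arbitrary: a)
  case (Suc n)
  show ?case
  proof (cases "n = 0")
    case True
    then show ?thesis using Suc.prems order_1 by simp
  next
    case False
    then have n: "n \<ge> 1" by simp
    let ?S = "{commutator G a b | a b. a \<in> lower_central G n \<and> b \<in> carrier G}"
    have S: "?S \<subseteq> carrier G" using lower_central_carrier by auto
    have base: "\<mu> x - 1 \<in> order_ge (Suc n)" if "x \<in> ?S" for x
    proof -
      from that obtain y z where yz: "x = commutator G y z" "y \<in> lower_central G n" "z \<in> carrier G" by blast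
      have "(\<mu> y - 1) * (\<mu> z - 1) - (\<mu> z - 1) * (\<mu> y - 1) \<in> order_ge (Suc n)"
        using order_ge_mult[OF Suc.IH[OF yz(2)] order_1[OF yz(3)]] order_ge_mult[OF order_1[OF yz(3)]
            Suc.IH[OF yz(2)]]
        by (intro order_ge_arith) simp_all
      then show ?thesis
        using mu_commutator[of y z] yz lower_central_carrier order_ge_mult_any by simp
    qed
    have inv: "\<mu> (inv x) - 1 \<in> order_ge (Suc n)" if "x \<in> carrier G" "\<mu> x - 1 \<in> order_ge (Suc n)" for x
    proof -
      have "\<mu> (inv x) - 1 = - (\<mu> (inv x) * (\<mu> x - 1))"
        using mu_inv[OF that(1)] by (simp add: algebra_simps)
      moreover have "\<mu> (inv x) * (\<mu> x - 1) \<in> order_ge (Suc n)" using that(2) by (rule order_ge_mult_any)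
      ultimately show ?thesis by (simp only: order_ge_arith(3))
    qed
    have "a \<in> generate G ?S" using Suc.prems lower_central_Suc[OF n] by simp
    then show ?thesis
    proof (induction a rule: generate.induct)
      case one
      then show ?case by (simp add: mu_one)
    next
      case (incl x)
      then show ?case by (rule base)
    next
      case (inv x)
      moreover have "x \<in> carrier G" using S inv by blast
      ultimately show ?case using \<open>\<And>x. x \<in> carrier G \<Longrightarrow> \<mu> x - 1 \<in> order_ge (Suc n) \<Longrightarrow> \<mu> (inv x) - 1
          \<in> order_ge (Suc n)\<close> base by blast
    next
      case (eng x y)
      then have c: "x \<in> carrier G" "y \<in> carrier G" using generate_in_carrier[OF S] by auto
      have "\<mu> (x \<otimes> y) - 1 = (\<mu> x - 1) * \<mu> y + (\<mu> y - 1)" using c by (simp add: mu_mult algebra_simps)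
      moreover have "(\<mu> x - 1) * \<mu> y + (\<mu> y - 1) \<in> order_ge (Suc n)"
        using order_ge_mult_any(2)[OF eng(3)] eng(4) by (rule order_ge_arith(1))
      ultimately show ?case by (simp only:)
    qed
  qed
qed simp

text \<open>
  The coefficient at a word of length $n$ is read off from a representative in degree $n$.  There is no
  degree zero, hence the value at the empty word.
\<close>

definition leading :: "(nat \<Rightarrow> 'a set) \<Rightarrow> series" where
  "leading f = Series (\<lambda>w. if w = [] then 0 else coeff (\<mu> (gr_rep f (length w))) w)"

lemma coeff_leading:
  assumes f: "f \<in> carrier (gr G)" and n: "n \<ge> 1" and a: "a \<in> lower_central G n" "f n = gr_class G n a"
      and w: "length w = n"
  shows "coeff (leading f) w = coeff (\<mu> a) w"
proof -
  note r = gr_rep[OF f n]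
  have c: "a \<in> carrier G" "gr_rep f n \<in> carrier G" using a r lower_central_carrier by auto
  obtain k where k: "k \<in> lower_central G (Suc n)" "gr_rep f n = k \<otimes> a"
    using r a c gr_class_eq_iff by metis
  have "\<mu> (gr_rep f n) - \<mu> a = (\<mu> k - 1) * \<mu> a"
    using k c lower_central_carrier by (simp add: mu_mult algebra_simps)
  moreover have "(\<mu> k - 1) * \<mu> a \<in> order_ge (Suc n)" using order_lower_central[OF k(1)]
      by (rule order_ge_mult_any)
  ultimately have "coeff (\<mu> (gr_rep f n) - \<mu> a) w = 0" using order_geD w by simp
  then show ?thesis using n w by (auto simp: leading_def)
qed

lemma leading_elem:
  assumes n: "n \<ge> 1" and a: "a \<in> lower_central G n"
  shows "leading (gr_elem G n a) = homogeneous_part n (\<mu> a - 1)"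
proof (rule series_eqI)
  fix w :: "nat list"
  note el = gr_elem_closed[OF n a]
  consider "w = []" | "length w = n" | "length w \<noteq> n" "length w \<ge> 1" by (cases w) auto
  then show "coeff (leading (gr_elem G n a)) w = coeff (homogeneous_part n (\<mu> a - 1)) w"
  proof cases
    case 1
    then show ?thesis using n by (simp add: leading_def coeff_homogeneous_part)
  next
    case 2
    then show ?thesis
      using coeff_leading[OF el n a _ 2] n by (auto simp: gr_elem_def coeff_homogeneous_part coeff_one)
  next
    case 3
    then have "gr_elem G n a (length w) = gr_class G (length w) \<one>"
      by (simp add: gr_elem_def gr_class_one del: lower_central.simps)
    from coeff_leading[OF el 3(2) lower_central_one this HOL.refl]
    show ?thesis using 3 by (auto simp: mu_one coeff_one coeff_homogeneous_part)
  qed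
qed

text \<open>
  The leading terms of $AB - BA$ and of $\mu(a^{-1}b^{-1})(AB - BA)$ agree, where $A = \mu(a) - 1$ and
  $B = \mu(b) - 1$, because $\mu(a^{-1}b^{-1})$ is 1 plus terms of positive order.
\<close>

lemma leading_lie_hom: "leading \<in> lie_hom (gr G) assoc_lie"
proof (rule lie_hom_grI[OF is_group lie_ring_nonassoc[OF lie_ring_assoc_lie]])
  fix f g assume f: "f \<in> carrier (gr G)" and g: "g \<in> carrier (gr G)"
  interpret gr: lie_ring "gr G" by (rule lie_ring_gr)
  show "leading (f \<otimes>\<^bsub>gr G\<^esub> g) = leading f \<otimes>\<^bsub>assoc_lie\<^esub> leading g"
  proof (rule series_eqI)
    fix w
    show "coeff (leading (f \<otimes>\<^bsub>gr G\<^esub> g)) w = coeff (leading f \<otimes>\<^bsub>assoc_lie\<^esub> leading g) w"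
    proof (cases "w = []")
      case False
      let ?n = "length w"
      let ?a = "gr_rep f ?n" and ?b = "gr_rep g ?n"
      have n: "?n \<ge> 1" using False by (cases w) auto
      note r = gr_rep[OF f n] and s = gr_rep[OF g n]
      have c: "?a \<in> carrier G" "?b \<in> carrier G" using r s lower_central_carrier by auto
      have "coeff (leading (f \<otimes>\<^bsub>gr G\<^esub> g)) w = coeff (\<mu> (?a \<otimes> ?b)) w"
        by (rule coeff_leading[OF gr.m_closed[OF f g] n lower_central_mult[OF r(1) s(1)]
            gr_mult_component[OF f g n] HOL.refl])
      also have "\<mu> (?a \<otimes> ?b) = (\<mu> ?a - 1) * (\<mu> ?b - 1) + \<mu> ?a + \<mu> ?b - 1"
        using c by (simp add: mu_mult algebra_simps)
      also have "coeff \<dots> w = coeff (\<mu> ?a) w + coeff (\<mu> ?b) w"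
      proof -
        have "(\<mu> ?a - 1) * (\<mu> ?b - 1) \<in> order_ge (?n + ?n)"
          using order_ge_mult[OF order_lower_central[OF r(1)] order_lower_central[OF s(1)]] .
        then have "coeff ((\<mu> ?a - 1) * (\<mu> ?b - 1)) w = 0" using n by (intro order_geD) auto
        then show ?thesis using False by (simp add: coeff_one)
      qed
      finally show ?thesis
        using False by (simp add: leading_def)
    qed (simp add: leading_def)
  qed
next
  fix c d a b assume cd: "c \<ge> 1" "d \<ge> 1" "a \<in> lower_central G c" "b \<in> lower_central G d"
  let ?A = "\<mu> a - 1" and ?B = "\<mu> b - 1"
  have car: "a \<in> carrier G" "b \<in> carrier G" using cd lower_central_carrier by auto
  note A = order_lower_central[OF cd(3)] and B = order_lower_central[OF cd(4)]
  have C: "?A * ?B - ?B * ?A \<in> order_ge (c + d)"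
    using order_ge_mult[OF A B] order_ge_mult[OF B A] by (intro order_ge_arith) (simp_all add: add.commute)
  have "\<mu> (inv a) * \<mu> (inv b) - 1 \<in> order_ge 1"
    using order_1[of "inv a \<otimes> inv b"] car by (simp add: mu_mult)
  from order_ge_mult[OF this C] have D: "(\<mu> (inv a) * \<mu> (inv b) - 1) * (?A * ?B - ?B * ?A)
      \<in> order_ge (Suc (c + d))"
    by simp
  have "\<mu> (commutator G a b) - 1 = (?A * ?B - ?B * ?A) + (\<mu> (inv a) * \<mu> (inv b) - 1) * (?A * ?B - ?B * ?A)"
    unfolding mu_commutator[OF car] by (simp add: left_diff_distrib)
  then have "homogeneous_part (c + d) (\<mu> (commutator G a b) - 1) = homogeneous_part (c + d) (?A * ?B - ?B * ?A)"
    using homogeneous_part_order[OF D] by (simp add: homogeneous_part_arith(1))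
  also have "\<dots> = homogeneous_part c ?A * homogeneous_part d ?B - homogeneous_part d ?B * homogeneous_part c ?A"
    using homogeneous_part_mult[OF A B] homogeneous_part_mult[OF B A]
        by (simp add: homogeneous_part_arith(2) add.commute)
  finally show "leading (gr_elem G (c + d) (commutator G a b))
      = \<lbrakk>leading (gr_elem G c a), leading (gr_elem G d b)\<rbrakk>\<^bsub>assoc_lie\<^esub>"
    using cd commutator_lower_central[OF cd] by (simp add: leading_elem)
qed simp

end

section \<open>Free groups\<close>

abbreviation word_class :: "'a set \<Rightarrow> ('a \<times> bool) list \<Rightarrow> ('a \<times> bool) list set" where
  "word_class X u \<equiv> free_group_rel X `` {u}"

lemma free_group_eq_context:
  "free_group_eq u v \<Longrightarrow> free_group_eq (a @ u @ b) (a @ v @ b)"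
proof (induction rule: free_group_eq.induct)
  case (cancel u x e v)
  then show ?case using free_group_eq.cancel[of "a @ u" x e "v @ b"] by simp
qed (blast intro: free_group_eq.intros)+

lemma free_group_eq_append:
  assumes "free_group_eq u u'" "free_group_eq v v'"
  shows "free_group_eq (u @ v) (u' @ v')"
  using free_group_eq_context[OF assms(1), of "[]" v] free_group_eq_context[OF assms(2), of u' "[]"]
  by (auto intro: free_group_eq.trans)

lemma equiv_free_group_rel: "equiv (lists (X \<times> UNIV)) (free_group_rel X)"
proof (rule equivI)
  show "refl_on (lists (X \<times> UNIV)) (free_group_rel X)"
    by (auto simp: refl_on_def free_group_rel_def intro: free_group_eq.refl)
  show "sym (free_group_rel X)"
    by (auto simp: sym_def free_group_rel_def intro: free_group_eq.sym)
  show "trans (free_group_rel X)"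
    by (auto simp: trans_def free_group_rel_def intro: free_group_eq.trans)
qed (auto simp: free_group_rel_def)

lemma word_class_eq_iff:
  assumes "u \<in> lists (X \<times> UNIV)" "v \<in> lists (X \<times> UNIV)"
  shows "word_class X u = word_class X v \<longleftrightarrow> free_group_eq u v"
  using eq_equiv_class_iff[OF equiv_free_group_rel assms] assms by (simp add: free_group_rel_def)

lemma carrier_free_group: "carrier (free_group X) = word_class X ` lists (X \<times> UNIV)"
  by (auto simp: free_group_def quotient_def)

lemma one_free_group: "\<one>\<^bsub>free_group X\<^esub> = word_class X []"
  by (simp add: free_group_def)

lemma append_in_listsI: "u \<in> lists A \<Longrightarrow> v \<in> lists A \<Longrightarrow> u @ v \<in> lists A"
  by simp

lemma mult_free_group:
  assumes u: "u \<in> lists (X \<times> UNIV)" and v: "v \<in> lists (X \<times> UNIV)"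
  shows "word_class X u \<otimes>\<^bsub>free_group X\<^esub> word_class X v = word_class X (u @ v)"
proof -
  have same: "word_class X (u' @ v') = word_class X (u @ v)" if "u' \<in> word_class X u"
      "v' \<in> word_class X v" for u' v'
  proof -
    have "u' \<in> lists (X \<times> UNIV)" "v' \<in> lists (X \<times> UNIV)" "free_group_eq (u' @ v') (u @ v)"
      using that by (auto simp: free_group_rel_def intro!: free_group_eq_append intro: free_group_eq.sym)
    then show ?thesis using u v by (subst word_class_eq_iff) auto
  qed
  have "word_class X u \<noteq> {}" "word_class X v \<noteq> {}"
    using u v by (auto simp: free_group_rel_def intro: free_group_eq.refl)
  moreover have "(\<Union>u' \<in> word_class X u. \<Union>v' \<in> word_class X v. word_class X (u' @ v'))
    = (\<Union>u' \<in> word_class X u. \<Union>v' \<in> word_class X v. word_class X (u @ v))"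
    using same by (intro SUP_cong HOL.refl)
  ultimately show ?thesis by (simp add: free_group_def)
qed

definition inverse_word :: "('a \<times> bool) list \<Rightarrow> ('a \<times> bool) list" where
  "inverse_word u = rev (map (\<lambda>(x, e). (x, \<not> e)) u)"

lemma inverse_word_cancel: "free_group_eq (inverse_word u @ u) []"
proof (induction u)
  case Nil
  then show ?case by (simp add: inverse_word_def free_group_eq.refl)
next
  case (Cons a u)
  obtain x e where a: "a = (x, e)" by fastforce
  have "free_group_eq (inverse_word u @ [(x, \<not> e), (x, \<not> \<not> e)] @ u) (inverse_word u @ u)"
    by (rule free_group_eq.cancel)
  with Cons show ?case
    by (auto simp: a inverse_word_def intro: free_group_eq.trans)
qed

lemma inverse_word_lists: "u \<in> lists (X \<times> UNIV) \<Longrightarrow> inverse_word u \<in> lists (X \<times> UNIV)"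
  by (auto simp: inverse_word_def)

lemma group_free_group: "group (free_group X)"
proof (rule groupI)
  let ?F = "free_group X"
  fix a b c assume "a \<in> carrier ?F" "b \<in> carrier ?F" "c \<in> carrier ?F"
  then obtain u v w where *: "a = word_class X u" "b = word_class X v" "c = word_class X w"
    and m: "u \<in> lists (X \<times> UNIV)" "v \<in> lists (X \<times> UNIV)" "w \<in> lists (X \<times> UNIV)"
    by (auto simp only: carrier_free_group)
  then show "a \<otimes>\<^bsub>?F\<^esub> b \<otimes>\<^bsub>?F\<^esub> c = a \<otimes>\<^bsub>?F\<^esub> (b \<otimes>\<^bsub>?F\<^esub> c)"
    using append_in_listsI[OF m(1,2)] append_in_listsI[OF m(2,3)] by (simp add: mult_free_group)
next
  let ?F = "free_group X"
  fix a b assume "a \<in> carrier ?F" "b \<in> carrier ?F"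
  then obtain u v where *: "a = word_class X u" "b = word_class X v"
    and m: "u \<in> lists (X \<times> UNIV)" "v \<in> lists (X \<times> UNIV)"
    by (auto simp only: carrier_free_group)
  then show "a \<otimes>\<^bsub>?F\<^esub> b \<in> carrier ?F"
    using append_in_listsI[OF m] by (simp add: mult_free_group carrier_free_group)
next
  let ?F = "free_group X"
  show "\<one>\<^bsub>?F\<^esub> \<in> carrier ?F" by (simp add: one_free_group carrier_free_group)
  fix a assume "a \<in> carrier ?F"
  then obtain u where u: "a = word_class X u" "u \<in> lists (X \<times> UNIV)"
    by (auto simp only: carrier_free_group)
  then show "\<one>\<^bsub>?F\<^esub> \<otimes>\<^bsub>?F\<^esub> a = a"
    using mult_free_group[of "[]" X u] by (simp add: one_free_group)
  have "word_class X (inverse_word u) \<otimes>\<^bsub>?F\<^esub> a = \<one>\<^bsub>?F\<^esub>"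
    using u inverse_word_cancel[of u] inverse_word_lists[OF u(2)] word_class_eq_iff[of
        "inverse_word u @ u" X "[]"]
    by (simp add: mult_free_group one_free_group)
  then show "\<exists>y \<in> carrier ?F. y \<otimes>\<^bsub>?F\<^esub> a = \<one>\<^bsub>?F\<^esub>"
    using inverse_word_lists[OF u(2)] by (auto simp only: carrier_free_group)
qed

lemma free_group_gen_closed: "x \<in> X \<Longrightarrow> free_group_gen X x \<in> carrier (free_group X)"
  by (simp add: free_group_gen_def carrier_free_group)

lemma inv_free_group_gen:
  assumes "x \<in> X"
  shows "inv\<^bsub>free_group X\<^esub> free_group_gen X x = word_class X [(x, False)]"
proof (rule group.inv_equality[OF group_free_group])
  have "free_group_eq ([] @ [(x, False), (x, \<not> False)] @ []) ([] @ [])" by (rule free_group_eq.cancel)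
  then show "word_class X [(x, False)] \<otimes>\<^bsub>free_group X\<^esub> free_group_gen X x = \<one>\<^bsub>free_group X\<^esub>"
    using assms word_class_eq_iff[of "[(x, False), (x, True)]" X "[]"]
    by (simp add: free_group_gen_def mult_free_group one_free_group)
  show "free_group_gen X x \<in> carrier (free_group X)" using assms by (rule free_group_gen_closed)
  show "word_class X [(x, False)] \<in> carrier (free_group X)" using assms by (simp add: carrier_free_group)
qed

lemma free_group_induct [consumes 1, case_names one gen inv]:
  assumes a: "a \<in> carrier (free_group X)" and one: "P \<one>\<^bsub>free_group X\<^esub>"
    and gen: "\<And>x a. x \<in> X \<Longrightarrow> a \<in> carrier (free_group X) \<Longrightarrow> P a \<Longrightarrow> P (free_group_gen X x \<otimes>\<^bsub>free_group X\<^esub> a)"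
    and inv: "\<And>x a. x \<in> X \<Longrightarrow> a \<in> carrier (free_group X) \<Longrightarrow> P a \<Longrightarrow> P (inv\<^bsub>free_group X\<^esub> free_group_gen X x
        \<otimes>\<^bsub>free_group X\<^esub> a)"
  shows "P a"
proof -
  have "P (word_class X u)" if "u \<in> lists (X \<times> UNIV)" for u
    using that
  proof (induction u)
    case Nil
    then show ?case using one by (simp add: one_free_group)
  next
    case (Cons l u)
    obtain x e where l: "l = (x, e)" by fastforce
    from Cons have x: "x \<in> X" and u: "u \<in> lists (X \<times> UNIV)" "word_class X u \<in> carrier (free_group X)"
      by (auto simp: l carrier_free_group)
    have "P (word_class X [l] \<otimes>\<^bsub>free_group X\<^esub> word_class X u)"
      using gen[OF x u(2) Cons.IH] inv[OF x u(2) Cons.IH]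
      unfolding inv_free_group_gen[OF x] l by (cases e) (simp_all add: free_group_gen_def)
    moreover have "[l] \<in> lists (X \<times> UNIV)" using x by (simp add: l)
    ultimately show ?case using mult_free_group[of "[l]" X u] u by simp
  qed
  then show ?thesis using a by (auto simp only: carrier_free_group)
qed

text \<open>
  Two words over \<open>X\<close> may be equivalent through words with letters outside \<open>X\<close>, so the letters are
  evaluated by a total function into the group.
\<close>

fun word_eval :: "('b, 'c) monoid_scheme \<Rightarrow> ('a \<Rightarrow> 'b) \<Rightarrow> ('a \<times> bool) list \<Rightarrow> 'b" where
  "word_eval H f [] = \<one>\<^bsub>H\<^esub>"
| "word_eval H f ((x, e) # u) = (if e then f x else inv\<^bsub>H\<^esub> f x) \<otimes>\<^bsub>H\<^esub> word_eval H f u"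

definition free_group_lift :: "('b, 'c) monoid_scheme \<Rightarrow> ('a \<Rightarrow> 'b) \<Rightarrow> ('a \<times> bool) list set \<Rightarrow> 'b" where
  "free_group_lift H f A = word_eval H f (SOME u. u \<in> A)"

context
  fixes H :: "('b, 'c) monoid_scheme" and f :: "'a \<Rightarrow> 'b"
  assumes H: "group H" and f: "range f \<subseteq> carrier H"
begin

interpretation H: group H by (rule H)

lemma word_eval_closed: "word_eval H f u \<in> carrier H"
proof (induction u)
  case (Cons l u)
  moreover have "f x \<in> carrier H" for x using f by blast
  ultimately show ?case by (cases l) auto
qed simp

lemma word_eval_append: "word_eval H f (u @ v) = word_eval H f u \<otimes>\<^bsub>H\<^esub> word_eval H f v"
proof (induction u)
  case Nil
  then show ?case using word_eval_closed by simp
next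
  case (Cons l u)
  moreover have "f x \<in> carrier H" for x using f by blast
  ultimately show ?case by (cases l) (auto simp: H.m_assoc word_eval_closed)
qed

lemma word_eval_eq: "free_group_eq u v \<Longrightarrow> word_eval H f u = word_eval H f v"
proof (induction rule: free_group_eq.induct)
  case (cancel u x e v)
  have "f x \<in> carrier H" using f by blast
  then have "word_eval H f [(x, e), (x, \<not> e)] = \<one>\<^bsub>H\<^esub>" by (cases e) simp_all
  moreover have "word_eval H f (u @ [(x, e), (x, \<not> e)] @ v)
    = word_eval H f u \<otimes>\<^bsub>H\<^esub> (word_eval H f [(x, e), (x, \<not> e)] \<otimes>\<^bsub>H\<^esub> word_eval H f v)"
    by (simp only: word_eval_append)
  ultimately show ?case using word_eval_closed by (simp add: word_eval_append)
qed auto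

lemma free_group_lift_word:
  assumes "u \<in> lists (X \<times> UNIV)"
  shows "free_group_lift H f (word_class X u) = word_eval H f u"
proof -
  have "u \<in> word_class X u" using assms by (auto simp: free_group_rel_def intro: free_group_eq.refl)
  then have "(SOME v. v \<in> word_class X u) \<in> word_class X u" by (rule someI)
  then have "free_group_eq u (SOME v. v \<in> word_class X u)" unfolding free_group_rel_def by blast
  then show ?thesis unfolding free_group_lift_def by (rule word_eval_eq[symmetric])
qed

lemma free_group_lift_hom: "free_group_lift H f \<in> hom (free_group X) H"
proof (rule homI)
  fix a assume "a \<in> carrier (free_group X)"
  then obtain u where "a = word_class X u" "u \<in> lists (X \<times> UNIV)" by (auto simp only: carrier_free_group)
  then show "free_group_lift H f a \<in> carrier H"
    using free_group_lift_word word_eval_closed by metis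
next
  fix a b assume "a \<in> carrier (free_group X)" "b \<in> carrier (free_group X)"
  then obtain u v where *: "a = word_class X u" "b = word_class X v"
    and m: "u \<in> lists (X \<times> UNIV)" "v \<in> lists (X \<times> UNIV)"
    by (auto simp only: carrier_free_group)
  show "free_group_lift H f (a \<otimes>\<^bsub>free_group X\<^esub> b) = free_group_lift H f a \<otimes>\<^bsub>H\<^esub> free_group_lift H f b"
    unfolding * mult_free_group[OF m] free_group_lift_word[OF m(1)] free_group_lift_word[OF m(2)]
      free_group_lift_word[OF append_in_listsI[OF m]] by (rule word_eval_append)
qed

lemma free_group_lift_gen:
  assumes "x \<in> X"
  shows "free_group_lift H f (free_group_gen X x) = f x"
proof -
  have "f x \<in> carrier H" using f by blast
  then show ?thesis
    unfolding free_group_gen_def using assms by (subst free_group_lift_word) simp_all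
qed

end

lemma free_group_hom_unique:
  assumes H: "group H" and \<phi>: "\<phi> \<in> hom (free_group X) H" and \<psi>: "\<psi> \<in> hom (free_group X) H"
    and gen: "\<And>x. x \<in> X \<Longrightarrow> \<phi> (free_group_gen X x) = \<psi> (free_group_gen X x)"
    and a: "a \<in> carrier (free_group X)"
  shows "\<phi> a = \<psi> a"
proof -
  interpret F: group "free_group X" by (rule group_free_group)
  interpret H: group H by fact
  interpret \<phi>: group_hom "free_group X" H \<phi> using \<phi> by unfold_locales
  interpret \<psi>: group_hom "free_group X" H \<psi> using \<psi> by unfold_locales
  show ?thesis
    using a
  proof (induction a rule: free_group_induct)
    case one
    then show ?case using \<phi>.hom_one \<psi>.hom_one by simp
  next
    case (gen x a)
    then show ?case using assms(4)[OF gen(1)] free_group_gen_closed[OF gen(1)] by simp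
  next
    case (inv x a)
    then show ?case using assms(4)[OF inv(1)] free_group_gen_closed[OF inv(1)] by simp
  qed
qed

section \<open>The McCool group\<close>

lemma group_F3: "group F3"
  unfolding F3_def by (rule group_free_group)

interpretation F3: group F3 by (rule group_F3)

interpretation Aut: group "AutoGroup F3" by (rule F3.AutoGroup)

definition index :: "nat set" where "index = {1, 2, 3}"

lemma F3_gen_closed: "i \<in> index \<Longrightarrow> F3_gen i \<in> carrier F3"
  unfolding F3_gen_def F3_def index_def by (rule free_group_gen_closed)

lemma Aut_carrier: "\<phi> \<in> carrier (AutoGroup F3) \<longleftrightarrow> \<phi> \<in> hom F3 F3 \<and> \<phi> \<in> extensional (carrier F3)
    \<and> bij_betw \<phi> (carrier F3) (carrier F3)"
  by (auto simp: AutoGroup_def auto_def Bij_def)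

lemma Aut_closed: "\<phi> \<in> carrier (AutoGroup F3) \<Longrightarrow> w \<in> carrier F3 \<Longrightarrow> \<phi> w \<in> carrier F3"
  by (auto simp: Aut_carrier hom_def)

lemma Aut_hom: "\<phi> \<in> carrier (AutoGroup F3) \<Longrightarrow> group_hom F3 F3 \<phi>"
  by (simp add: Aut_carrier group_hom_def group_hom_axioms_def group_F3)

lemma Aut_mult:
  assumes "\<phi> \<in> carrier (AutoGroup F3)" "\<psi> \<in> carrier (AutoGroup F3)" "w \<in> carrier F3"
  shows "(\<phi> \<otimes>\<^bsub>AutoGroup F3\<^esub> \<psi>) w = \<phi> (\<psi> w)"
proof -
  have "\<phi> \<in> Bij (carrier F3)" "\<psi> \<in> Bij (carrier F3)" using assms by (auto simp: AutoGroup_def auto_def)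
  then show ?thesis using assms(3) by (simp add: AutoGroup_def BijGroup_def compose_def)
qed

lemma Aut_one: "w \<in> carrier F3 \<Longrightarrow> \<one>\<^bsub>AutoGroup F3\<^esub> w = w"
  by (simp add: AutoGroup_def BijGroup_def)

lemma F3_hom_unique:
  assumes "group H" "\<phi> \<in> hom F3 H" "\<psi> \<in> hom F3 H" "\<And>i. i \<in> index \<Longrightarrow> \<phi> (F3_gen i) = \<psi> (F3_gen i)" "w \<in> carrier F3"
  shows "\<phi> w = \<psi> w"
  using free_group_hom_unique[of H \<phi> index \<psi> w] assms by (simp add: F3_def F3_gen_def index_def)

lemma Aut_eqI:
  assumes "\<phi> \<in> carrier (AutoGroup F3)" "\<psi> \<in> carrier (AutoGroup F3)"
      "\<And>i. i \<in> index \<Longrightarrow> \<phi> (F3_gen i) = \<psi> (F3_gen i)"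
  shows "\<phi> = \<psi>"
proof (rule extensionalityI)
  show "\<phi> \<in> extensional (carrier F3)" "\<psi> \<in> extensional (carrier F3)" using assms(1,2)
      by (auto simp: Aut_carrier)
  show "\<phi> w = \<psi> w" if "w \<in> carrier F3" for w
    by (rule F3_hom_unique[OF group_F3]) (use assms that in \<open>auto simp: Aut_carrier\<close>)
qed

definition F3_endo :: "(nat \<Rightarrow> (nat \<times> bool) list set) \<Rightarrow> (nat \<times> bool) list set \<Rightarrow> (nat \<times> bool) list set" where
  "F3_endo f = restrict (free_group_lift F3 f) (carrier F3)"

lemma
  assumes "range f \<subseteq> carrier F3"
  shows F3_endo_hom: "F3_endo f \<in> hom F3 F3" and F3_endo_gen: "i \<in> index \<Longrightarrow> F3_endo f (F3_gen i) = f i"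
proof -
  have "free_group_lift F3 f \<in> hom F3 F3"
    using free_group_lift_hom[OF group_F3 assms, of index] by (simp add: F3_def index_def)
  then show "F3_endo f \<in> hom F3 F3" unfolding F3_endo_def by (auto simp: hom_def Pi_iff)
  show "F3_endo f (F3_gen i) = f i" if "i \<in> index"
    using free_group_lift_gen[OF group_F3 assms that] F3_gen_closed[OF that]
        by (simp add: F3_endo_def F3_gen_def index_def)
qed

text \<open>
  Both composites are endomorphisms, and these are determined by their values on the generators.
\<close>

lemma F3_endo_auto:
  assumes f: "range f \<subseteq> carrier F3" and g: "range g \<subseteq> carrier F3"
    and fg: "\<And>i. i \<in> index \<Longrightarrow> F3_endo f (g i) = F3_gen i" and gf: "\<And>i. i \<in> index \<Longrightarrow> F3_endo g (f i) = F3_gen i"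
  shows "F3_endo f \<in> carrier (AutoGroup F3)"
proof -
  have id: "(\<lambda>x. x) \<in> hom F3 F3" by (simp add: hom_def)
  have fg': "F3_endo f (F3_endo g w) = w" if "w \<in> carrier F3" for w
  proof -
    have "(\<lambda>w. F3_endo f (F3_endo g w)) \<in> hom F3 F3"
      using F3_endo_hom[OF f] F3_endo_hom[OF g] by (auto simp: hom_def Pi_iff)
    from F3_hom_unique[OF group_F3 this id _ that] show ?thesis using fg F3_endo_gen[OF g] by simp
  qed
  have gf': "F3_endo g (F3_endo f w) = w" if "w \<in> carrier F3" for w
  proof -
    have "(\<lambda>w. F3_endo g (F3_endo f w)) \<in> hom F3 F3"
      using F3_endo_hom[OF f] F3_endo_hom[OF g] by (auto simp: hom_def Pi_iff)
    from F3_hom_unique[OF group_F3 this id _ that] show ?thesis using gf F3_endo_gen[OF f] by simp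
  qed
  have "bij_betw (F3_endo f) (carrier F3) (carrier F3)"
    by (rule bij_betw_byWitness[of _ "F3_endo g"])
       (use fg' gf' F3_endo_hom[OF f] F3_endo_hom[OF g] in \<open>auto simp: hom_def\<close>)
  then show ?thesis using F3_endo_hom[OF f] by (simp add: Aut_carrier) (simp add: F3_endo_def)
qed

lemma
  assumes ij: "i \<in> index" "j \<in> index" "i \<noteq> j"
  shows chi_auto: "chi i j \<in> carrier (AutoGroup F3)"
    and chi_moved: "chi i j (F3_gen i) = inv\<^bsub>F3\<^esub> F3_gen j \<otimes>\<^bsub>F3\<^esub> F3_gen i \<otimes>\<^bsub>F3\<^esub> F3_gen j"
    and chi_fixed: "k \<in> index \<Longrightarrow> k \<noteq> i \<Longrightarrow> chi i j (F3_gen k) = F3_gen k"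
proof -
  note g = F3_gen_closed
  define f where "f k = (if k = i then inv\<^bsub>F3\<^esub> F3_gen j \<otimes>\<^bsub>F3\<^esub> F3_gen i \<otimes>\<^bsub>F3\<^esub> F3_gen j
    else if k \<in> index then F3_gen k else \<one>\<^bsub>F3\<^esub>)" for k
  define f' where "f' k = (if k = i then F3_gen j \<otimes>\<^bsub>F3\<^esub> F3_gen i \<otimes>\<^bsub>F3\<^esub> inv\<^bsub>F3\<^esub> F3_gen j
    else if k \<in> index then F3_gen k else \<one>\<^bsub>F3\<^esub>)" for k
  have f: "range f \<subseteq> carrier F3" and f': "range f' \<subseteq> carrier F3"
    using g ij by (auto simp: f_def f'_def)
  interpret E: group_hom F3 F3 "F3_endo f" using F3_endo_hom[OF f] by unfold_locales
  interpret E': group_hom F3 F3 "F3_endo f'" using F3_endo_hom[OF f'] by unfold_locales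
  have gen: "F3_endo f (F3_gen k) = f k" "F3_endo f' (F3_gen k) = f' k" if "k \<in> index" for k
    using F3_endo_gen[OF f that] F3_endo_gen[OF f' that] by auto
  have fj: "f j = F3_gen j" "f' j = F3_gen j" "f i = inv\<^bsub>F3\<^esub> F3_gen j \<otimes>\<^bsub>F3\<^esub> F3_gen i \<otimes>\<^bsub>F3\<^esub> F3_gen j"
    "f' i = F3_gen j \<otimes>\<^bsub>F3\<^esub> F3_gen i \<otimes>\<^bsub>F3\<^esub> inv\<^bsub>F3\<^esub> F3_gen j"
    using ij unfolding f_def f'_def by auto
  have fk: "f k = F3_gen k" "f' k = F3_gen k" if "k \<in> index" "k \<noteq> i" for k
    using that unfolding f_def f'_def by auto
  have a: "F3_endo f \<in> carrier (AutoGroup F3)"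
  proof (rule F3_endo_auto[OF f f'])
    fix k assume k: "k \<in> index"
    show "F3_endo f (f' k) = F3_gen k"
      using g[OF ij(1)] g[OF ij(2)] gen[OF ij(1)] gen[OF ij(2)] gen[OF k] fj fk[OF k]
      by (cases "k = i") (simp_all add: F3.m_assoc)
    show "F3_endo f' (f k) = F3_gen k"
      using g[OF ij(1)] g[OF ij(2)] gen[OF ij(1)] gen[OF ij(2)] gen[OF k] fj fk[OF k]
      by (cases "k = i") (simp_all add: F3.m_assoc)
  qed
  have comm: "F3_gen i \<otimes>\<^bsub>F3\<^esub> commutator F3 (F3_gen i) (F3_gen j) = inv\<^bsub>F3\<^esub> F3_gen j \<otimes>\<^bsub>F3\<^esub> F3_gen i
      \<otimes>\<^bsub>F3\<^esub> F3_gen j"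
    using g ij by (simp add: F3.conj_eq_commutator)
  have "chi i j = F3_endo f"
    unfolding chi_def comm index_def[symmetric]
  proof (rule the_equality)
    show "F3_endo f \<in> carrier (AutoGroup F3) \<and> F3_endo f (F3_gen i) = inv\<^bsub>F3\<^esub> F3_gen j \<otimes>\<^bsub>F3\<^esub> F3_gen i
        \<otimes>\<^bsub>F3\<^esub> F3_gen j \<and>
      (\<forall>k \<in> index - {i}. F3_endo f (F3_gen k) = F3_gen k)"
      using a gen fj fk ij by simp
    fix \<phi> assume \<phi>: "\<phi> \<in> carrier (AutoGroup F3) \<and> \<phi> (F3_gen i) = inv\<^bsub>F3\<^esub> F3_gen j \<otimes>\<^bsub>F3\<^esub> F3_gen i
        \<otimes>\<^bsub>F3\<^esub> F3_gen j \<and>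
      (\<forall>k \<in> index - {i}. \<phi> (F3_gen k) = F3_gen k)"
    show "\<phi> = F3_endo f"
    proof (rule Aut_eqI)
      fix k assume "k \<in> index"
      then show "\<phi> (F3_gen k) = F3_endo f (F3_gen k)"
        using \<phi> gen[of k] fj fk[of k] by (cases "k = i") auto
    qed (use \<phi> a in auto)
  qed
  with a gen fj fk ij show "chi i j \<in> carrier (AutoGroup F3)"
    "chi i j (F3_gen i) = inv\<^bsub>F3\<^esub> F3_gen j \<otimes>\<^bsub>F3\<^esub> F3_gen i \<otimes>\<^bsub>F3\<^esub> F3_gen j"
    "k \<in> index \<Longrightarrow> k \<noteq> i \<Longrightarrow> chi i j (F3_gen k) = F3_gen k"
    by auto
qed

definition chi_set where "chi_set = {chi i j | i j. i \<in> index \<and> j \<in> index \<and> i \<noteq> j}"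

lemma chi_set_auto: "chi_set \<subseteq> carrier (AutoGroup F3)"
  unfolding chi_set_def using chi_auto by blast

lemma McCool3_eq: "McCool3 = (AutoGroup F3)\<lparr>carrier := generate (AutoGroup F3) chi_set\<rparr>"
proof -
  have "McCool3 = subgroup_generated (AutoGroup F3) chi_set"
    unfolding McCool3_def chi_set_def index_def ..
  then show ?thesis using chi_set_auto by (simp add: subgroup_generated_def Int_absorb1)
qed

lemma carrier_McCool3: "carrier McCool3 = generate (AutoGroup F3) chi_set"
  by (simp add: McCool3_eq)

lemma McCool3_subset: "carrier McCool3 \<subseteq> carrier (AutoGroup F3)"
  unfolding carrier_McCool3 using Aut.generate_in_carrier[OF chi_set_auto] by blast

lemma group_McCool3: "group McCool3"
  unfolding McCool3_def by (rule Aut.group_subgroup_generated)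

interpretation M3: group McCool3 by (rule group_McCool3)

lemma mult_McCool3 [simp]: "\<phi> \<otimes>\<^bsub>McCool3\<^esub> \<psi> = \<phi> \<otimes>\<^bsub>AutoGroup F3\<^esub> \<psi>"
  by (simp add: McCool3_eq)

lemma one_McCool3 [simp]: "\<one>\<^bsub>McCool3\<^esub> = \<one>\<^bsub>AutoGroup F3\<^esub>"
  by (simp add: McCool3_eq)

lemma inv_McCool3: "\<phi> \<in> carrier McCool3 \<Longrightarrow> inv\<^bsub>McCool3\<^esub> \<phi> = inv\<^bsub>AutoGroup F3\<^esub> \<phi>"
  unfolding McCool3_def by (rule Aut.inv_subgroup_generated)

lemma McCool3_generated: "carrier McCool3 = generate McCool3 chi_set" "chi_set \<subseteq> carrier McCool3"
proof -
  show "chi_set \<subseteq> carrier McCool3" unfolding carrier_McCool3 by (auto intro: generate.incl)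
  then have "generate McCool3 chi_set = generate (AutoGroup F3) chi_set"
    unfolding McCool3_eq
    using Aut.generate_consistent[OF _ Aut.generate_is_subgroup[OF chi_set_auto]] by (simp add: McCool3_eq)
  then show "carrier McCool3 = generate McCool3 chi_set" by (simp add: carrier_McCool3)
qed

lemma chi_McCool3: "i \<in> index \<Longrightarrow> j \<in> index \<Longrightarrow> i \<noteq> j \<Longrightarrow> chi i j \<in> carrier McCool3"
  using McCool3_generated(2) unfolding chi_set_def by blast

section \<open>The outer action and ping-pong\<close>

text \<open>
  A syllable $(j, n)$ stands for the $n$-th power of the $j$-th free generator of the outer classes.  The
  head of the list is the syllable that was multiplied last.
\<close>

fun reduced :: "(nat \<times> int) list \<Rightarrow> bool" where
  "reduced [] = True"
| "reduced ((j, n) # w) = (j \<in> index \<and> n \<noteq> 0 \<and> reduced w \<and> (case w of [] \<Rightarrow> True | (i, _) # _ \<Rightarrow> i \<noteq> j))"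

text \<open>
  The effect of the $n$-th power of the $j$-th outer generator on the areas spanned by three vectors in the
  plane, see \<open>areas_step\<close>.  The factor 3 is large enough for ping-pong.
\<close>

definition area_move :: "nat \<Rightarrow> int \<Rightarrow> int \<times> int \<times> int \<Rightarrow> int \<times> int \<times> int" where
  "area_move j n = (\<lambda>(a, b, c). if j = 1 then (a, b + 3 * n * a * c, c)
     else if j = 2 then (a, b, c - 3 * n * a * b) else (a - 3 * n * b * c, b, c))"

lemma area_move_add: "area_move j m (area_move j n t) = area_move j (m + n) t"
  by (cases t) (auto simp: area_move_def algebra_simps)

lemma area_move_zero: "area_move j 0 t = t"
  by (cases t) (auto simp: area_move_def)

fun word_area :: "(nat \<times> int) list \<Rightarrow> int \<times> int \<times> int" where
  "word_area [] = (1, 1, 1)"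
| "word_area ((j, n) # w) = area_move j n (word_area w)"

text \<open>
  The $j$-th generator changes only the area of the two vectors other than the $j$-th.  After it was
      applied last,
  this area is strictly the largest.
\<close>

definition dominant :: "nat \<Rightarrow> int \<times> int \<times> int \<Rightarrow> bool" where
  "dominant j = (\<lambda>(a, b, c). \<bar>a\<bar> \<ge> 1 \<and> \<bar>b\<bar> \<ge> 1 \<and> \<bar>c\<bar> \<ge> 1 \<and>
     (if j = 1 then \<bar>b\<bar> > \<bar>a\<bar> \<and> \<bar>b\<bar> > \<bar>c\<bar> else if j = 2 then \<bar>c\<bar> > \<bar>a\<bar> \<and> \<bar>c\<bar> > \<bar>b\<bar>
      else \<bar>a\<bar> > \<bar>b\<bar> \<and> \<bar>a\<bar> > \<bar>c\<bar>))"

text \<open>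
  The new area $r + s$ has $|s| \ge 3|pq| \ge 3\max(|p|, |q|)$, while $|r|$ is at most the maximum, as
  another area was the largest before.
\<close>

lemma ping_pong_step:
  fixes p q r n s :: int
  assumes "\<bar>p\<bar> \<ge> 1" "\<bar>q\<bar> \<ge> 1" "n \<noteq> 0" "\<bar>r\<bar> \<le> max \<bar>p\<bar> \<bar>q\<bar>" "s = 3 * n * p * q \<or> s = - (3 * n * p * q)"
  shows "\<bar>r + s\<bar> > \<bar>p\<bar> \<and> \<bar>r + s\<bar> > \<bar>q\<bar>"
proof -
  have pq: "\<bar>p * q\<bar> \<ge> max \<bar>p\<bar> \<bar>q\<bar>"
    using assms(1,2) mult_left_mono[of 1 "\<bar>q\<bar>" "\<bar>p\<bar>"] mult_right_mono[of 1 "\<bar>p\<bar>" "\<bar>q\<bar>"] by (simp add: abs_mult)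
  have "\<bar>n\<bar> * \<bar>p * q\<bar> \<ge> 1 * \<bar>p * q\<bar>" using assms(3) by (intro mult_right_mono) auto
  then have "\<bar>s\<bar> \<ge> 3 * \<bar>p * q\<bar>" using assms(5) by (auto simp: abs_mult)
  then show ?thesis using pq assms(1,2,4) by linarith
qed

lemma reduced_dominant:
  assumes "reduced ((j, n) # w)"
  shows "dominant j (word_area ((j, n) # w))"
  using assms
proof (induction w arbitrary: j n)
  case Nil
  then have j: "j = 1 \<or> j = 2 \<or> j = 3" and n: "n \<noteq> 0" by (auto simp: index_def)
  then show ?case
    using ping_pong_step[of 1 1 n 1 "3 * n"] ping_pong_step[of 1 1 n 1 "- (3 * n)"]
    by (auto simp: area_move_def dominant_def)
next
  case (Cons l w)
  obtain i m where l: "l = (i, m)" by fastforce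
  from Cons have ij: "i \<noteq> j" "n \<noteq> 0" "j = 1 \<or> j = 2 \<or> j = 3" "i = 1 \<or> i = 2 \<or> i = 3"
    and dom: "dominant i (word_area ((i, m) # w))" by (auto simp: l index_def)
  obtain a b c where t: "word_area ((i, m) # w) = (a, b, c)" by (metis prod_cases3)
  have d: "dominant i (a, b, c)" using dom t by simp
  have pos: "\<bar>a\<bar> \<ge> 1" "\<bar>b\<bar> \<ge> 1" "\<bar>c\<bar> \<ge> 1" using d by (auto simp: dominant_def)
  have "dominant j (area_move j n (a, b, c))"
    using ij(3)
  proof (elim disjE)
    assume j: "j = 1"
    have "\<bar>b\<bar> \<le> max \<bar>a\<bar> \<bar>c\<bar>" using d ij j by (auto simp: dominant_def)
    then show ?thesis using ping_pong_step[of a c n b "3 * n * a * c"] pos ij(2)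
        by (simp add: j area_move_def dominant_def)
  next
    assume j: "j = 2"
    have "\<bar>c\<bar> \<le> max \<bar>a\<bar> \<bar>b\<bar>" using d ij j by (auto simp: dominant_def)
    then show ?thesis using ping_pong_step[of a b n c "- (3 * n * a * b)"] pos ij(2)
        by (simp add: j area_move_def dominant_def)
  next
    assume j: "j = 3"
    have "\<bar>a\<bar> \<le> max \<bar>b\<bar> \<bar>c\<bar>" using d ij j by (auto simp: dominant_def)
    then show ?thesis using ping_pong_step[of b c n a "- (3 * n * b * c)"] pos ij(2)
        by (simp add: j area_move_def dominant_def)
  qed
  then show ?case using t l by simp
qed

text \<open>
  The symplectic form of the plane.
\<close>

definition area :: "int \<times> int \<Rightarrow> int \<times> int \<Rightarrow> int" where
  "area v w = fst v * snd w - snd v * fst w"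

text \<open>
  The $n$-th power of the transvection along $v$, with the factor 3 built in.  A conjugate of a
      transvection is the transvection
  along the moved vector.
\<close>

definition transvection :: "int \<times> int \<Rightarrow> int \<Rightarrow> int \<times> int \<Rightarrow> int \<times> int" where
  "transvection v n w = (fst w + 3 * n * area v w * fst v, snd w + 3 * n * area v w * snd v)"

lemma transvection_add: "transvection v m (transvection v n w) = transvection v (m + n) w"
  by (simp add: transvection_def area_def algebra_simps)

lemma transvection_zero [simp]: "transvection v 0 w = w"
  by (simp add: transvection_def)

lemma transvection_conj:
  "transvection (transvection u m v) n w = transvection u m (transvection v n (transvection u (- m) w))"
  by (simp add: transvection_def area_def prod_eq_iff) algebra

definition plane_group where "plane_group = BijGroup (UNIV :: (int \<times> int) set)"

lemma group_plane_group: "group plane_group"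
  unfolding plane_group_def by (rule group_BijGroup)

lemma plane_group_carrier: "carrier plane_group = {f. bij f}"
  by (auto simp: plane_group_def BijGroup_def Bij_def)

lemma plane_group_mult: "bij f \<Longrightarrow> bij g \<Longrightarrow> f \<otimes>\<^bsub>plane_group\<^esub> g = f \<circ> g"
  by (auto simp: plane_group_def BijGroup_def Bij_def compose_def fun_eq_iff)

lemma plane_group_one: "\<one>\<^bsub>plane_group\<^esub> = id"
  by (auto simp: plane_group_def BijGroup_def)

lemma bij_transvection: "bij (transvection v n)"
  by (rule bijI'[of "transvection v n"]) 
     (metis transvection_add transvection_zero add.left_inverse, metis transvection_add transvection_zero
         add.right_inverse)

lemma plane_group_inv: "inv\<^bsub>plane_group\<^esub> transvection v n = transvection v (- n)"
  by (rule group.inv_equality[OF group_plane_group])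
     (auto simp: plane_group_carrier plane_group_mult plane_group_one bij_transvection transvection_add)

text \<open>
  Three vectors of which any two span area 1 or $-1$.
\<close>

definition base_vector :: "nat \<Rightarrow> int \<times> int" where
  "base_vector i = (if i = 1 then (1, 0) else if i = 2 then (0, 1) else (-1, -1))"

definition plane_rep where
  "plane_rep = free_group_lift plane_group (\<lambda>i. transvection (base_vector i) 1)"

lemma plane_rep_hom: "plane_rep \<in> hom F3 plane_group"
  and plane_rep_gen: "i \<in> index \<Longrightarrow> plane_rep (F3_gen i) = transvection (base_vector i) 1"
proof -
  have r: "range (\<lambda>i. transvection (base_vector i) 1) \<subseteq> carrier plane_group"
    by (auto simp: plane_group_carrier bij_transvection)
  show "plane_rep \<in> hom F3 plane_group"
    unfolding plane_rep_def F3_def by (rule free_group_lift_hom[OF group_plane_group r])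
  show "i \<in> index \<Longrightarrow> plane_rep (F3_gen i) = transvection (base_vector i) 1"
    unfolding plane_rep_def F3_gen_def index_def by (rule free_group_lift_gen[OF group_plane_group r])
qed

text \<open>
  The representation of $F$ by transvections, twisted by $\phi$, sends $g_i$ to the transvection along $v_i$.
  The vectors are determined only up to sign, so this is a relation.
\<close>

definition axes :: "((nat \<times> bool) list set \<Rightarrow> (nat \<times> bool) list set) \<Rightarrow> (nat \<Rightarrow> int \<times> int) \<Rightarrow> bool" where
  "axes \<phi> v \<longleftrightarrow> (\<forall>i \<in> index. plane_rep (\<phi> (F3_gen i)) = transvection (v i) 1)"

definition areas :: "(nat \<Rightarrow> int \<times> int) \<Rightarrow> int \<times> int \<times> int" where
  "areas v = (area (v 1) (v 2), area (v 2) (v 3), area (v 3) (v 1))"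

text \<open>
  A transvection determines the products of the coordinates of its vector, and the square of the area of two
  vectors is a polynomial in these products.
\<close>

lemma axes_one_area:
  assumes "axes \<one>\<^bsub>AutoGroup F3\<^esub> v" "i \<in> index" "j \<in> index"
  shows "area (v i) (v j) * area (v i) (v j) = area (base_vector i) (base_vector j) * area (base_vector i)
      (base_vector j)"
proof -
  have tr: "transvection (v k) 1 = transvection (base_vector k) 1" if k: "k \<in> index" for k
  proof -
    have "plane_rep (\<one>\<^bsub>AutoGroup F3\<^esub> (F3_gen k)) = transvection (v k) 1"
      using assms(1) k unfolding axes_def by blast
    then show ?thesis using plane_rep_gen[OF k] Aut_one[OF F3_gen_closed[OF k]] by metis
  qed
  have e: "fst (v k) * fst (v k) = fst (base_vector k) * fst (base_vector k)"
    "snd (v k) * snd (v k) = snd (base_vector k) * snd (base_vector k)"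
    "fst (v k) * snd (v k) = fst (base_vector k) * snd (base_vector k)" if "k \<in> index" for k
    using fun_cong[OF tr[OF that], of "(0, 1)"] fun_cong[OF tr[OF that], of "(1, 0)"]
    by (auto simp: transvection_def area_def mult.commute)
  have sq: "area u w * area u w = (fst u * fst u) * (snd w * snd w) - 2 * (fst u * snd u) * (fst w * snd w)
    + (snd u * snd u) * (fst w * fst w)" for u w
    unfolding area_def by algebra
  show ?thesis unfolding sq by (simp only: e[OF assms(2)] e[OF assms(3)])
qed

lemma axes_one_areas:
  assumes "axes \<one>\<^bsub>AutoGroup F3\<^esub> v" "areas v = (a, b, c)"
  shows "\<bar>a\<bar> = 1" "\<bar>b\<bar> = 1" "\<bar>c\<bar> = 1"
proof -
  have "a * a = 1" "b * b = 1" "c * c = 1"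
    using axes_one_area[OF assms(1), of 1 2] axes_one_area[OF assms(1), of 2 3] axes_one_area[OF assms(1),
        of 3 1] assms(2)
    by (auto simp: index_def areas_def base_vector_def area_def)
  then show "\<bar>a\<bar> = 1" "\<bar>b\<bar> = 1" "\<bar>c\<bar> = 1"
    using abs_square_eq_1[of a] abs_square_eq_1[of b] abs_square_eq_1[of c] by (simp_all add: power2_eq_square)
qed

lemma axes_base: "axes \<one>\<^bsub>AutoGroup F3\<^esub> base_vector" "areas base_vector = (1, 1, 1)"
  using plane_rep_gen Aut_one F3_gen_closed by (auto simp: axes_def areas_def area_def base_vector_def)

text \<open>
  Composition on the right with $\chi_{ij}$ or its inverse conjugates the image of $g_i$ by that of
  $g_j$.
\<close>

lemma axes_step:
  assumes \<psi>: "\<psi> \<in> carrier (AutoGroup F3)" and \<chi>: "\<chi> \<in> carrier (AutoGroup F3)" and v: "axes \<psi> v" and ij: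
      "i \<in> index" "j \<in> index"
    and fixed: "\<And>k. k \<in> index \<Longrightarrow> k \<noteq> i \<Longrightarrow> \<chi> (F3_gen k) = F3_gen k"
    and moved: "n = 1 \<and> \<chi> (F3_gen i) = F3_gen j \<otimes>\<^bsub>F3\<^esub> F3_gen i \<otimes>\<^bsub>F3\<^esub> inv\<^bsub>F3\<^esub> F3_gen j \<or>
      n = -1 \<and> \<chi> (F3_gen i) = inv\<^bsub>F3\<^esub> F3_gen j \<otimes>\<^bsub>F3\<^esub> F3_gen i \<otimes>\<^bsub>F3\<^esub> F3_gen j"
  shows "axes (\<psi> \<otimes>\<^bsub>AutoGroup F3\<^esub> \<chi>) (v(i := transvection (v j) n (v i)))"
  unfolding axes_def
proof
  fix k assume k: "k \<in> index"
  interpret \<psi>: group_hom F3 F3 \<psi> by (rule Aut_hom[OF \<psi>])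
  interpret P: group plane_group by (rule group_plane_group)
  interpret \<rho>: group_hom F3 plane_group plane_rep using plane_rep_hom by unfold_locales
  have act: "(\<psi> \<otimes>\<^bsub>AutoGroup F3\<^esub> \<chi>) (F3_gen k) = \<psi> (\<chi> (F3_gen k))"
    using Aut_mult[OF \<psi> \<chi> F3_gen_closed[OF k]] .
  have r: "plane_rep (\<psi> (F3_gen l)) = transvection (v l) 1" if "l \<in> index" for l
    using v that by (simp add: axes_def)
  note g = F3_gen_closed[OF ij(1)] F3_gen_closed[OF ij(2)]
  show "plane_rep ((\<psi> \<otimes>\<^bsub>AutoGroup F3\<^esub> \<chi>) (F3_gen k)) = transvection ((v(i := transvection (v j) n (v i))) k) 1"
  proof (cases "k = i")
    case False
    then show ?thesis using act fixed[OF k] r[OF k] by simp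
  next
    case True
    have "plane_rep (\<psi> (\<chi> (F3_gen i))) = transvection (v j) n \<circ> transvection (v i) 1 \<circ> transvection (v j) (- n)"
      using moved
    proof (elim disjE conjE)
      assume n: "n = 1" and m: "\<chi> (F3_gen i) = F3_gen j \<otimes>\<^bsub>F3\<^esub> F3_gen i \<otimes>\<^bsub>F3\<^esub> inv\<^bsub>F3\<^esub> F3_gen j"
      show ?thesis
        unfolding m n using g by (simp add: r ij plane_group_inv plane_group_mult bij_transvection bij_comp)
    next
      assume n: "n = -1" and m: "\<chi> (F3_gen i) = inv\<^bsub>F3\<^esub> F3_gen j \<otimes>\<^bsub>F3\<^esub> F3_gen i \<otimes>\<^bsub>F3\<^esub> F3_gen j"
      show ?thesis
        unfolding m n using g by (simp add: r ij plane_group_inv plane_group_mult bij_transvection bij_comp)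
    qed
    also have "\<dots> = transvection (transvection (v j) n (v i)) 1"
      by (rule ext) (simp add: transvection_conj)
    finally show ?thesis using act True by simp
  qed
qed

text \<open>
  Modulo inner automorphisms $\chi_{kj}$ is the inverse of $\chi_{ij}$; the sign says which of the two is
  taken as the $j$-th generator.
\<close>

definition chi_sign :: "nat \<Rightarrow> nat \<Rightarrow> int" where
  "chi_sign i j = (if (i, j) \<in> {(2, 1), (1, 2), (2, 3)} then 1 else -1)"

lemma areas_step:
  assumes "i \<in> index" "j \<in> index" "i \<noteq> j"
  shows "areas (v(i := transvection (v j) n (v i))) = area_move j (- n * chi_sign i j) (areas v)"
  using assms unfolding index_def
  by (auto simp: areas_def area_def transvection_def area_move_def chi_sign_def algebra_simps)

interpretation U: group series_units by (rule group_series_units)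

lemma indet_unit_closed: "indet_unit j \<in> carrier series_units"
  using indet_unit_inv[of j] by auto

definition indet_power :: "nat \<Rightarrow> int \<Rightarrow> series" where
  "indet_power j n = indet_unit j [^]\<^bsub>series_units\<^esub> n"

lemma indet_power_closed: "indet_power j n \<in> carrier series_units"
  unfolding indet_power_def by (rule U.int_pow_closed[OF indet_unit_closed])

lemma indet_power_add: "indet_power j m * indet_power j n = indet_power j (m + n)"
  using U.int_pow_mult[OF indet_unit_closed, of j m n] by (simp add: indet_power_def)

lemma indet_power_simps: "indet_power j 0 = 1" "indet_power j 1 = indet_unit j"
    "indet_power j (- 1) = indet_unit_inv j"
proof -
  show "indet_power j 0 = 1" by (simp add: indet_power_def)
  show "indet_power j 1 = indet_unit j" unfolding indet_power_def using U.int_pow_1[OF indet_unit_closed] .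
  have "indet_power j (- 1) = inv\<^bsub>series_units\<^esub> indet_unit j"
    unfolding indet_power_def using U.int_pow_neg[OF indet_unit_closed, of j 1] U.int_pow_1[OF
        indet_unit_closed] by simp
  also have "\<dots> = indet_unit_inv j"
    using indet_unit_inv[of j] by (intro U.inv_equality) auto
  finally show "indet_power j (- 1) = indet_unit_inv j" .
qed

fun word_unit :: "(nat \<times> int) list \<Rightarrow> series" where
  "word_unit [] = 1"
| "word_unit ((j, n) # w) = word_unit w * indet_power j n"

text \<open>
  Multiplication of a reduced word by one more syllable, with cancellation.
\<close>

lemma reduced_push:
  assumes "reduced w" "j \<in> index" "n \<noteq> 0"
  shows "\<exists>w'. reduced w' \<and> word_area w' = area_move j n (word_area w) \<and> word_unit w'
      = word_unit w * indet_power j n"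
proof (cases w)
  case Nil
  then show ?thesis using assms by (intro exI[of _ "[(j, n)]"]) simp
next
  case (Cons l w0)
  obtain i m where l: "l = (i, m)" by fastforce
  show ?thesis
  proof (cases "i = j")
    case False
    then show ?thesis using assms Cons l by (intro exI[of _ "(j, n) # w"]) simp
  next
    case True
    show ?thesis
    proof (cases "m + n = 0")
      case True
      have "n + m = 0" using True by simp
      with True \<open>i = j\<close> show ?thesis
        using assms Cons l by (intro exI[of _ w0]) (simp add: area_move_add area_move_zero mult.assoc
            indet_power_add True indet_power_simps)
    next
      case False
      with \<open>i = j\<close> show ?thesis
        using assms Cons l by (intro exI[of _ "(j, m
            + n) # w0"]) (simp add: area_move_add mult.assoc indet_power_add add.commute)
    qed
  qed
qed

text \<open>
  The automorphism $\phi$ and the unit $u$ come from the same word: $u$ is its value at the units $1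
      + X_j$, and the
  areas for $\phi$ are its value in the action on triples.
\<close>

definition normal_form :: "((nat \<times> bool) list set \<Rightarrow> (nat \<times> bool) list set) \<Rightarrow> series \<Rightarrow> bool" where
  "normal_form \<phi> u \<longleftrightarrow> (\<exists>w v. reduced w \<and> u = word_unit w \<and> axes \<phi> v \<and> areas v = word_area w)"

lemma normal_form_one: "normal_form \<one>\<^bsub>AutoGroup F3\<^esub> 1"
  unfolding normal_form_def using axes_base by (intro exI[of _ "[]"] exI[of _ base_vector]) simp

text \<open>
  For the identity all three areas are 1 or $-1$, which rules out a dominant one; so the word is
  empty.
\<close>

lemma normal_form_one_unique:
  assumes "normal_form \<one>\<^bsub>AutoGroup F3\<^esub> u"
  shows "u = 1"
proof -
  from assms obtain w v where w: "reduced w" "u = word_unit w" "axes \<one>\<^bsub>AutoGroup F3\<^esub> v" "areas v = word_area w"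
    unfolding normal_form_def by blast
  obtain a b c where abc: "word_area w = (a, b, c)" by (metis prod_cases3)
  have one: "\<bar>a\<bar> = 1" "\<bar>b\<bar> = 1" "\<bar>c\<bar> = 1" using axes_one_areas[OF w(3)] w(4) abc by auto
  show ?thesis
  proof (cases w)
    case Nil
    then show ?thesis using w by simp
  next
    case (Cons l w')
    then obtain j n where "w = (j, n) # w'" by (cases l) auto
    then have "dominant j (a, b, c)" using reduced_dominant[of j n w'] w abc by simp
    then show ?thesis using one by (auto simp: dominant_def split: if_splits)
  qed
qed

definition chi_unit :: "nat \<Rightarrow> nat \<Rightarrow> series" where
  "chi_unit i j = indet_power j (chi_sign i j)"

lemma chi_inverse:
  assumes ij: "i \<in> index" "j \<in> index" "i \<noteq> j"
  shows "(inv\<^bsub>AutoGroup F3\<^esub> chi i j) (F3_gen i) = F3_gen j \<otimes>\<^bsub>F3\<^esub> F3_gen i \<otimes>\<^bsub>F3\<^esub> inv\<^bsub>F3\<^esub> F3_gen j"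
    and "k \<in> index \<Longrightarrow> k \<noteq> i \<Longrightarrow> (inv\<^bsub>AutoGroup F3\<^esub> chi i j) (F3_gen k) = F3_gen k"
proof -
  let ?i = "inv\<^bsub>AutoGroup F3\<^esub> chi i j"
  note c = chi_auto[OF ij]
  have ic: "?i \<in> carrier (AutoGroup F3)" using c by simp
  interpret I: group_hom F3 F3 ?i by (rule Aut_hom[OF ic])
  have undo: "?i (chi i j w) = w" if "w \<in> carrier F3" for w
    using Aut_mult[OF ic c that] Aut_one[OF that] c by simp
  note g = F3_gen_closed[OF ij(1)] F3_gen_closed[OF ij(2)]
  show fix_k: "?i (F3_gen k) = F3_gen k" if "k \<in> index" "k \<noteq> i" for k
    using undo[OF F3_gen_closed[OF that(1)]] chi_fixed[OF ij that] by simp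
  have j: "?i (F3_gen j) = F3_gen j" using fix_k ij by auto
  have ig: "?i (F3_gen i) \<in> carrier F3" using g by simp
  have "F3_gen i = inv\<^bsub>F3\<^esub> F3_gen j \<otimes>\<^bsub>F3\<^esub> ?i (F3_gen i) \<otimes>\<^bsub>F3\<^esub> F3_gen j"
    using undo[OF g(1)] unfolding chi_moved[OF ij] using g j by simp
  then have "F3_gen j \<otimes>\<^bsub>F3\<^esub> F3_gen i \<otimes>\<^bsub>F3\<^esub> inv\<^bsub>F3\<^esub> F3_gen j =
    F3_gen j \<otimes>\<^bsub>F3\<^esub> (inv\<^bsub>F3\<^esub> F3_gen j \<otimes>\<^bsub>F3\<^esub> ?i (F3_gen i) \<otimes>\<^bsub>F3\<^esub> F3_gen j) \<otimes>\<^bsub>F3\<^esub> inv\<^bsub>F3\<^esub> F3_gen j" by simp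
  also have "\<dots> = ?i (F3_gen i)" using g ig by (simp add: F3.m_assoc)
  finally show "?i (F3_gen i) = F3_gen j \<otimes>\<^bsub>F3\<^esub> F3_gen i \<otimes>\<^bsub>F3\<^esub> inv\<^bsub>F3\<^esub> F3_gen j" by simp
qed

lemma normal_form_step:
  assumes \<psi>: "\<psi> \<in> carrier (AutoGroup F3)" and t: "normal_form \<psi> u" and ij: "i \<in> index" "j \<in> index" "i \<noteq> j"
  shows "normal_form (\<psi> \<otimes>\<^bsub>AutoGroup F3\<^esub> chi i j) (u * chi_unit i j)"
    and "normal_form (\<psi> \<otimes>\<^bsub>AutoGroup F3\<^esub> inv\<^bsub>AutoGroup F3\<^esub> chi i j) (u * indet_power j (- chi_sign i j))"
proof -
  from t obtain w v where w: "reduced w" "u = word_unit w" "axes \<psi> v" "areas v = word_area w"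
    unfolding normal_form_def by blast
  have s: "chi_sign i j \<noteq> 0" "- chi_sign i j \<noteq> 0" by (auto simp: chi_sign_def)
  note c = chi_auto[OF ij]
  have ic: "inv\<^bsub>AutoGroup F3\<^esub> chi i j \<in> carrier (AutoGroup F3)" using c by simp
  obtain w1 where w1: "reduced w1" "word_area w1 = area_move j (chi_sign i j) (word_area w)"
    "word_unit w1 = word_unit w * indet_power j (chi_sign i j)"
    using reduced_push[OF w(1) ij(2) s(1)] by blast
  have a1: "axes (\<psi> \<otimes>\<^bsub>AutoGroup F3\<^esub> chi i j) (v(i := transvection (v j) (- 1) (v i)))"
    by (rule axes_step[OF \<psi> c w(3) ij(1,2) chi_fixed[OF ij]]) (simp_all add: chi_moved[OF ij])
  show "normal_form (\<psi> \<otimes>\<^bsub>AutoGroup F3\<^esub> chi i j) (u * chi_unit i j)"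
    unfolding normal_form_def
    using w1 a1 areas_step[OF ij, of v "- 1"] w by (intro exI[of _ w1] exI[of _
        "v(i := transvection (v j) (- 1) (v i))"]) (simp add: chi_unit_def)
  obtain w2 where w2: "reduced w2" "word_area w2 = area_move j (- chi_sign i j) (word_area w)"
    "word_unit w2 = word_unit w * indet_power j (- chi_sign i j)"
    using reduced_push[OF w(1) ij(2) s(2)] by blast
  have a2: "axes (\<psi> \<otimes>\<^bsub>AutoGroup F3\<^esub> inv\<^bsub>AutoGroup F3\<^esub> chi i j) (v(i := transvection (v j) 1 (v i)))"
    by (rule axes_step[OF \<psi> ic w(3) ij(1,2) chi_inverse(2)[OF ij]]) (simp_all add: chi_inverse(1)[OF ij])
  show "normal_form (\<psi> \<otimes>\<^bsub>AutoGroup F3\<^esub> inv\<^bsub>AutoGroup F3\<^esub> chi i j) (u * indet_power j (- chi_sign i j))"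
    unfolding normal_form_def
    using w2 a2 areas_step[OF ij, of v 1] w by (intro exI[of _ w2] exI[of _
        "v(i := transvection (v j) 1 (v i))"]) simp
qed

abbreviation pair_group where "pair_group \<equiv> AutoGroup F3 \<times>\<times> series_units"

interpretation P: group pair_group
  by (rule DirProd_group[OF F3.AutoGroup group_series_units])

definition chi_pairs where
  "chi_pairs = {(chi i j, chi_unit i j) | i j. i \<in> index \<and> j \<in> index \<and> i \<noteq> j}"

lemma chi_unit_closed: "chi_unit i j \<in> carrier series_units"
  unfolding chi_unit_def by (rule indet_power_closed)

lemma chi_pairs_closed: "chi_pairs \<subseteq> carrier pair_group"
  unfolding chi_pairs_def using chi_auto chi_unit_closed by (auto simp del: series_units_simps)

lemma inv_indet_power: "inv\<^bsub>series_units\<^esub> indet_power j n = indet_power j (- n)"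
  using indet_power_closed indet_power_add[of j "- n" n] indet_power_simps(1)
  by (intro U.inv_equality) (simp_all del: series_units_simps(1))

lemma normal_form_mult:
  assumes "p \<in> generate pair_group chi_pairs" "\<psi> \<in> carrier (AutoGroup F3)" "normal_form \<psi> u"
  shows "normal_form (\<psi> \<otimes>\<^bsub>AutoGroup F3\<^esub> fst p) (u * snd p)"
  using assms
proof (induction p arbitrary: \<psi> u rule: generate.induct)
  case one
  then show ?case by simp
next
  case (incl h)
  then show ?case using normal_form_step(1) by (auto simp: chi_pairs_def)
next
  case (inv h)
  then obtain i j where h: "h = (chi i j, chi_unit i j)" "i \<in> index" "j \<in> index" "i \<noteq> j"
      by (auto simp: chi_pairs_def)
  have "inv\<^bsub>pair_group\<^esub> h = (inv\<^bsub>AutoGroup F3\<^esub> chi i j, indet_power j (- chi_sign i j))"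
    unfolding h(1) using inv_DirProd[OF F3.AutoGroup group_series_units chi_auto[OF h(2-4)] chi_unit_closed]
    by (simp add: chi_unit_def inv_indet_power)
  then show ?case using normal_form_step(2)[OF inv(2,3) h(2-4)] by simp
next
  case (eng h1 h2)
  have "h1 \<in> carrier pair_group" "h2 \<in> carrier pair_group"
    using eng P.generate_in_carrier[OF chi_pairs_closed] by auto
  then have "fst h1 \<in> carrier (AutoGroup F3)" "fst h2 \<in> carrier (AutoGroup F3)" by auto
  then have "normal_form ((\<psi> \<otimes>\<^bsub>AutoGroup F3\<^esub> fst h1) \<otimes>\<^bsub>AutoGroup F3\<^esub> fst h2) ((u * snd h1) * snd h2)"
    using eng by simp
  then show ?case
    using eng.prems(1) \<open>fst h1 \<in> carrier (AutoGroup F3)\<close> \<open>fst h2 \<in> carrier (AutoGroup F3)\<close>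
    by (cases h1; cases h2) (simp add: Aut.m_assoc mult.assoc)
qed

text \<open>
  The subgroup generated by the pairs $(\chi_{ij}, (1
      + X_j)^{\pm 1})$ is therefore the graph of a homomorphism on
  the McCool group.
\<close>

lemma pair_kernel_trivial:
  assumes "(\<one>\<^bsub>AutoGroup F3\<^esub>, u) \<in> generate pair_group chi_pairs"
  shows "u = 1"
  using normal_form_mult[OF assms Aut.one_closed normal_form_one] normal_form_one_unique by simp

lemma generate_pairs_subgroup: "subgroup (generate pair_group chi_pairs) pair_group"
  by (rule P.generate_is_subgroup[OF chi_pairs_closed])

lemma pair_exists:
  assumes "\<phi> \<in> carrier McCool3"
  shows "\<exists>u. (\<phi>, u) \<in> generate pair_group chi_pairs"
  using assms unfolding carrier_McCool3
proof (induction \<phi> rule: generate.induct)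
  case one
  then show ?case using generate.one[of pair_group chi_pairs] by auto
next
  case (incl h)
  then show ?case using generate.incl[of _ chi_pairs pair_group] by (fastforce simp: chi_set_def chi_pairs_def)
next
  case (inv h)
  then obtain i j where h: "h = chi i j" "i \<in> index" "j \<in> index" "i \<noteq> j" by (auto simp: chi_set_def)
  then have "(h, chi_unit i j) \<in> chi_pairs" by (auto simp: chi_pairs_def)
  from generate.inv[OF this, of pair_group] show ?case
    using inv_DirProd[OF F3.AutoGroup group_series_units chi_auto[OF h(2-4)] chi_unit_closed] h(1) by auto
next
  case (eng h1 h2)
  then obtain u1 u2 where "(h1, u1) \<in> generate pair_group chi_pairs"
      "(h2, u2) \<in> generate pair_group chi_pairs" by blast
  from generate.eng[OF this] show ?case by auto
qed

lemma pair_unique: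
  assumes "(\<phi>, u) \<in> generate pair_group chi_pairs" "(\<phi>, u') \<in> generate pair_group chi_pairs"
  shows "u = u'"
proof -
  have c: "\<phi> \<in> carrier (AutoGroup F3)" "u \<in> carrier series_units" "u' \<in> carrier series_units"
    using assms P.generate_in_carrier[OF chi_pairs_closed] by (auto simp del: series_units_simps(1))
  have "inv\<^bsub>pair_group\<^esub> (\<phi>, u) \<otimes>\<^bsub>pair_group\<^esub> (\<phi>, u') \<in> generate pair_group chi_pairs"
    using subgroup.m_closed[OF generate_pairs_subgroup subgroup.m_inv_closed[OF generate_pairs_subgroup
        assms(1)] assms(2)] .
  also have "inv\<^bsub>pair_group\<^esub> (\<phi>, u) \<otimes>\<^bsub>pair_group\<^esub> (\<phi>, u') = (\<one>\<^bsub>AutoGroup F3\<^esub>, inv\<^bsub>series_units\<^esub> u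
      \<otimes>\<^bsub>series_units\<^esub> u')"
    using inv_DirProd[OF F3.AutoGroup group_series_units c(1,2)] c(1) by simp
  finally have "inv\<^bsub>series_units\<^esub> u \<otimes>\<^bsub>series_units\<^esub> u' = \<one>\<^bsub>series_units\<^esub>"
    using pair_kernel_trivial by simp
  with U.cancel_left(1)[OF c(2,3)] U.r_one[OF c(2)] show ?thesis by simp
qed

definition outer_unit :: "((nat \<times> bool) list set \<Rightarrow> (nat \<times> bool) list set) \<Rightarrow> series" where
  "outer_unit \<phi> = (THE u. (\<phi>, u) \<in> generate pair_group chi_pairs)"

lemma outer_unit_eq: "(\<phi>, u) \<in> generate pair_group chi_pairs \<Longrightarrow> outer_unit \<phi> = u"
  unfolding outer_unit_def using pair_unique by blast

lemma outer_unit_pair: "\<phi> \<in> carrier McCool3 \<Longrightarrow> (\<phi>, outer_unit \<phi>) \<in> generate pair_group chi_pairs"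
  using pair_exists outer_unit_eq by metis

lemma outer_unit_hom: "outer_unit \<in> hom McCool3 series_units"
proof (rule homI)
  show "outer_unit \<phi> \<in> carrier series_units" if "\<phi> \<in> carrier McCool3" for \<phi>
    using outer_unit_pair[OF that] P.generate_in_carrier[OF chi_pairs_closed]
        by (fastforce simp del: series_units_simps(1))
  show "outer_unit (\<phi> \<otimes>\<^bsub>McCool3\<^esub> \<psi>) = outer_unit \<phi> \<otimes>\<^bsub>series_units\<^esub> outer_unit \<psi>"
    if "\<phi> \<in> carrier McCool3" "\<psi> \<in> carrier McCool3" for \<phi> \<psi>
    using generate.eng[OF outer_unit_pair[OF that(1)] outer_unit_pair[OF that(2)]] outer_unit_eq by simp
qed

lemma outer_unit_chi:
  assumes "i \<in> index" "j \<in> index" "i \<noteq> j"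
  shows "outer_unit (chi i j) = chi_unit i j"
  by (rule outer_unit_eq, rule generate.incl) (use assms in \<open>auto simp: chi_pairs_def\<close>)

section \<open>Magnus representations of the McCool group and of the free group\<close>

lemma coeff_Nil_mult: "coeff (f * g) [] = coeff f [] * coeff g []"
  by (simp add: coeff_mult)

lemma order_ge_1_iff: "f - 1 \<in> order_ge 1 \<longleftrightarrow> coeff f [] = 1"
  by (auto simp: order_ge_def coeff_one)

text \<open>
  The constant coefficient is multiplicative, so it suffices to look at generators.
\<close>

lemma magnus_homI:
  assumes G: "group G" and hom: "\<mu> \<in> hom G series_units" and gen: "carrier G = generate G S" "S \<subseteq> carrier G"
    and S: "\<And>s. s \<in> S \<Longrightarrow> coeff (\<mu> s) [] = 1"
  shows "magnus_hom G \<mu>"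
proof -
  interpret G: group G by fact
  interpret m: group_hom G series_units \<mu> using hom by unfold_locales
  have "coeff (\<mu> g) [] = 1" if "g \<in> carrier G" for g
    using that unfolding gen(1)
  proof (induction g rule: generate.induct)
    case one
    then show ?case using m.hom_one by (simp add: coeff_one)
  next
    case (inv h)
    then have h: "h \<in> carrier G" using gen(2) by blast
    have "\<mu> (inv\<^bsub>G\<^esub> h) * \<mu> h = 1" using m.hom_mult[of "inv\<^bsub>G\<^esub> h" h] h m.hom_one by (simp del: m.hom_inv)
    then have "coeff (\<mu> (inv\<^bsub>G\<^esub> h)) [] * coeff (\<mu> h) [] = 1" using coeff_Nil_mult by (metis coeff_one)
    then show ?case using S[OF inv] by simp
  next
    case (eng h1 h2)
    then have "h1 \<in> carrier G" "h2 \<in> carrier G" using G.generate_in_carrier[OF gen(2)] by auto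
    then show ?case using eng by (simp add: coeff_Nil_mult)
  qed (rule S)
  then show ?thesis
    using hom by unfold_locales (simp_all only: order_ge_1_iff)
qed

lemma coeff_Nil_indet_units: "coeff (indet_unit j) [] = 1" "coeff (indet_unit_inv j) [] = 1"
  by (simp_all add: indet_unit_def indet_unit_inv_def coeff_one coeff_indet)

lemma magnus_outer_unit: "magnus_hom McCool3 outer_unit"
proof (rule magnus_homI[OF group_McCool3 outer_unit_hom McCool3_generated])
  fix s assume "s \<in> chi_set"
  then obtain i j where s: "s = chi i j" "i \<in> index" "j \<in> index" "i \<noteq> j" by (auto simp: chi_set_def)
  have "chi_sign i j = 1 \<or> chi_sign i j = -1" by (simp add: chi_sign_def)
  then show "coeff (outer_unit s) [] = 1"
    using outer_unit_chi[OF s(2-4)] s(1) by (auto simp: chi_unit_def indet_power_simps coeff_Nil_indet_units)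
qed

text \<open>
  The generators go to $(1 + X_i)^{-1}$ because the products $\chi_{ij}\chi_{kj}$ are the inner automorphisms by
  the inverse generators, which then have leading terms $X_j$.
\<close>

definition magnus :: "(nat \<times> bool) list set \<Rightarrow> series" where
  "magnus = free_group_lift series_units indet_unit_inv"

lemma magnus_gen: "i \<in> index \<Longrightarrow> magnus (F3_gen i) = indet_unit_inv i"
  and magnus_hom_F3: "magnus \<in> hom F3 series_units"
proof -
  have r: "range indet_unit_inv \<subseteq> carrier series_units" using indet_unit_inv by auto
  show "i \<in> index \<Longrightarrow> magnus (F3_gen i) = indet_unit_inv i"
    unfolding magnus_def F3_gen_def index_def by (rule free_group_lift_gen[OF group_series_units r])
  show "magnus \<in> hom F3 series_units"
    unfolding magnus_def F3_def by (rule free_group_lift_hom[OF group_series_units r])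
qed

lemma F3_generated: "carrier F3 = generate F3 (F3_gen ` index)" "F3_gen ` index \<subseteq> carrier F3"
proof -
  show sub: "F3_gen ` index \<subseteq> carrier F3" using F3_gen_closed by blast
  have "w \<in> generate F3 (F3_gen ` index)" if "w \<in> carrier F3" for w
    using that unfolding F3_def
  proof (induction w rule: free_group_induct)
    case one
    then show ?case by (rule generate.one)
  next
    case (gen x a)
    have "F3_gen x \<in> F3_gen ` index" by (rule imageI) (use gen(1) in \<open>simp add: index_def\<close>)
    from generate.eng[OF generate.incl[OF this] gen(3)] show ?case by (simp only: F3_gen_def[of x])
  next
    case (inv x a)
    have "F3_gen x \<in> F3_gen ` index" by (rule imageI) (use inv(1) in \<open>simp add: index_def\<close>)
    from generate.eng[OF generate.inv[OF this] inv(3)] show ?case by (simp only: F3_gen_def[of x])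
  qed
  then show "carrier F3 = generate F3 (F3_gen ` index)" using F3.generate_in_carrier[OF sub] by blast
qed

lemma magnus_hom_magnus: "magnus_hom F3 magnus"
  by (rule magnus_homI[OF group_F3 magnus_hom_F3 F3_generated])
     (auto simp: magnus_gen coeff_Nil_indet_units)

section \<open>Inner automorphisms and the Johnson filtration\<close>

definition inner :: "(nat \<times> bool) list set \<Rightarrow> (nat \<times> bool) list set \<Rightarrow> (nat \<times> bool) list set" where
  "inner w = (\<lambda>g \<in> carrier F3. w \<otimes>\<^bsub>F3\<^esub> g \<otimes>\<^bsub>F3\<^esub> inv\<^bsub>F3\<^esub> w)"

lemma inner_auto:
  assumes w: "w \<in> carrier F3"
  shows "inner w \<in> carrier (AutoGroup F3)"
proof -
  have "bij_betw (inner w) (carrier F3) (carrier F3)"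
    by (rule bij_betw_byWitness[of _ "inner (inv\<^bsub>F3\<^esub> w)"]) (use w in \<open>auto simp: inner_def F3.m_assoc\<close>)
  moreover have "inner w \<in> hom F3 F3"
    by (rule homI) (use w in \<open>simp_all add: inner_def F3.m_assoc\<close>)
  ultimately show ?thesis by (simp add: Aut_carrier) (simp add: inner_def)
qed

lemma inner_mult:
  assumes "v \<in> carrier F3" "w \<in> carrier F3"
  shows "inner (v \<otimes>\<^bsub>F3\<^esub> w) = inner v \<otimes>\<^bsub>AutoGroup F3\<^esub> inner w"
proof (rule Aut_eqI)
  fix i assume "i \<in> index"
  then have g: "F3_gen i \<in> carrier F3" by (rule F3_gen_closed)
  show "inner (v \<otimes>\<^bsub>F3\<^esub> w) (F3_gen i) = (inner v \<otimes>\<^bsub>AutoGroup F3\<^esub> inner w) (F3_gen i)"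
    unfolding Aut_mult[OF inner_auto[OF assms(1)] inner_auto[OF assms(2)] g]
    using assms g by (simp add: inner_def F3.m_assoc F3.inv_mult_group)
qed (use assms inner_auto in simp_all)

lemma inner_chi:
  assumes i: "i \<in> index" and k: "k \<in> index" and j: "j \<in> index" and ne: "i \<noteq> j" "k \<noteq> j" "i \<noteq> k"
  shows "inner (inv\<^bsub>F3\<^esub> F3_gen j) = chi i j \<otimes>\<^bsub>AutoGroup F3\<^esub> chi k j"
proof (rule Aut_eqI)
  note g = F3_gen_closed[OF i] F3_gen_closed[OF j] F3_gen_closed[OF k]
  note ci = chi_auto[OF i j ne(1)] and ck = chi_auto[OF k j ne(2)]
  fix l assume l: "l \<in> index"
  then have "l = i \<or> l = j \<or> l = k" using i j k ne by (auto simp: index_def)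
  interpret I: group_hom F3 F3 "chi i j" by (rule Aut_hom[OF ci])
  have act: "(chi i j \<otimes>\<^bsub>AutoGroup F3\<^esub> chi k j) (F3_gen l) = chi i j (chi k j (F3_gen l))"
    by (rule Aut_mult[OF ci ck F3_gen_closed[OF l]])
  show "inner (inv\<^bsub>F3\<^esub> F3_gen j) (F3_gen l) = (chi i j \<otimes>\<^bsub>AutoGroup F3\<^esub> chi k j) (F3_gen l)"
    unfolding act using \<open>l = i \<or> l = j \<or> l = k\<close>
  proof (elim disjE)
    assume "l = i"
    then show "inner (inv\<^bsub>F3\<^esub> F3_gen j) (F3_gen l) = chi i j (chi k j (F3_gen l))"
        using g ne chi_fixed[OF k j ne(2) i] chi_moved[OF i j ne(1)] by (simp add: inner_def)
  next
    assume "l = j"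
    then show "inner (inv\<^bsub>F3\<^esub> F3_gen j) (F3_gen l) = chi i j (chi k j (F3_gen l))"
        using g ne chi_fixed[OF k j ne(2) j] chi_fixed[OF i j ne(1) j] by (simp add: inner_def)
  next
    assume "l = k"
    then show "inner (inv\<^bsub>F3\<^esub> F3_gen j) (F3_gen l) = chi i j (chi k j (F3_gen l))"
      using g ne chi_moved[OF k j ne(2)] chi_fixed[OF i j ne(1) k] chi_fixed[OF i j ne(1) j]
          by (simp add: inner_def)
  qed
qed (use chi_auto[OF i j ne(1)] chi_auto[OF k j ne(2)] inner_auto F3_gen_closed[OF j] in simp_all)

lemma inner_McCool3: "w \<in> carrier F3 \<Longrightarrow> inner w \<in> carrier McCool3"
proof -
  have inner_one: "inner \<one>\<^bsub>F3\<^esub> = \<one>\<^bsub>AutoGroup F3\<^esub>"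
    using inner_mult[of "\<one>\<^bsub>F3\<^esub>" "\<one>\<^bsub>F3\<^esub>"] inner_auto[of "\<one>\<^bsub>F3\<^esub>"] Aut.l_cancel_one'[of "inner \<one>\<^bsub>F3\<^esub>"
        "inner \<one>\<^bsub>F3\<^esub>"] by simp
  have inner_inv: "inner (inv\<^bsub>F3\<^esub> w) = inv\<^bsub>AutoGroup F3\<^esub> inner w" if "w \<in> carrier F3" for w
    using inner_mult[of "inv\<^bsub>F3\<^esub> w" w] that inner_auto inner_one by (intro Aut.inv_equality[symmetric]) simp_all
  have gen: "inner (inv\<^bsub>F3\<^esub> F3_gen j) \<in> carrier McCool3" if j: "j \<in> index" for j
  proof -
    obtain i k where ik: "i \<in> index" "k \<in> index" "i \<noteq> j" "k \<noteq> j" "i \<noteq> k"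
    proof -
      have "j = 1 \<or> j = 2 \<or> j = 3" using j by (simp add: index_def)
      then show thesis using that[of 2 3] that[of 1 3] that[of 1 2] by (auto simp: index_def)
    qed
    show ?thesis
      unfolding inner_chi[OF ik(1,2) j ik(3,4,5)]
      using M3.m_closed[OF chi_McCool3[OF ik(1) j ik(3)] chi_McCool3[OF ik(2) j ik(4)]] by simp
  qed
  assume "w \<in> carrier F3"
  then show ?thesis
    unfolding F3_generated(1)
  proof (induction w rule: generate.induct)
    case one
    then show ?case using M3.one_closed by (simp add: inner_one)
  next
    case (incl h)
    then obtain j where j: "j \<in> index" "h = F3_gen j" by blast
    have "inv\<^bsub>AutoGroup F3\<^esub> inner (inv\<^bsub>F3\<^esub> h) \<in> carrier McCool3"
      using M3.inv_closed[OF gen[OF j(1)]] inv_McCool3[OF gen[OF j(1)]] j by simp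
    then show ?case using inner_inv[of h] j F3_gen_closed inner_auto by simp
  next
    case (inv h)
    then show ?case using gen by blast
  next
    case (eng h1 h2)
    then have "h1 \<in> carrier F3" "h2 \<in> carrier F3" using F3.generate_in_carrier[OF F3_generated(2)] by auto
    then show ?case using M3.m_closed[OF eng(3,4)] by (simp add: inner_mult)
  qed
qed

lemma inner_hom: "inner \<in> hom F3 McCool3"
  by (rule homI) (simp_all add: inner_McCool3 inner_mult)

text \<open>
  The $n$-th step of the Johnson filtration, in the strong form that all terms of the lower central series are
  moved $n$ steps deeper.
\<close>

definition raises_filtration :: "nat \<Rightarrow> ((nat \<times> bool) list set \<Rightarrow> (nat \<times> bool) list set) \<Rightarrow> bool" where
  "raises_filtration n \<phi> \<longleftrightarrow> (\<forall>k \<ge> 1. \<forall>w \<in> lower_central F3 k. inv\<^bsub>F3\<^esub> w \<otimes>\<^bsub>F3\<^esub> \<phi> w \<in> lower_central F3 (k + n))"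

lemma raises_filtrationE:
  assumes "raises_filtration n \<phi>" "k \<ge> 1" "w \<in> lower_central F3 k" "\<phi> w \<in> carrier F3"
  obtains a where "a \<in> lower_central F3 (k + n)" "\<phi> w = w \<otimes>\<^bsub>F3\<^esub> a"
proof
  show "inv\<^bsub>F3\<^esub> w \<otimes>\<^bsub>F3\<^esub> \<phi> w \<in> lower_central F3 (k + n)" using assms by (simp add: raises_filtration_def)
  show "\<phi> w = w \<otimes>\<^bsub>F3\<^esub> (inv\<^bsub>F3\<^esub> w \<otimes>\<^bsub>F3\<^esub> \<phi> w)" using assms F3.lower_central_carrier by simp
qed

lemma Aut_lower_central:
  assumes "\<phi> \<in> carrier (AutoGroup F3)" "w \<in> lower_central F3 k"
  shows "\<phi> w \<in> lower_central F3 k"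
  using hom_lower_central[OF group_F3 group_F3 _ assms(2)] assms(1) by (simp add: Aut_carrier)

lemma raises_filtration_subgroup: "subgroup {\<phi> \<in> carrier (AutoGroup F3). raises_filtration n \<phi>} (AutoGroup F3)"
proof (rule Aut.subgroupI)
  have "raises_filtration n \<one>\<^bsub>AutoGroup F3\<^esub>"
    using F3.lower_central_carrier F3.lower_central_one by (auto simp: raises_filtration_def Aut_one)
  then show "{\<phi> \<in> carrier (AutoGroup F3). raises_filtration n \<phi>} \<noteq> {}" by auto
next
  fix \<phi> assume \<phi>: "\<phi> \<in> {\<phi> \<in> carrier (AutoGroup F3). raises_filtration n \<phi>}"
  let ?i = "inv\<^bsub>AutoGroup F3\<^esub> \<phi>"
  have c: "\<phi> \<in> carrier (AutoGroup F3)" "?i \<in> carrier (AutoGroup F3)" using \<phi> by auto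
  have "inv\<^bsub>F3\<^esub> w \<otimes>\<^bsub>F3\<^esub> ?i w \<in> lower_central F3 (k + n)" if k: "k \<ge> 1" "w \<in> lower_central F3 k" for k w
  proof -
    have w: "w \<in> carrier F3" using k F3.lower_central_carrier by blast
    have m: "?i w \<in> lower_central F3 k" using Aut_lower_central[OF c(2) k(2)] .
    have mc: "?i w \<in> carrier F3" using m F3.lower_central_carrier by blast
    have "\<phi> (?i w) = w" using Aut_mult[OF c w] Aut_one[OF w] c by simp
    then have "inv\<^bsub>F3\<^esub> ?i w \<otimes>\<^bsub>F3\<^esub> w \<in> lower_central F3 (k + n)"
      using \<phi> k(1) m unfolding raises_filtration_def by fastforce
    from F3.lower_central_inv[OF this] show ?thesis using w mc by (simp add: F3.inv_mult_group)
  qed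
  then show "?i \<in> {\<phi> \<in> carrier (AutoGroup F3). raises_filtration n \<phi>}" using c
      by (simp add: raises_filtration_def)
next
  fix \<phi> \<psi> assume \<phi>\<psi>: "\<phi> \<in> {\<phi> \<in> carrier (AutoGroup F3). raises_filtration n \<phi>}"
      "\<psi> \<in> {\<phi> \<in> carrier (AutoGroup F3). raises_filtration n \<phi>}"
  then have c: "\<phi> \<in> carrier (AutoGroup F3)" "\<psi> \<in> carrier (AutoGroup F3)" by auto
  interpret \<phi>: group_hom F3 F3 \<phi> by (rule Aut_hom[OF c(1)])
  have "inv\<^bsub>F3\<^esub> w \<otimes>\<^bsub>F3\<^esub> (\<phi> \<otimes>\<^bsub>AutoGroup F3\<^esub> \<psi>) w \<in> lower_central F3 (k + n)" if k: "k \<ge> 1"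
      "w \<in> lower_central F3 k" for k w
  proof -
    have w: "w \<in> carrier F3" using k F3.lower_central_carrier by blast
    obtain a where a: "a \<in> lower_central F3 (k + n)" "\<phi> w = w \<otimes>\<^bsub>F3\<^esub> a"
      using raises_filtrationE[of n \<phi> k w] \<phi>\<psi> k w by auto
    obtain b where b: "b \<in> lower_central F3 (k + n)" "\<psi> w = w \<otimes>\<^bsub>F3\<^esub> b"
      using raises_filtrationE[of n \<psi> k w] \<phi>\<psi> k Aut_closed[OF c(2) w] by auto
    have ab: "a \<in> carrier F3" "b \<in> carrier F3" using a b F3.lower_central_carrier by auto
    have "(\<phi> \<otimes>\<^bsub>AutoGroup F3\<^esub> \<psi>) w = w \<otimes>\<^bsub>F3\<^esub> (a \<otimes>\<^bsub>F3\<^esub> \<phi> b)"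
      using Aut_mult[OF c w] a b ab w by (simp add: F3.m_assoc)
    moreover have "a \<otimes>\<^bsub>F3\<^esub> \<phi> b \<in> lower_central F3 (k + n)"
      using F3.lower_central_mult[OF a(1) Aut_lower_central[OF c(1) b(1)]] .
    ultimately show ?thesis using w ab by simp
  qed
  then show "\<phi> \<otimes>\<^bsub>AutoGroup F3\<^esub> \<psi> \<in> {\<phi> \<in> carrier (AutoGroup F3). raises_filtration n \<phi>}"
    using c by (simp add: raises_filtration_def)
qed auto

text \<open>
  Modulo $\gamma_{k+n+1}$ both $\phi\psi$ and $\psi\phi$ map $w$ to $wab$, where $\phi(w) = wa$ and
  $\psi(w) = wb$, since $(a, b)$ lies in that term.
\<close>

lemma raises_filtration_commutator:
  assumes \<phi>: "\<phi> \<in> carrier (AutoGroup F3)" "raises_filtration n \<phi>" and \<psi>: "\<psi> \<in> carrier (AutoGroup F3)"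
      "raises_filtration 1 \<psi>"
  shows "raises_filtration (Suc n) (commutator (AutoGroup F3) \<phi> \<psi>)"
  unfolding raises_filtration_def
proof (intro allI impI ballI)
  fix k w assume k: "1 \<le> k" and wk: "w \<in> lower_central F3 k"
  interpret \<phi>: group_hom F3 F3 \<phi> by (rule Aut_hom[OF \<phi>(1)])
  interpret \<psi>: group_hom F3 F3 \<psi> by (rule Aut_hom[OF \<psi>(1)])
  let ?pp = "\<phi> \<otimes>\<^bsub>AutoGroup F3\<^esub> \<psi>" and ?qq = "\<psi> \<otimes>\<^bsub>AutoGroup F3\<^esub> \<phi>"
  let ?L = "lower_central F3 (k + Suc n)"
  have w: "w \<in> carrier F3" using wk F3.lower_central_carrier by blast
  obtain a where a: "a \<in> lower_central F3 (k + n)" "\<phi> w = w \<otimes>\<^bsub>F3\<^esub> a"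
    using raises_filtrationE[OF \<phi>(2) k wk] w by auto
  obtain b where b: "b \<in> lower_central F3 (k + 1)" "\<psi> w = w \<otimes>\<^bsub>F3\<^esub> b"
    using raises_filtrationE[OF \<psi>(2) k wk] w by auto
  have ab: "a \<in> carrier F3" "b \<in> carrier F3" using a(1) b(1) F3.lower_central_carrier by blast+
  obtain c where c: "c \<in> lower_central F3 (k + 1 + n)" "\<phi> b = b \<otimes>\<^bsub>F3\<^esub> c"
    using raises_filtrationE[OF \<phi>(2) _ b(1)] ab by auto
  obtain d where d: "d \<in> lower_central F3 (k + n + 1)" "\<psi> a = a \<otimes>\<^bsub>F3\<^esub> d"
    using raises_filtrationE[OF \<psi>(2) _ a(1)] ab k by auto
  have cd: "c \<in> ?L" "d \<in> ?L" using c d by auto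
  have cdc: "c \<in> carrier F3" "d \<in> carrier F3" using cd F3.lower_central_carrier by blast+
  have com: "commutator F3 a b \<in> ?L" using F3.commutator_lower_central_1[OF a(1) ab(2)] by simp
  have pp: "?pp w = w \<otimes>\<^bsub>F3\<^esub> a \<otimes>\<^bsub>F3\<^esub> b \<otimes>\<^bsub>F3\<^esub> c"
    unfolding Aut_mult[OF \<phi>(1) \<psi>(1) w] using w ab cdc by (simp add: b(2) a(2) c(2) F3.m_assoc)
  have qq: "?qq w = w \<otimes>\<^bsub>F3\<^esub> b \<otimes>\<^bsub>F3\<^esub> a \<otimes>\<^bsub>F3\<^esub> d"
    unfolding Aut_mult[OF \<psi>(1) \<phi>(1) w] using w ab cdc by (simp add: b(2) a(2) d(2) F3.m_assoc)
  \<comment> \<open>The two composites differ by $e$ on the right, and applying the inverse of one of them moves $e$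
      within its term.\<close>
  define e where "e = inv\<^bsub>F3\<^esub> d \<otimes>\<^bsub>F3\<^esub> commutator F3 a b \<otimes>\<^bsub>F3\<^esub> c"
  have e: "e \<in> ?L" unfolding e_def using cd com by (intro F3.lower_central_mult F3.lower_central_inv)
  have ec: "e \<in> carrier F3" using e F3.lower_central_carrier by blast
  have pq: "?pp w = ?qq w \<otimes>\<^bsub>F3\<^esub> e"
    unfolding pp qq e_def commutator_def using w ab cdc by (simp add: F3.m_assoc)
  let ?i = "inv\<^bsub>AutoGroup F3\<^esub> ?qq"
  have m: "?pp \<in> carrier (AutoGroup F3)" "?qq \<in> carrier (AutoGroup F3)" "?i \<in> carrier (AutoGroup F3)"
    using \<phi>(1) \<psi>(1) by auto
  interpret I: group_hom F3 F3 ?i by (rule Aut_hom[OF m(3)])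
  have "commutator (AutoGroup F3) \<phi> \<psi> = ?i \<otimes>\<^bsub>AutoGroup F3\<^esub> ?pp"
    using \<phi>(1) \<psi>(1) by (simp add: commutator_def Aut.inv_mult_group Aut.m_assoc)
  then have "commutator (AutoGroup F3) \<phi> \<psi> w = ?i (?qq w \<otimes>\<^bsub>F3\<^esub> e)"
    using Aut_mult[OF m(3,1) w] pq by simp
  also have "\<dots> = ?i (?qq w) \<otimes>\<^bsub>F3\<^esub> ?i e" using I.hom_mult Aut_closed[OF m(2) w] ec by blast
  also have "?i (?qq w) = w" using Aut_mult[OF m(3,2) w] Aut_one[OF w] m(2) by simp
  finally have "inv\<^bsub>F3\<^esub> w \<otimes>\<^bsub>F3\<^esub> commutator (AutoGroup F3) \<phi> \<psi> w = ?i e" using w ec by simp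
  then show "inv\<^bsub>F3\<^esub> w \<otimes>\<^bsub>F3\<^esub> commutator (AutoGroup F3) \<phi> \<psi> w \<in> ?L"
    using Aut_lower_central[OF m(3) e] by simp
qed

text \<open>
  The induced endomorphism of the associated graded ring of $F$ fixes the generators of degree one, hence
  everything.
\<close>

lemma raises_filtration_chi:
  assumes ij: "i \<in> index" "j \<in> index" "i \<noteq> j"
  shows "raises_filtration 1 (chi i j)"
proof -
  let ?\<phi> = "chi i j"
  note c = chi_auto[OF ij]
  have hom: "?\<phi> \<in> hom F3 F3" using c by (simp add: Aut_carrier)
  interpret gr: lie_ring "gr F3" by (rule F3.lie_ring_gr)
  note m = gr_map_lie_hom[OF group_F3 group_F3 hom]
  interpret m: group_hom "gr F3" "gr F3" "gr_map F3 F3 ?\<phi>"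
    using m by (simp add: lie_hom_def group_hom_def group_hom_axioms_def gr.is_group)
  let ?H = "{f \<in> carrier (gr F3). gr_map F3 F3 ?\<phi> f = f}"
  have "?H = carrier (gr F3)"
  proof (rule F3.gr_generated_in_degree_one[OF _ _ F3_generated])
    show "subgroup ?H (gr F3)"
      by (rule gr.subgroupI) (auto intro: exI[of _ "\<one>\<^bsub>gr F3\<^esub>"])
    show "\<lbrakk>x, y\<rbrakk>\<^bsub>gr F3\<^esub> \<in> ?H" if "x \<in> ?H" "y \<in> ?H" for x y
      using that m gr.lbr_closed by (simp add: lie_hom_def)
    show "gr_elem F3 1 s \<in> ?H" if "s \<in> F3_gen ` index" for s
    proof -
      from that obtain k where k: "s = F3_gen k" "k \<in> index" by blast
      have s: "s \<in> carrier F3" using k F3_gen_closed by simp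
      have "gr_elem F3 1 (?\<phi> s) = gr_elem F3 1 s"
      proof (cases "k = i")
        case False
        then show ?thesis using chi_fixed[OF ij k(2)] k(1) by simp
      next
        case True
        have g: "F3_gen i \<in> carrier F3" "F3_gen j \<in> carrier F3" using F3_gen_closed ij by auto
        have "commutator F3 (F3_gen i) (F3_gen j) \<in> lower_central F3 (Suc 1)"
          by (rule F3.commutator_lower_central_1) (use g in simp_all)
        then have "gr_class F3 1 (F3_gen i \<otimes>\<^bsub>F3\<^esub> commutator F3 (F3_gen i) (F3_gen j) \<otimes>\<^bsub>F3\<^esub> \<one>\<^bsub>F3\<^esub>)
            = gr_class F3 1 (F3_gen i \<otimes>\<^bsub>F3\<^esub> \<one>\<^bsub>F3\<^esub>)"
          by (rule F3.gr_class_absorb) (use g in simp_all)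
        then have "gr_class F3 1 (?\<phi> s) = gr_class F3 1 s"
          using chi_moved[OF ij] True k(1) g F3.conj_eq_commutator[of "F3_gen i" "F3_gen j"] by simp
        then show ?thesis by (simp only: gr_elem_def)
      qed
      then show ?thesis
        using gr_map_elem[OF group_F3 group_F3 hom, of 1 s] F3.gr_elem_closed[of 1 s] s by simp
    qed
  qed
  then have fix_gr: "gr_map F3 F3 ?\<phi> f = f" if "f \<in> carrier (gr F3)" for f using that by blast
  show ?thesis
    unfolding raises_filtration_def
  proof (intro allI impI ballI)
    fix k w assume k: "1 \<le> k" and w: "w \<in> lower_central F3 k"
    have e: "gr_elem F3 k (?\<phi> w) = gr_elem F3 k w"
      using gr_map_elem[OF group_F3 group_F3 hom k w] fix_gr[OF F3.gr_elem_closed[OF k w]] by simp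
    have pw: "?\<phi> w \<in> lower_central F3 k" using Aut_lower_central[OF c w] .
    have "gr_elem F3 k (inv\<^bsub>F3\<^esub> w \<otimes>\<^bsub>F3\<^esub> ?\<phi> w) = inv\<^bsub>gr F3\<^esub> gr_elem F3 k w \<otimes>\<^bsub>gr F3\<^esub> gr_elem F3 k w"
      using F3.gr_elem_mult[OF k F3.lower_central_inv[OF w] pw] F3.gr_elem_inv[OF k w] e by simp
    also have "\<dots> = \<one>\<^bsub>gr F3\<^esub>" using F3.gr_elem_closed[OF k w] by simp
    finally have "inv\<^bsub>F3\<^esub> w \<otimes>\<^bsub>F3\<^esub> ?\<phi> w \<in> lower_central F3 (Suc k)"
      using F3.gr_elem_eq_one_iff[OF k] w pw F3.lower_central_carrier by simp
    then show "inv\<^bsub>F3\<^esub> w \<otimes>\<^bsub>F3\<^esub> ?\<phi> w \<in> lower_central F3 (k + 1)" by simp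
  qed
qed

lemma raises_filtration_McCool3: "\<phi> \<in> carrier McCool3 \<Longrightarrow> raises_filtration 1 \<phi>"
proof -
  have "chi_set \<subseteq> {\<phi> \<in> carrier (AutoGroup F3). raises_filtration 1 \<phi>}"
    using raises_filtration_chi chi_set_auto unfolding chi_set_def by blast
  from Aut.generate_subgroup_incl[OF this raises_filtration_subgroup]
  show "\<phi> \<in> carrier McCool3 \<Longrightarrow> raises_filtration 1 \<phi>" unfolding carrier_McCool3 by blast
qed

lemma commutator_McCool3:
  "\<phi> \<in> carrier McCool3 \<Longrightarrow> \<psi> \<in> carrier McCool3 \<Longrightarrow> commutator McCool3 \<phi> \<psi> = commutator (AutoGroup F3) \<phi> \<psi>"
  by (simp add: commutator_def inv_McCool3)

lemma raises_filtration_lower_central: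
  assumes "n \<ge> 1" "\<phi> \<in> lower_central McCool3 n"
  shows "raises_filtration n \<phi>"
  using assms
proof (induction n arbitrary: \<phi> rule: nat_induct_at_least)
  case base
  then show ?case using raises_filtration_McCool3 by simp
next
  case (Suc n)
  let ?S = "{commutator McCool3 a b | a b. a \<in> lower_central McCool3 n \<and> b \<in> carrier McCool3}"
  have S: "?S \<subseteq> carrier McCool3" using M3.lower_central_carrier by auto
  have sub: "subgroup {\<phi> \<in> carrier McCool3. raises_filtration (Suc n) \<phi>} McCool3"
  proof (rule M3.subgroupI)
    note s = raises_filtration_subgroup[of "Suc n"]
    show "{\<phi> \<in> carrier McCool3. raises_filtration (Suc n) \<phi>} \<noteq> {}"
      using subgroup.one_closed[OF s] M3.one_closed by auto
    show "inv\<^bsub>McCool3\<^esub> a \<in> {\<phi> \<in> carrier McCool3. raises_filtration (Suc n) \<phi>}" if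
        "a \<in> {\<phi> \<in> carrier McCool3. raises_filtration (Suc n) \<phi>}" for a
      using subgroup.m_inv_closed[OF s, of a] that McCool3_subset M3.inv_closed[of a]
          by (auto simp: inv_McCool3)
    show "a \<otimes>\<^bsub>McCool3\<^esub> b \<in> {\<phi> \<in> carrier McCool3. raises_filtration (Suc n) \<phi>}"
      if "a \<in> {\<phi> \<in> carrier McCool3. raises_filtration (Suc n) \<phi>}"
          "b \<in> {\<phi> \<in> carrier McCool3. raises_filtration (Suc n) \<phi>}" for a b
      using subgroup.m_closed[OF s, of a b] that McCool3_subset M3.m_closed[of a b] by auto
  qed auto
  have "?S \<subseteq> {\<phi> \<in> carrier McCool3. raises_filtration (Suc n) \<phi>}"
  proof
    fix x assume x: "x \<in> ?S"
    then obtain a b where ab: "x = commutator McCool3 a b" "a \<in> lower_central McCool3 n"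
        "b \<in> carrier McCool3" by blast
    have a: "a \<in> carrier McCool3" using ab M3.lower_central_carrier by blast
    have "raises_filtration (Suc n) (commutator (AutoGroup F3) a b)"
      using raises_filtration_commutator[OF _ Suc.IH[OF ab(2)] _ raises_filtration_McCool3[OF ab(3)]] a
          ab(3) McCool3_subset by blast
    then show "x \<in> {\<phi> \<in> carrier McCool3. raises_filtration (Suc n) \<phi>}"
      using x S ab commutator_McCool3[OF a ab(3)] by auto
  qed
  from M3.generate_subgroup_incl[OF this sub]
  show ?case using Suc.prems M3.lower_central_Suc[OF Suc(1)] by blast
qed

interpretation mag: magnus_hom F3 magnus by (rule magnus_hom_magnus)

lemma leading_gen:
  assumes "i \<in> index"
  shows "mag.leading (gr_elem F3 1 (F3_gen i)) = - indet i"
proof -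
  have g: "F3_gen i \<in> lower_central F3 1" using F3_gen_closed[OF assms] by simp
  show ?thesis
    unfolding mag.leading_elem[OF order.refl g] magnus_gen[OF assms]
    by (rule series_eqI) (auto simp: coeff_homogeneous_part indet_unit_inv_def coeff_one coeff_indet
        length_Suc_conv)
qed

text \<open>
  If conjugation by $a \in \gamma_n(F)$ is in $\gamma_{n+1}(M)$, then $(g_i, a) \in \gamma_{n+2}(F)$ for
  every $i$.  So the bracket of the classes of $g_i$ and $a$ vanishes, and the part of degree $n$ of the
  leading terms commutes with all variables.
\<close>

lemma inner_kernel_leading:
  assumes p: "p \<in> carrier (gr F3)" and zero: "gr_map F3 McCool3 inner p = \<one>\<^bsub>gr McCool3\<^esub>"
  shows "mag.leading p = 0"
proof -
  interpret gr: lie_ring "gr F3" by (rule F3.lie_ring_gr)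
  note lead = mag.leading_lie_hom
  interpret A: lie_ring "assoc_lie :: series lie_struct" by (rule lie_ring_assoc_lie)
  interpret lead: group_hom "gr F3" "assoc_lie :: series lie_struct" mag.leading
    using lead by (simp add: lie_hom_def group_hom_def group_hom_axioms_def gr.is_group A.is_group)
  have hp: "homogeneous_part n (mag.leading p) = 0" if n: "n \<ge> 1" for n
  proof -
    let ?a = "F3.gr_rep p n"
    note r = F3.gr_rep[OF p n]
    have a: "?a \<in> carrier F3" using r F3.lower_central_carrier by blast
    have "gr_map F3 McCool3 inner p n = lower_central McCool3 (Suc n)"
      unfolding zero using n by (simp add: M3.one_gr del: lower_central.simps)
    then have "gr_class McCool3 n (inner ?a) = lower_central McCool3 (Suc n)"
      using n by (simp add: gr_map_def)
    then have "inner ?a \<in> lower_central McCool3 (Suc n)"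
      using M3.gr_class_eq_one_iff[OF inner_McCool3[OF a]] by simp
    moreover have "inner (inv\<^bsub>F3\<^esub> ?a) = inv\<^bsub>McCool3\<^esub> inner ?a"
      by (rule group_hom.hom_inv[OF _ a]) (simp add: group_hom_def group_hom_axioms_def inner_hom group_F3
          group_McCool3)
    ultimately have "inner (inv\<^bsub>F3\<^esub> ?a) \<in> lower_central McCool3 (Suc n)" using M3.lower_central_inv by metis
    then have sh: "raises_filtration (Suc n) (inner (inv\<^bsub>F3\<^esub> ?a))"
        by (intro raises_filtration_lower_central) simp
    have comm: "indet i * homogeneous_part n (mag.leading p)
        = homogeneous_part n (mag.leading p) * indet i" if i: "i \<in> index" for i
    proof -
      have g: "F3_gen i \<in> carrier F3" by (rule F3_gen_closed[OF i])
      have "inv\<^bsub>F3\<^esub> F3_gen i \<otimes>\<^bsub>F3\<^esub> inner (inv\<^bsub>F3\<^esub> ?a) (F3_gen i) \<in> lower_central F3 (1 + Suc n)"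
        using sh g unfolding raises_filtration_def by (metis lower_central.simps(2) One_nat_def order.refl)
      then have "commutator F3 (F3_gen i) ?a \<in> lower_central F3 (Suc (1 + n))"
        using g a by (simp add: inner_def commutator_def F3.m_assoc del: lower_central.simps)
      then have "\<lbrakk>gr_elem F3 1 (F3_gen i), gr_elem F3 n ?a\<rbrakk>\<^bsub>gr F3\<^esub> = \<one>\<^bsub>gr F3\<^esub>"
        using F3.gr_elem_lbr[of 1 n "F3_gen i" ?a] F3.gr_elem_eq_one_iff[of "1 + n"
            "commutator F3 (F3_gen i) ?a"] n g r a by simp
      then have "mag.leading \<lbrakk>gr_elem F3 1 (F3_gen i), gr_elem F3 n ?a\<rbrakk>\<^bsub>gr F3\<^esub> = 0"
        using lead.hom_one by simp
      moreover have "mag.leading \<lbrakk>gr_elem F3 1 (F3_gen i), gr_elem F3 n ?a\<rbrakk>\<^bsub>gr F3\<^esub>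
        = \<lbrakk>mag.leading (gr_elem F3 1 (F3_gen i)), mag.leading (gr_elem F3 n ?a)\<rbrakk>\<^bsub>assoc_lie\<^esub>"
        using lead F3.gr_elem_closed[of 1 "F3_gen i"] F3.gr_elem_closed[OF n r(1)] g unfolding lie_hom_def
            by simp
      moreover have "mag.leading (gr_elem F3 n ?a) = homogeneous_part n (mag.leading p)"
      proof -
        have "coeff (mag.leading p) w = coeff (magnus ?a) w" if "length w = n" for w
          using mag.coeff_leading[OF p n r that] .
        then show ?thesis
          unfolding mag.leading_elem[OF n r(1)]
          by (intro series_eqI) (use n in \<open>auto simp: coeff_homogeneous_part coeff_one\<close>)
      qed
      ultimately show ?thesis using leading_gen[OF i] by (simp add: algebra_simps)
    qed
    show ?thesis
      by (rule central_series_zero[OF comm[of 1] comm[of 2]]) (use n in \<open>simp_all add: index_def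
          coeff_homogeneous_part\<close>)
  qed
  show ?thesis
  proof (rule series_eqI)
    fix w :: "nat list"
    show "coeff (mag.leading p) w = coeff 0 w"
    proof (cases "w = []")
      case True
      then show ?thesis by (simp add: mag.leading_def)
    next
      case False
      then have "length w \<ge> 1" by (cases w) auto
      from arg_cong[OF hp[OF this], of "\<lambda>f. coeff f w"] show ?thesis by (simp add: coeff_homogeneous_part)
    qed
  qed
qed

interpretation out: magnus_hom McCool3 outer_unit by (rule magnus_outer_unit)

section \<open>The nine relations\<close>

text \<open>
  The generators of \<^const>\<open>J6\<close> as expressions in arbitrary elements of a Lie ring.
\<close>

definition mccool_relators :: "('a, 'b) lie_struct_scheme \<Rightarrow> (nat \<Rightarrow> 'a) \<Rightarrow> 'a set" where
  "mccool_relators K x = (let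
      y1 = \<lbrakk>x 2, x 1\<rbrakk>\<^bsub>K\<^esub>; y2 = \<lbrakk>x 4, x 3\<rbrakk>\<^bsub>K\<^esub>; y3 = \<lbrakk>x 6, x 5\<rbrakk>\<^bsub>K\<^esub>;
      y5 = \<lbrakk>x 4, x 1\<rbrakk>\<^bsub>K\<^esub>; y6 = \<lbrakk>x 3, x 2\<rbrakk>\<^bsub>K\<^esub>; y7 = \<lbrakk>x 4, x 2\<rbrakk>\<^bsub>K\<^esub>;
      y8 = \<lbrakk>x 5, x 1\<rbrakk>\<^bsub>K\<^esub>; y9 = \<lbrakk>x 6, x 1\<rbrakk>\<^bsub>K\<^esub>; y10 = \<lbrakk>x 5, x 2\<rbrakk>\<^bsub>K\<^esub>;
      y12 = \<lbrakk>x 5, x 3\<rbrakk>\<^bsub>K\<^esub>; y13 = \<lbrakk>x 6, x 3\<rbrakk>\<^bsub>K\<^esub>; y15 = \<lbrakk>x 6, x 4\<rbrakk>\<^bsub>K\<^esub>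
    in {y1, y2, y3,
      y6 \<otimes>\<^bsub>K\<^esub> y7, y7 \<otimes>\<^bsub>K\<^esub> y5, y9 \<otimes>\<^bsub>K\<^esub> y8,
      y10 \<otimes>\<^bsub>K\<^esub> y8, y12 \<otimes>\<^bsub>K\<^esub> y13, y15 \<otimes>\<^bsub>K\<^esub> y13})"

lemma J6_eq: "J6 = gen_lie_ideal L6 (mccool_relators L6 (free_lie_gen {1..6}))"
  unfolding J6_def mccool_relators_def Let_def ..

lemma mccool_relators_closed:
  assumes "nonassoc_ring K" "\<And>i. i \<in> {1..6} \<Longrightarrow> x i \<in> carrier K"
  shows "mccool_relators K x \<subseteq> carrier K"
proof -
  interpret nonassoc_ring K by fact
  have "x 1 \<in> carrier K" "x 2 \<in> carrier K" "x 3 \<in> carrier K" "x 4 \<in> carrier K" "x 5 \<in> carrier K"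
      "x 6 \<in> carrier K"
    using assms(2) by auto
  then show ?thesis unfolding mccool_relators_def Let_def by (auto simp: lbr_closed)
qed

lemma lie_hom_mccool_relators:
  assumes L: "nonassoc_ring L" and f: "f \<in> lie_hom L K" and x: "\<And>i. i \<in> {1..6} \<Longrightarrow> x i \<in> carrier L"
    and y: "\<And>i. i \<in> {1..6} \<Longrightarrow> f (x i) = y i"
  shows "f ` mccool_relators L x = mccool_relators K y"
proof -
  interpret nonassoc_ring L by fact
  have c: "x 1 \<in> carrier L" "x 2 \<in> carrier L" "x 3 \<in> carrier L" "x 4 \<in> carrier L" "x 5 \<in> carrier L"
      "x 6 \<in> carrier L"
    using x by auto
  have e: "f (x 1) = y 1" "f (x 2) = y 2" "f (x 3) = y 3" "f (x 4) = y 4" "f (x 5) = y 5" "f (x 6) = y 6"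
    using y by auto
  have "\<And>a b. a \<in> carrier L \<Longrightarrow> b \<in> carrier L \<Longrightarrow> f \<lbrakk>a, b\<rbrakk>\<^bsub>L\<^esub> = \<lbrakk>f a, f b\<rbrakk>\<^bsub>K\<^esub>"
    "\<And>a b. a \<in> carrier L \<Longrightarrow> b \<in> carrier L \<Longrightarrow> f (a \<otimes>\<^bsub>L\<^esub> b) = f a \<otimes>\<^bsub>K\<^esub> f b"
    using f by (auto simp: lie_hom_def hom_def)
  then show ?thesis
    unfolding mccool_relators_def Let_def by (simp add: c e lbr_closed del: One_nat_def)
qed

definition inner_part :: "('a, 'b) lie_struct_scheme \<Rightarrow> (nat \<Rightarrow> 'a) \<Rightarrow> nat \<Rightarrow> 'a" where
  "inner_part K x i = (if i = 1 then x 1 \<otimes>\<^bsub>K\<^esub> x 2 else if i = 2 then x 3 \<otimes>\<^bsub>K\<^esub> x 4 else x 5 \<otimes>\<^bsub>K\<^esub> x 6)"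

definition outer_part :: "(nat \<Rightarrow> 'a) \<Rightarrow> nat \<Rightarrow> 'a" where
  "outer_part x i = (if i = 1 then x 1 else if i = 2 then x 3 else x 5)"

text \<open>
  The relations say that $x_2, x_6$ commute with $s_2$, that $x_4, x_5$ commute with $s_1$, that $x_1,
      x_3$ commute
  with $s_3$, and that $t_j$ commutes with $s_j$.  Substituting $x_2 = s_1
      - t_1$ and its analogues gives the three brackets
  that need not vanish: $[t_1, s_2] = [s_1, s_2]$, $[t_2, s_1] = [s_2, s_1]$ and $[t_3, s_2] = [s_3, s_2]$.
\<close>

lemma (in lie_ring) mccool_relators_decomposition:
  assumes x: "range x \<subseteq> carrier L" and rel: "mccool_relators L x \<subseteq> {\<one>}"
  defines "H \<equiv> {u \<otimes> v | u v. u \<in> lyndon_span (inner_part L x) index \<and> v \<in> lyndon_span (outer_part x) index}"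
  shows "subgroup H L" and "p \<in> H \<Longrightarrow> q \<in> H \<Longrightarrow> \<lbrakk>p, q\<rbrakk> \<in> H" and "i \<in> {1..6} \<Longrightarrow> x i \<in> H"
proof -
  let ?s = "inner_part L x" and ?t = "outer_part x"
  have c: "x i \<in> carrier L" for i using x by blast
  have s: "range ?s \<subseteq> carrier L" and t: "range ?t \<subseteq> carrier L"
    using c by (auto simp: inner_part_def outer_part_def)
  have sc: "?s i \<in> carrier L" for i using s by blast
  have fin: "finite index" by (simp add: index_def)
  have ind: "1 \<in> index" "2 \<in> index" "3 \<in> index" by (simp_all add: index_def)
  have st: "?s 1 = x 1 \<otimes> x 2" "?s 2 = x 3 \<otimes> x 4" "?s 3 = x 5 \<otimes> x 6" "?t 1 = x 1" "?t 2 = x 3" "?t 3 = x 5"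
    by (simp_all add: inner_part_def outer_part_def)
  have r: "\<lbrakk>x 2, x 1\<rbrakk> = \<one>" "\<lbrakk>x 4, x 3\<rbrakk> = \<one>" "\<lbrakk>x 6, x 5\<rbrakk> = \<one>"
    "\<lbrakk>x 3, x 2\<rbrakk> \<otimes> \<lbrakk>x 4, x 2\<rbrakk> = \<one>" "\<lbrakk>x 4, x 2\<rbrakk> \<otimes> \<lbrakk>x 4, x 1\<rbrakk> = \<one>" "\<lbrakk>x 6, x 1\<rbrakk> \<otimes> \<lbrakk>x 5, x 1\<rbrakk> = \<one>"
    "\<lbrakk>x 5, x 2\<rbrakk> \<otimes> \<lbrakk>x 5, x 1\<rbrakk> = \<one>" "\<lbrakk>x 5, x 3\<rbrakk> \<otimes> \<lbrakk>x 6, x 3\<rbrakk> = \<one>" "\<lbrakk>x 6, x 4\<rbrakk> \<otimes> \<lbrakk>x 6, x 3\<rbrakk> = \<one>"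
    using rel unfolding mccool_relators_def Let_def by auto
  have swap: "\<lbrakk>b, a\<rbrakk> = \<one>" if "\<lbrakk>a, b\<rbrakk> = \<one>" "a \<in> carrier L" "b \<in> carrier L" for a b
    using lbr_antisym[of a b] that by simp
  have comm: "\<lbrakk>x 1, ?s 1\<rbrakk> = \<one>" "\<lbrakk>x 3, ?s 2\<rbrakk> = \<one>" "\<lbrakk>x 5, ?s 3\<rbrakk> = \<one>"
    "\<lbrakk>x 2, ?s 2\<rbrakk> = \<one>" "\<lbrakk>x 4, ?s 1\<rbrakk> = \<one>" "\<lbrakk>x 1, ?s 3\<rbrakk> = \<one>" "\<lbrakk>x 5, ?s 1\<rbrakk> = \<one>" "\<lbrakk>x 3, ?s 3\<rbrakk> = \<one>" "\<lbrakk>x 6, ?s 2\<rbrakk> = \<one>"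
  proof -
    show "\<lbrakk>x 1, ?s 1\<rbrakk> = \<one>" "\<lbrakk>x 3, ?s 2\<rbrakk> = \<one>" "\<lbrakk>x 5, ?s 3\<rbrakk> = \<one>"
      using swap[OF r(1) c c] swap[OF r(2) c c] swap[OF r(3) c c] c
          by (simp_all add: st lbr_add_right lbr_self del: One_nat_def)
    show "\<lbrakk>x 2, ?s 2\<rbrakk> = \<one>"
      by (rule swap[OF _ sc c]) (use r(4) c in \<open>simp add: st lbr_add_left del: One_nat_def\<close>)
    show "\<lbrakk>x 4, ?s 1\<rbrakk> = \<one>" "\<lbrakk>x 5, ?s 1\<rbrakk> = \<one>" "\<lbrakk>x 6, ?s 2\<rbrakk> = \<one>"
      using r(5,7,9) c by (simp_all add: st lbr_add_right lbr_closed m_comm del: One_nat_def)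
    show "\<lbrakk>x 1, ?s 3\<rbrakk> = \<one>" "\<lbrakk>x 3, ?s 3\<rbrakk> = \<one>"
      by (rule swap[OF _ sc c], use r(6,8) c in \<open>simp add: st lbr_add_left lbr_closed m_comm del: One_nat_def\<close>)+
  qed
  have via: "\<lbrakk>a, v\<rbrakk> = \<lbrakk>a \<otimes> b, v\<rbrakk>" if "\<lbrakk>b, v\<rbrakk> = \<one>" "a \<in> carrier L" "b \<in> carrier L" "v \<in> carrier L" for a b v
    using that by (simp add: lbr_add_left lbr_closed)
  \<comment> \<open>Replace $t_j$ by $s_j$: the difference commutes with the second entry.\<close>
  have mixed: "\<lbrakk>x 1, ?s 2\<rbrakk> = \<lbrakk>?s 1, ?s 2\<rbrakk>" "\<lbrakk>x 3, ?s 1\<rbrakk> = \<lbrakk>?s 2, ?s 1\<rbrakk>" "\<lbrakk>x 5, ?s 2\<rbrakk> = \<lbrakk>?s 3, ?s 2\<rbrakk>"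
    using via[OF comm(4) c[of 1] c sc] via[OF comm(5) c[of 3] c sc] via[OF comm(9) c[of 5] c sc]
        by (simp_all only: st)
  note sub_s = subgroup_lyndon_span[OF s, of index] and sub_t = subgroup_lyndon_span[OF t, of index]
  have s_mem: "?s i \<in> lyndon_span ?s index" if "i \<in> index" for i
    using tree_eval_in_lyndon_span[OF s fin, of "Gen i"] that by simp
  have t_mem: "?t i \<in> lyndon_span ?t index" if "i \<in> index" for i
    using tree_eval_in_lyndon_span[OF t fin, of "Gen i"] that by simp
  have one: "\<one> \<in> lyndon_span ?s index" using subgroup.one_closed[OF sub_s] .
  have gen: "\<lbrakk>?t j, ?s i\<rbrakk> \<in> lyndon_span ?s index" if i: "i \<in> index" and j: "j \<in> index" for i j
  proof -
    have "i = 1 \<or> i = 2 \<or> i = 3" "j = 1 \<or> j = 2 \<or> j = 3" using i j by (simp_all add: index_def)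
    then consider "j = 1 \<and> i = 1" | "j = 1 \<and> i = 2" | "j = 1 \<and> i = 3" | "j = 2 \<and> i = 1" | "j = 2 \<and> i = 2"
      | "j = 2 \<and> i = 3" | "j = 3 \<and> i = 1" | "j = 3 \<and> i = 2" | "j = 3 \<and> i = 3" by auto
    then show ?thesis
      using comm one mixed lyndon_span_lbr[OF s fin s_mem s_mem] ind
      by cases (simp_all only: st(4-6))
  qed
  show sub: "subgroup H L" unfolding H_def by (rule span_sum_closed(1)[OF s t fin gen])
  show "\<lbrakk>p, q\<rbrakk> \<in> H" if "p \<in> H" "q \<in> H"
    using span_sum_closed(2)[OF s t fin gen, of p q] that unfolding H_def by blast
  have H_s: "u \<in> H" if "u \<in> lyndon_span ?s index" for u
  proof -
    have "u \<otimes> \<one> \<in> H" unfolding H_def using that subgroup.one_closed[OF sub_t] by blast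
    then show ?thesis using that subgroup.subset[OF sub_s] by auto
  qed
  have H_t: "u \<in> H" if "u \<in> lyndon_span ?t index" for u
  proof -
    have "\<one> \<otimes> u \<in> H" unfolding H_def using that one by blast
    then show ?thesis using that subgroup.subset[OF sub_t] by auto
  qed
  have odd: "x 1 \<in> H" "x 3 \<in> H" "x 5 \<in> H"
    using H_t[OF t_mem[OF ind(1)]] H_t[OF t_mem[OF ind(2)]] H_t[OF t_mem[OF ind(3)]] by (simp_all only: st)
  have diff: "b \<in> H" if "a \<in> H" "a \<otimes> b \<in> H" "a \<in> carrier L" "b \<in> carrier L" for a b
    using subgroup.m_closed[OF sub subgroup.m_inv_closed[OF sub that(1)] that(2)] that(3,4)
        by (simp flip: m_assoc)
  have even: "x 2 \<in> H" "x 4 \<in> H" "x 6 \<in> H"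
    using diff[OF odd(1) _ c c, of 2] diff[OF odd(2) _ c c, of 4] diff[OF odd(3) _ c c, of 6]
      H_s[OF s_mem[OF ind(1)]] H_s[OF s_mem[OF ind(2)]] H_s[OF s_mem[OF ind(3)]] by (simp_all only: st)
  show "x i \<in> H" if "i \<in> {1..6}"
  proof -
    have "i = 1 \<or> i = 2 \<or> i = 3 \<or> i = 4 \<or> i = 5 \<or> i = 6" using that by auto
    then show ?thesis using odd even by auto
  qed
qed

section \<open>The relations in the associated graded Lie ring\<close>

definition chi_gen :: "nat \<Rightarrow> (nat \<times> bool) list set \<Rightarrow> (nat \<times> bool) list set" where
  "chi_gen k = (if k = 1 then chi 2 1 else if k = 2 then chi 3 1 else if k = 3 then chi 1 2
     else if k = 4 then chi 3 2 else if k = 5 then chi 2 3 else chi 1 3)"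

lemma chi_gen_closed: "chi_gen k \<in> carrier McCool3"
  unfolding chi_gen_def by (auto intro!: chi_McCool3 simp: index_def)

lemma chi_gen_range: "chi_set \<subseteq> chi_gen ` {1..6}"
proof
  fix \<phi> assume "\<phi> \<in> chi_set"
  then obtain i j where ij: "\<phi> = chi i j" "i \<in> index" "j \<in> index" "i \<noteq> j" by (auto simp: chi_set_def)
  then have "\<phi> \<in> {chi_gen 1, chi_gen 2, chi_gen 3, chi_gen 4, chi_gen 5, chi_gen 6}"
    by (auto simp: index_def chi_gen_def)
  then show "\<phi> \<in> chi_gen ` {1..6}" by auto
qed

definition gr_gen :: "nat \<Rightarrow> nat \<Rightarrow> ((nat \<times> bool) list set \<Rightarrow> (nat \<times> bool) list set) set" where
  "gr_gen k = gr_elem McCool3 1 (chi_gen k)"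

lemma gr_gen_closed: "gr_gen k \<in> carrier (gr McCool3)"
  unfolding gr_gen_def by (rule M3.gr_elem_closed) (simp_all add: chi_gen_closed)

text \<open>
  The elements $s_i$ are the classes of the inner automorphisms by $g_i^{-1}$; in degree one,
  $\chi_{ij}\chi_{kj}$ has the class of a sum.  An index other than 1 and 2 is read as 3, as in
  \<^const>\<open>inner_part\<close>.
\<close>

lemma inner_part_gr_gen:
  "inner_part (gr McCool3) gr_gen i = gr_map F3 McCool3 inner (gr_elem F3 1 (inv\<^bsub>F3\<^esub> F3_gen (if i
      = 1 then 1 else if i = 2 then 2 else 3)))"
    (is "_ = gr_map _ _ _ (gr_elem F3 1 (inv\<^bsub>F3\<^esub> F3_gen ?j))")
proof -
  have ind: "1 \<in> index" "2 \<in> index" "3 \<in> index" by (simp_all add: index_def)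
  have j: "?j \<in> index" using ind by simp
  have g: "inv\<^bsub>F3\<^esub> F3_gen ?j \<in> lower_central F3 1" using F3_gen_closed[OF j] by simp
  have mult: "gr_gen k \<otimes>\<^bsub>gr McCool3\<^esub> gr_gen l = gr_elem McCool3 1 (chi_gen k \<otimes>\<^bsub>McCool3\<^esub> chi_gen l)" for k l
    unfolding gr_gen_def by (rule M3.gr_elem_mult) (simp_all add: chi_gen_closed)
  have "gr_map F3 McCool3 inner (gr_elem F3 1 (inv\<^bsub>F3\<^esub> F3_gen ?j))
      = gr_elem McCool3 1 (inner (inv\<^bsub>F3\<^esub> F3_gen ?j))"
    by (rule gr_map_elem[OF group_F3 group_McCool3 inner_hom _ g]) simp
  then show ?thesis
    using inner_chi[of 2 3 1] inner_chi[of 1 3 2] inner_chi[of 2 1 3] ind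
    by (auto simp: inner_part_def mult chi_gen_def)
qed

lemma gr_commute:
  assumes "\<phi> \<in> carrier McCool3" "\<psi> \<in> carrier McCool3" "\<phi> \<otimes>\<^bsub>AutoGroup F3\<^esub> \<psi> = \<psi> \<otimes>\<^bsub>AutoGroup F3\<^esub> \<phi>"
  shows "\<lbrakk>gr_elem McCool3 1 \<phi>, gr_elem McCool3 1 \<psi>\<rbrakk>\<^bsub>gr McCool3\<^esub> = \<one>\<^bsub>gr McCool3\<^esub>"
proof -
  have c: "\<phi> \<in> carrier (AutoGroup F3)" "\<psi> \<in> carrier (AutoGroup F3)" using assms(1,2) McCool3_subset by auto
  have "commutator (AutoGroup F3) \<phi> \<psi> = inv\<^bsub>AutoGroup F3\<^esub> (\<psi> \<otimes>\<^bsub>AutoGroup F3\<^esub> \<phi>) \<otimes>\<^bsub>AutoGroup F3\<^esub> (\<phi>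
      \<otimes>\<^bsub>AutoGroup F3\<^esub> \<psi>)"
    using c by (simp add: commutator_def Aut.inv_mult_group Aut.m_assoc)
  then have "commutator McCool3 \<phi> \<psi> = \<one>\<^bsub>McCool3\<^esub>"
    using c assms by (simp add: commutator_McCool3)
  then show ?thesis
    using M3.gr_elem_lbr[of 1 1 \<phi> \<psi>] assms M3.gr_elem_one[of "1 + 1"] by simp
qed

lemma chi_commute_same:
  assumes i: "i \<in> index" and k: "k \<in> index" and j: "j \<in> index" and ne: "i \<noteq> j" "k \<noteq> j" "i \<noteq> k"
  shows "chi i j \<otimes>\<^bsub>AutoGroup F3\<^esub> chi k j = chi k j \<otimes>\<^bsub>AutoGroup F3\<^esub> chi i j"
  using inner_chi[OF i k j ne] inner_chi[OF k i j ne(2,1) ne(3)[symmetric]] by simp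

text \<open>
  $\phi$ conjugates the inner automorphism by $w$ to the inner automorphism by $\phi(w)$.
\<close>

lemma inner_commute:
  assumes \<phi>: "\<phi> \<in> carrier (AutoGroup F3)" and j: "j \<in> index" and fix_j: "\<phi> (F3_gen j) = F3_gen j"
  shows "inner (inv\<^bsub>F3\<^esub> F3_gen j) \<otimes>\<^bsub>AutoGroup F3\<^esub> \<phi> = \<phi> \<otimes>\<^bsub>AutoGroup F3\<^esub> inner (inv\<^bsub>F3\<^esub> F3_gen j)"
proof (rule Aut_eqI)
  interpret \<phi>: group_hom F3 F3 \<phi> by (rule Aut_hom[OF \<phi>])
  have g: "F3_gen j \<in> carrier F3" by (rule F3_gen_closed[OF j])
  have ic: "inner (inv\<^bsub>F3\<^esub> F3_gen j) \<in> carrier (AutoGroup F3)" using inner_auto g by simp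
  show "inner (inv\<^bsub>F3\<^esub> F3_gen j) \<otimes>\<^bsub>AutoGroup F3\<^esub> \<phi> \<in> carrier (AutoGroup F3)"
    "\<phi> \<otimes>\<^bsub>AutoGroup F3\<^esub> inner (inv\<^bsub>F3\<^esub> F3_gen j) \<in> carrier (AutoGroup F3)"
    using \<phi> ic by simp_all
  fix i assume "i \<in> index"
  then have gi: "F3_gen i \<in> carrier F3" by (rule F3_gen_closed)
  show "(inner (inv\<^bsub>F3\<^esub> F3_gen j) \<otimes>\<^bsub>AutoGroup F3\<^esub> \<phi>) (F3_gen i) = (\<phi>
      \<otimes>\<^bsub>AutoGroup F3\<^esub> inner (inv\<^bsub>F3\<^esub> F3_gen j)) (F3_gen i)"
    unfolding Aut_mult[OF ic \<phi> gi] Aut_mult[OF \<phi> ic gi] using g gi fix_j by (simp add: inner_def)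
qed

lemma chi_inner_commute:
  assumes i: "i \<in> index" and k: "k \<in> index" and j: "j \<in> index" and ne: "i \<noteq> j" "k \<noteq> j" "i \<noteq> k"
    and ab: "a \<in> index" "b \<in> index" "a \<noteq> b" "a \<noteq> j"
  shows "\<lbrakk>gr_elem McCool3 1 (chi i j) \<otimes>\<^bsub>gr McCool3\<^esub> gr_elem McCool3 1 (chi k j), gr_elem McCool3 1 (chi a
      b)\<rbrakk>\<^bsub>gr McCool3\<^esub> = \<one>\<^bsub>gr McCool3\<^esub>"
    and "\<lbrakk>gr_elem McCool3 1 (chi a b), gr_elem McCool3 1 (chi i j)
        \<otimes>\<^bsub>gr McCool3\<^esub> gr_elem McCool3 1 (chi k j)\<rbrakk>\<^bsub>gr McCool3\<^esub> = \<one>\<^bsub>gr McCool3\<^esub>"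
proof -
  have m: "chi i j \<in> carrier McCool3" "chi k j \<in> carrier McCool3" "chi a b \<in> carrier McCool3"
    using chi_McCool3 assms by auto
  have prod: "gr_elem McCool3 1 (chi i j) \<otimes>\<^bsub>gr McCool3\<^esub> gr_elem McCool3 1 (chi k j)
      = gr_elem McCool3 1 (inner (inv\<^bsub>F3\<^esub> F3_gen j))"
    using M3.gr_elem_mult[of 1 "chi i j" "chi k j"] m inner_chi[OF i k j ne] by simp
  have im: "inner (inv\<^bsub>F3\<^esub> F3_gen j) \<in> carrier McCool3" using inner_McCool3 F3_gen_closed[OF j] by simp
  have comm: "inner (inv\<^bsub>F3\<^esub> F3_gen j) \<otimes>\<^bsub>AutoGroup F3\<^esub> chi a b = chi a b
      \<otimes>\<^bsub>AutoGroup F3\<^esub> inner (inv\<^bsub>F3\<^esub> F3_gen j)"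
    by (rule inner_commute[OF chi_auto[OF ab(1-3)] j chi_fixed[OF ab(1-3) j]]) (use ab(4) in simp)
  show "\<lbrakk>gr_elem McCool3 1 (chi i j) \<otimes>\<^bsub>gr McCool3\<^esub> gr_elem McCool3 1 (chi k j), gr_elem McCool3 1 (chi a
      b)\<rbrakk>\<^bsub>gr McCool3\<^esub> = \<one>\<^bsub>gr McCool3\<^esub>"
    unfolding prod by (rule gr_commute[OF im m(3) comm])
  show "\<lbrakk>gr_elem McCool3 1 (chi a b), gr_elem McCool3 1 (chi i j)
      \<otimes>\<^bsub>gr McCool3\<^esub> gr_elem McCool3 1 (chi k j)\<rbrakk>\<^bsub>gr McCool3\<^esub> = \<one>\<^bsub>gr McCool3\<^esub>"
    unfolding prod by (rule gr_commute[OF m(3) im comm[symmetric]])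
qed

lemma gr_mccool_relators: "mccool_relators (gr McCool3) gr_gen \<subseteq> {\<one>\<^bsub>gr McCool3\<^esub>}"
proof -
  interpret gr: lie_ring "gr McCool3" by (rule M3.lie_ring_gr)
  let ?x = gr_gen
  have c: "?x k \<in> carrier (gr McCool3)" for k by (rule gr_gen_closed)
  have ind: "1 \<in> index" "2 \<in> index" "3 \<in> index" by (simp_all add: index_def)
  have x: "?x 1 = gr_elem McCool3 1 (chi 2 1)" "?x 2 = gr_elem McCool3 1 (chi 3 1)"
      "?x 3 = gr_elem McCool3 1 (chi 1 2)"
    "?x 4 = gr_elem McCool3 1 (chi 3 2)" "?x 5 = gr_elem McCool3 1 (chi 2 3)"
        "?x 6 = gr_elem McCool3 1 (chi 1 3)"
    by (simp_all add: gr_gen_def chi_gen_def)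
  have m: "chi i j \<in> carrier McCool3" if "i \<in> index" "j \<in> index" "i \<noteq> j" for i j using chi_McCool3 that by blast
  have same: "\<lbrakk>?x 2, ?x 1\<rbrakk>\<^bsub>gr McCool3\<^esub> = \<one>\<^bsub>gr McCool3\<^esub>" "\<lbrakk>?x 4, ?x 3\<rbrakk>\<^bsub>gr McCool3\<^esub> = \<one>\<^bsub>gr McCool3\<^esub>"
    "\<lbrakk>?x 6, ?x 5\<rbrakk>\<^bsub>gr McCool3\<^esub> = \<one>\<^bsub>gr McCool3\<^esub>"
    unfolding x by (rule gr_commute[OF m m chi_commute_same]; use ind in simp)+
  have "\<lbrakk>?x 3 \<otimes>\<^bsub>gr McCool3\<^esub> ?x 4, ?x 2\<rbrakk>\<^bsub>gr McCool3\<^esub> = \<one>\<^bsub>gr McCool3\<^esub>"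
    "\<lbrakk>?x 5 \<otimes>\<^bsub>gr McCool3\<^esub> ?x 6, ?x 1\<rbrakk>\<^bsub>gr McCool3\<^esub> = \<one>\<^bsub>gr McCool3\<^esub>"
    "\<lbrakk>?x 5 \<otimes>\<^bsub>gr McCool3\<^esub> ?x 6, ?x 3\<rbrakk>\<^bsub>gr McCool3\<^esub> = \<one>\<^bsub>gr McCool3\<^esub>"
    unfolding x by (rule chi_inner_commute(1); use ind in simp)+
  moreover have "\<lbrakk>?x 4, ?x 1 \<otimes>\<^bsub>gr McCool3\<^esub> ?x 2\<rbrakk>\<^bsub>gr McCool3\<^esub> = \<one>\<^bsub>gr McCool3\<^esub>"
    "\<lbrakk>?x 5, ?x 1 \<otimes>\<^bsub>gr McCool3\<^esub> ?x 2\<rbrakk>\<^bsub>gr McCool3\<^esub> = \<one>\<^bsub>gr McCool3\<^esub>"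
    "\<lbrakk>?x 6, ?x 3 \<otimes>\<^bsub>gr McCool3\<^esub> ?x 4\<rbrakk>\<^bsub>gr McCool3\<^esub> = \<one>\<^bsub>gr McCool3\<^esub>"
    unfolding x by (rule chi_inner_commute(2); use ind in simp)+
  ultimately have "\<lbrakk>?x 3, ?x 2\<rbrakk>\<^bsub>gr McCool3\<^esub> \<otimes>\<^bsub>gr McCool3\<^esub> \<lbrakk>?x 4, ?x 2\<rbrakk>\<^bsub>gr McCool3\<^esub> = \<one>\<^bsub>gr McCool3\<^esub>"
    "\<lbrakk>?x 6, ?x 1\<rbrakk>\<^bsub>gr McCool3\<^esub> \<otimes>\<^bsub>gr McCool3\<^esub> \<lbrakk>?x 5, ?x 1\<rbrakk>\<^bsub>gr McCool3\<^esub> = \<one>\<^bsub>gr McCool3\<^esub>"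
    "\<lbrakk>?x 5, ?x 3\<rbrakk>\<^bsub>gr McCool3\<^esub> \<otimes>\<^bsub>gr McCool3\<^esub> \<lbrakk>?x 6, ?x 3\<rbrakk>\<^bsub>gr McCool3\<^esub> = \<one>\<^bsub>gr McCool3\<^esub>"
    "\<lbrakk>?x 4, ?x 2\<rbrakk>\<^bsub>gr McCool3\<^esub> \<otimes>\<^bsub>gr McCool3\<^esub> \<lbrakk>?x 4, ?x 1\<rbrakk>\<^bsub>gr McCool3\<^esub> = \<one>\<^bsub>gr McCool3\<^esub>"
    "\<lbrakk>?x 5, ?x 2\<rbrakk>\<^bsub>gr McCool3\<^esub> \<otimes>\<^bsub>gr McCool3\<^esub> \<lbrakk>?x 5, ?x 1\<rbrakk>\<^bsub>gr McCool3\<^esub> = \<one>\<^bsub>gr McCool3\<^esub>"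
    "\<lbrakk>?x 6, ?x 4\<rbrakk>\<^bsub>gr McCool3\<^esub> \<otimes>\<^bsub>gr McCool3\<^esub> \<lbrakk>?x 6, ?x 3\<rbrakk>\<^bsub>gr McCool3\<^esub> = \<one>\<^bsub>gr McCool3\<^esub>"
    using c by (simp_all add: gr.lbr_add_left gr.lbr_add_right gr.lbr_closed gr.m_comm)
  with same show ?thesis unfolding mccool_relators_def Let_def by simp
qed

section \<open>Linear independence of the Lyndon brackets\<close>

lemma lie_eval_zero: "lie_eval assoc_lie (\<lambda>_. 0 :: series) p = 0"
proof -
  interpret A: lie_ring "assoc_lie :: series lie_struct" by (rule lie_ring_assoc_lie)
  have r: "range (\<lambda>_. 0 :: series) \<subseteq> carrier assoc_lie" by simp
  have tree: "tree_eval assoc_lie (\<lambda>_. 0 :: series) t = 0" for t :: "'a magma" by (induction t) simp_all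
  have inv: "inv\<^bsub>assoc_lie\<^esub> (0 :: series) = 0" using A.inv_one by simp
  have "Poly_Mapping.keys p \<subseteq> UNIV" by simp
  then show ?thesis
    by (induction p rule: frag_induction)
       (simp_all add: A.lie_eval_simps[OF r] A.lie_eval_frag_of[OF r] tree inv)
qed

text \<open>
  The leading terms under \<^const>\<open>outer_unit\<close> vanish on the $s_i$ and send $t_j$ to $X_j$, which gives
  $r = 0$.  What remains is the image of a combination of brackets in the associated graded ring of $F$, and its
  leading terms under \<^const>\<open>magnus\<close> vanish, which gives $p = 0$.
\<close>

lemma gr_McCool3_independence:
  assumes p: "Poly_Mapping.keys p \<subseteq> {t. lyndon t \<and> set (foliage t) \<subseteq> index}"
    and r: "Poly_Mapping.keys r \<subseteq> {t. lyndon t \<and> set (foliage t) \<subseteq> index}"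
    and zero: "lie_eval (gr McCool3) (inner_part (gr McCool3) gr_gen) p \<otimes>\<^bsub>gr McCool3\<^esub>
      lie_eval (gr McCool3) (outer_part gr_gen) r = \<one>\<^bsub>gr McCool3\<^esub>"
  shows "p = 0" "r = 0"
proof -
  let ?K = "gr McCool3" and ?s = "inner_part (gr McCool3) gr_gen" and ?t = "outer_part gr_gen"
  interpret A: lie_ring "assoc_lie :: series lie_struct" by (rule lie_ring_assoc_lie)
  interpret K: lie_ring ?K by (rule M3.lie_ring_gr)
  interpret gF: lie_ring "gr F3" by (rule F3.lie_ring_gr)
  have s: "range ?s \<subseteq> carrier ?K" and t: "range ?t \<subseteq> carrier ?K"
    using gr_gen_closed by (auto simp: inner_part_def outer_part_def)
  have ind: "1 \<in> index" "2 \<in> index" "3 \<in> index" by (simp_all add: index_def)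
  have indet_r: "range indet \<subseteq> carrier assoc_lie" by simp
  let ?j = "\<lambda>i :: nat. if i = 1 then 1 else if i = 2 then 2 else (3 :: nat)"
  have j: "?j i \<in> index" for i using ind by simp
  note lead = out.leading_lie_hom
  interpret lead: group_hom ?K "assoc_lie :: series lie_struct" out.leading
    using lead by (simp add: lie_hom_def group_hom_def group_hom_axioms_def K.is_group A.is_group)
  have lead_s: "out.leading (?s i) = 0" for i
  proof -
    have g: "inv\<^bsub>F3\<^esub> F3_gen (?j i) \<in> lower_central F3 1" "inv\<^bsub>F3\<^esub> F3_gen (?j i) \<in> carrier F3"
      using F3_gen_closed[OF j[of i]] by simp_all
    have m: "inner (inv\<^bsub>F3\<^esub> F3_gen (?j i)) \<in> lower_central McCool3 1" using inner_McCool3[OF g(2)] by simp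
    have e: "?s i = gr_elem McCool3 1 (inner (inv\<^bsub>F3\<^esub> F3_gen (?j i)))"
      unfolding inner_part_gr_gen by (rule gr_map_elem[OF group_F3 group_McCool3 inner_hom _ g(1)]) simp
    have u: "outer_unit (inner (inv\<^bsub>F3\<^esub> F3_gen a)) = 1" if abc: "a \<in> index" "b \<in> index" "c \<in> index"
        "b \<noteq> a" "c \<noteq> a" "b \<noteq> c" for a b c
    proof -
      have "chi_sign b a + chi_sign c a = 0" using abc by (auto simp: index_def chi_sign_def)
      then show ?thesis
        unfolding inner_chi[OF abc(2,3,1,4,5,6)]
        using out.mu_mult[OF chi_McCool3[OF abc(2,1,4)] chi_McCool3[OF abc(3,1,5)]]
          outer_unit_chi[OF abc(2,1,4)] outer_unit_chi[OF abc(3,1,5)]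
        by (simp add: chi_unit_def indet_power_add indet_power_simps)
    qed
    have "outer_unit (inner (inv\<^bsub>F3\<^esub> F3_gen (?j i))) = 1"
      using u[of 1 2 3] u[of 2 1 3] u[of 3 1 2] ind by simp
    then show ?thesis
      unfolding e out.leading_elem[OF order.refl m] by (simp add: homogeneous_part_order)
  qed
  have lead_t: "out.leading (?t i) = indet i" if i: "i \<in> index" for i
  proof -
    \<comment> \<open>The chosen generator with index $i$ is $\chi_{21}$, $\chi_{12}$ or $\chi_{23}$.\<close>
    define a where "a = (if i = 2 then 1 else (2 :: nat))"
    have a: "a \<in> index" "a \<noteq> i" using i ind by (auto simp: a_def)
    have sgn: "chi_sign a i = 1" using i by (auto simp: index_def a_def chi_sign_def)
    have e: "?t i = gr_elem McCool3 1 (chi a i)"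
      using i by (auto simp: index_def a_def outer_part_def gr_gen_def chi_gen_def)
    have m: "chi a i \<in> lower_central McCool3 1" using chi_McCool3[OF a(1) i a(2)] by simp
    show ?thesis
      unfolding e out.leading_elem[OF order.refl m] outer_unit_chi[OF a(1) i a(2)] chi_unit_def sgn
          indet_power_simps
      by (rule series_eqI) (auto simp: coeff_homogeneous_part indet_unit_def coeff_indet)
  qed
  have "out.leading (lie_eval ?K ?s p) = lie_eval assoc_lie (\<lambda>i. out.leading (?s i)) p"
    by (rule lie_eval_lie_hom[OF K.nonassoc_ring_axioms A.nonassoc_ring_axioms lead s])
  then have 1: "out.leading (lie_eval ?K ?s p) = 0" by (simp add: lead_s lie_eval_zero)
  have "out.leading (lie_eval ?K ?t r) = lie_eval assoc_lie (\<lambda>i. out.leading (?t i)) r"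
    by (rule lie_eval_lie_hom[OF K.nonassoc_ring_axioms A.nonassoc_ring_axioms lead t])
  also have "\<dots> = lie_eval assoc_lie indet r"
    by (rule A.lie_eval_cong[OF _ indet_r r lead_t]) simp
  finally have 2: "out.leading (lie_eval ?K ?t r) = lie_eval assoc_lie indet r" .
  have "out.leading (lie_eval ?K ?s p) + out.leading (lie_eval ?K ?t r) = 0"
    using arg_cong[OF zero, of out.leading] lead.hom_one lead.hom_mult[OF K.lie_eval_simps(1)[OF s]
        K.lie_eval_simps(1)[OF t]] by simp
  then have "lie_eval assoc_lie indet r = 0" using 1 2 by simp
  with r show r0: "r = 0" by (intro lyndon_eval_injective) auto
  have s_zero: "lie_eval ?K ?s p = \<one>\<^bsub>?K\<^esub>"
    using zero K.lie_eval_simps(1)[OF s, of p] by (simp add: r0 K.lie_eval_simps(3)[OF t])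
  define z where "z i = gr_elem F3 1 (inv\<^bsub>F3\<^esub> F3_gen (?j i))" for i
  have zl: "inv\<^bsub>F3\<^esub> F3_gen (?j i) \<in> lower_central F3 1" for i using F3_gen_closed[OF j[of i]] by simp
  have z: "range z \<subseteq> carrier (gr F3)"
    using F3.gr_elem_closed[OF order.refl zl] by (auto simp: z_def)
  have "gr_map F3 McCool3 inner (lie_eval (gr F3) z p) = lie_eval ?K (\<lambda>i. gr_map F3 McCool3 inner (z i)) p"
    by (rule lie_eval_lie_hom[OF gF.nonassoc_ring_axioms K.nonassoc_ring_axioms gr_map_lie_hom[OF group_F3
        group_McCool3 inner_hom] z])
  also have "(\<lambda>i. gr_map F3 McCool3 inner (z i)) = ?s"
    by (rule ext) (simp only: z_def inner_part_gr_gen)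
  finally have "mag.leading (lie_eval (gr F3) z p) = 0"
    using s_zero by (intro inner_kernel_leading gF.lie_eval_simps(1)[OF z]) simp
  moreover have "mag.leading (lie_eval (gr F3) z p) = lie_eval assoc_lie (\<lambda>i. mag.leading (z i)) p"
    by (rule lie_eval_lie_hom[OF gF.nonassoc_ring_axioms A.nonassoc_ring_axioms mag.leading_lie_hom z])
  moreover have "\<dots> = lie_eval assoc_lie indet p"
  proof (rule A.lie_eval_cong[OF _ indet_r p])
    fix i assume i: "i \<in> index"
    then have ji: "?j i = i" by (auto simp: index_def)
    have g: "F3_gen i \<in> lower_central F3 1" "F3_gen i \<in> carrier F3" using F3_gen_closed[OF i] by simp_all
    have "magnus (inv\<^bsub>F3\<^esub> F3_gen i) = magnus (inv\<^bsub>F3\<^esub> F3_gen i) * (indet_unit_inv i * indet_unit i)"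
      by (simp add: indet_unit_inv)
    also have "\<dots> = indet_unit i"
      using mag.mu_inv(1)[OF g(2)] magnus_gen[OF i] by (simp flip: mult.assoc)
    finally have "magnus (inv\<^bsub>F3\<^esub> F3_gen i) = indet_unit i" .
    then show "mag.leading (z i) = indet i"
      unfolding z_def ji mag.leading_elem[OF order.refl F3.lower_central_inv[OF g(1)]]
      by (intro series_eqI) (auto simp: coeff_homogeneous_part indet_unit_def coeff_indet)
  qed simp
  ultimately have "lie_eval assoc_lie indet p = 0" by simp
  with p show "p = 0" by (intro lyndon_eval_injective) auto
qed

section \<open>The isomorphism\<close>

theorem theorem3:
  shows "lie_isomorphic (lie_quot L6 J6) (gr McCool3) \<and> torsion_free (gr McCool3)"
proof -
  let ?Q = "lie_quot L6 J6" and ?K = "gr McCool3" and ?g = "free_lie_gen {1..6}"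
  interpret L: lie_ring L6 unfolding L6_def by (rule lie_ring_free_lie)
  interpret K: lie_ring ?K by (rule M3.lie_ring_gr)
  have g: "?g i \<in> carrier L6" if "i \<in> {1..6}" for i
    unfolding L6_def using that by (rule free_lie_gen_closed)
  have rel_closed: "mccool_relators L6 ?g \<subseteq> carrier L6"
    by (rule mccool_relators_closed[OF L.nonassoc_ring_axioms]) (rule g)
  have J: "lie_ideal J6 L6" "mccool_relators L6 ?g \<subseteq> J6"
    using L.lie_ideal_gen[OF rel_closed] unfolding J6_eq by blast+
  interpret Q: lie_ring ?Q by (rule L.lie_ring_lie_quot[OF J(1) L.lie_relators_trivial[OF J(1)]])
  have q: "(\<lambda>a. J6 #>\<^bsub>L6\<^esub> a) \<in> lie_hom L6 ?Q" by (rule L.quot_map_lie_hom[OF J(1)])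
  define x where "x i = (if i \<in> {1..6} then J6 #>\<^bsub>L6\<^esub> ?g i else \<one>\<^bsub>?Q\<^esub>)" for i
  have xc: "range x \<subseteq> carrier ?Q"
  proof -
    have "J6 #>\<^bsub>L6\<^esub> ?g i \<in> carrier ?Q" if "i \<in> {1..6}" for i
      unfolding carrier_lie_quot using g[OF that] by (rule imageI)
    then show ?thesis using Q.one_closed unfolding x_def by auto
  qed
  have x_rel: "mccool_relators ?Q x \<subseteq> {\<one>\<^bsub>?Q\<^esub>}"
  proof -
    have "mccool_relators ?Q x = (\<lambda>a. J6 #>\<^bsub>L6\<^esub> a) ` mccool_relators L6 ?g"
      by (rule lie_hom_mccool_relators[OF L.nonassoc_ring_axioms q, symmetric]) (simp_all add: x_def g
          del: One_nat_def)
    moreover have "J6 #>\<^bsub>L6\<^esub> a = \<one>\<^bsub>?Q\<^esub>" if "a \<in> J6" for a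
      using that J(1) subgroup.subset[of J6 L6] L.coset_join2[of a J6]
          unfolding lie_ideal_def one_lie_quot by blast
    ultimately show ?thesis using J(2) by auto
  qed
  have K_rng: "range gr_gen \<subseteq> carrier ?K" using gr_gen_closed by blast
  obtain f where f: "f \<in> lie_hom L6 ?K" "\<And>i. i \<in> {1..6} \<Longrightarrow> f (?g i) = gr_gen i"
    unfolding L6_def using free_lie_universal[OF K.lie_ring_axioms K_rng] by metis
  have "J6 \<subseteq> {a \<in> carrier L6. f a = \<one>\<^bsub>?K\<^esub>}"
    unfolding J6_eq
  proof (rule L.gen_lie_ideal_least[OF L.lie_hom_kernel_ideal[OF K.nonassoc_ring_axioms f(1)]])
    show "mccool_relators L6 ?g \<subseteq> {a \<in> carrier L6. f a = \<one>\<^bsub>?K\<^esub>}"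
    proof -
      have "f ` mccool_relators L6 ?g = mccool_relators ?K gr_gen"
        by (rule lie_hom_mccool_relators[OF L.nonassoc_ring_axioms f(1)]) (rule g f(2); assumption)+
      then show ?thesis using rel_closed gr_mccool_relators by blast
    qed
  qed
  then have ker: "f a = \<one>\<^bsub>?K\<^esub>" if "a \<in> J6" for a using that by blast
  obtain h where h: "h \<in> lie_hom ?Q ?K" "\<And>a. a \<in> carrier L6 \<Longrightarrow> h (J6 #>\<^bsub>L6\<^esub> a) = f a"
    using L.lie_quot_universal[OF J(1) K.nonassoc_ring_axioms f(1) ker] by metis
  interpret h: group_hom ?Q ?K h
    using h(1) by (simp add: lie_hom_def group_hom_def group_hom_axioms_def Q.is_group K.is_group)
  have hx: "h (x i) = gr_gen i" if "i \<in> {1..6}" for i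
    using that h(2)[OF g[OF that]] f(2)[OF that] by (simp add: x_def)
  let ?s = "inner_part ?Q x" and ?t = "outer_part x"
  have xi: "x i \<in> carrier ?Q" for i using xc by blast
  have s: "range ?s \<subseteq> carrier ?Q" and t: "range ?t \<subseteq> carrier ?Q"
    using xi by (auto simp: inner_part_def outer_part_def)
  have hs: "(\<lambda>i. h (?s i)) = inner_part ?K gr_gen" and ht: "(\<lambda>i. h (?t i)) = outer_part gr_gen"
    using xi by (auto simp: inner_part_def outer_part_def hx fun_eq_iff)
  have decomposition: "\<exists>p r. Poly_Mapping.keys p \<subseteq> {t. lyndon t \<and> set (foliage t) \<subseteq> index} \<and>
    Poly_Mapping.keys r \<subseteq> {t. lyndon t \<and> set (foliage t) \<subseteq> index} \<and> a = lie_eval ?Q ?s p \<otimes>\<^bsub>?Q\<^esub> lie_eval ?Q ?t r"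
    if a: "a \<in> carrier ?Q" for a
  proof -
    let ?H = "{u \<otimes>\<^bsub>?Q\<^esub> v | u v. u \<in> Q.lyndon_span ?s index \<and> v \<in> Q.lyndon_span ?t index}"
    note H = Q.mccool_relators_decomposition[OF xc x_rel]
    have "?H = carrier ?Q"
    proof (rule lie_quot_generated[OF L.lie_ring_axioms J(1) _ _ H(1)])
      show "H = carrier L6" if "subgroup H L6" "\<And>a b. a \<in> H \<Longrightarrow> b \<in> H \<Longrightarrow> \<lbrakk>a, b\<rbrakk>\<^bsub>L6\<^esub> \<in> H" "?g ` {1..6} \<subseteq> H" for H
        using that unfolding L6_def by (intro free_lie_generated) auto
      show "?g ` {1..6} \<subseteq> carrier L6" using g by blast
      show "\<lbrakk>a, b\<rbrakk>\<^bsub>?Q\<^esub> \<in> ?H" if "a \<in> ?H" "b \<in> ?H" for a b using H(2)[OF that] .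
      show "J6 #>\<^bsub>L6\<^esub> a \<in> ?H" if "a \<in> ?g ` {1..6}" for a
      proof -
        from that obtain i where "i \<in> {1..6}" "a = ?g i" by blast
        then show ?thesis using H(3)[of i] by (simp add: x_def)
      qed
    qed
    then obtain u v where uv: "a = u \<otimes>\<^bsub>?Q\<^esub> v" "u \<in> Q.lyndon_span ?s index" "v \<in> Q.lyndon_span ?t index"
      using a by blast
    obtain p where p: "Poly_Mapping.keys p \<subseteq> {t. lyndon t \<and> set (foliage t) \<subseteq> index}" "u = lie_eval ?Q ?s p"
      using Q.lyndon_span_lie_eval[OF s uv(2)] by blast
    obtain r where r: "Poly_Mapping.keys r \<subseteq> {t. lyndon t \<and> set (foliage t) \<subseteq> index}" "v = lie_eval ?Q ?t r"
      using Q.lyndon_span_lie_eval[OF t uv(3)] by blast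
    show ?thesis
      by (intro exI[of _ p] exI[of _ r] conjI p(1) r(1)) (simp only: uv(1) p(2) r(2))
  qed
  have image: "h (lie_eval ?Q ?s p \<otimes>\<^bsub>?Q\<^esub> lie_eval ?Q ?t r) = lie_eval ?K (inner_part ?K gr_gen) p
      \<otimes>\<^bsub>?K\<^esub> lie_eval ?K (outer_part gr_gen) r" for p r
    using lie_eval_lie_hom[OF Q.nonassoc_ring_axioms K.nonassoc_ring_axioms h(1) s, of p]
      lie_eval_lie_hom[OF Q.nonassoc_ring_axioms K.nonassoc_ring_axioms h(1) t, of r]
      h.hom_mult[OF Q.lie_eval_simps(1)[OF s] Q.lie_eval_simps(1)[OF t], of p r]
    by (simp add: hs ht)
  have inj: "a = \<one>\<^bsub>?Q\<^esub>" if a: "a \<in> carrier ?Q" "h a = \<one>\<^bsub>?K\<^esub>" for a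
  proof -
    obtain p r where pr: "Poly_Mapping.keys p \<subseteq> {t. lyndon t \<and> set (foliage t) \<subseteq> index}"
      "Poly_Mapping.keys r \<subseteq> {t. lyndon t \<and> set (foliage t) \<subseteq> index}"
          "a = lie_eval ?Q ?s p \<otimes>\<^bsub>?Q\<^esub> lie_eval ?Q ?t r"
      using decomposition[OF a(1)] by blast
    have "p = 0" "r = 0" using gr_McCool3_independence[OF pr(1,2)] image[of p r] a(2) pr(3) by auto
    then show ?thesis using pr(3) by (simp add: Q.lie_eval_simps(3)[OF s] Q.lie_eval_simps(3)[OF t])
  qed
  have surj: "h ` carrier ?Q = carrier ?K"
  proof (rule M3.gr_generated_in_degree_one[OF _ _ McCool3_generated])
    show "subgroup (h ` carrier ?Q) ?K" by (rule h.img_is_subgroup)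
    show "\<lbrakk>a, b\<rbrakk>\<^bsub>?K\<^esub> \<in> h ` carrier ?Q" if ab: "a \<in> h ` carrier ?Q" "b \<in> h ` carrier ?Q" for a b
    proof -
      obtain a' b' where "a = h a'" "b = h b'" "a' \<in> carrier ?Q" "b' \<in> carrier ?Q" using ab by blast
      moreover from this have "h \<lbrakk>a', b'\<rbrakk>\<^bsub>?Q\<^esub> = \<lbrakk>a, b\<rbrakk>\<^bsub>?K\<^esub>" using h(1) by (simp add: lie_hom_def)
      ultimately show ?thesis using Q.lbr_closed by (metis imageI)
    qed
    show "gr_elem McCool3 1 \<phi> \<in> h ` carrier ?Q" if \<phi>: "\<phi> \<in> chi_set" for \<phi>
    proof -
      obtain i where i: "i \<in> {1..6}" "\<phi> = chi_gen i" using \<phi> chi_gen_range by blast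
      then have "gr_elem McCool3 1 \<phi> = h (x i)" using hx by (simp add: gr_gen_def)
      then show ?thesis using xi by blast
    qed
  qed
  have "inj_on h (carrier ?Q)"
    using inj h.inj_on_one_iff by simp
  then have "h \<in> lie_iso ?Q ?K"
    using h(1) surj by (simp add: lie_iso_def lie_hom_def iso_def bij_betw_def)
  then have "lie_isomorphic ?Q ?K"
    unfolding lie_isomorphic_def using Q.lie_ring_axioms K.lie_ring_axioms by blast
  moreover have "torsion_free ?K"
    unfolding torsion_free_def
  proof (intro ballI allI impI)
    fix y and n :: int assume y: "y \<in> carrier ?K" and n: "n \<noteq> 0" and yn: "y [^]\<^bsub>?K\<^esub> n = \<one>\<^bsub>?K\<^esub>"
    obtain a where a: "a \<in> carrier ?Q" "y = h a" using y surj by blast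
    obtain p r where pr: "Poly_Mapping.keys p \<subseteq> {t. lyndon t \<and> set (foliage t) \<subseteq> index}"
      "Poly_Mapping.keys r \<subseteq> {t. lyndon t \<and> set (foliage t) \<subseteq> index}"
          "a = lie_eval ?Q ?s p \<otimes>\<^bsub>?Q\<^esub> lie_eval ?Q ?t r"
      using decomposition[OF a(1)] by blast
    have S: "range (inner_part ?K gr_gen) \<subseteq> carrier ?K" and T: "range (outer_part gr_gen) \<subseteq> carrier ?K"
      using gr_gen_closed by (auto simp: inner_part_def outer_part_def)
    have pow: "lie_eval ?K z (frag_cmul n u) = lie_eval ?K z u [^]\<^bsub>?K\<^esub> n" if z: "range z \<subseteq> carrier ?K"
        for z :: "nat \<Rightarrow> _" and u
      using hom_int_pow[OF K.lie_eval_hom[OF z], of u n] by (simp add: K.is_group)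
    have "lie_eval ?K (inner_part ?K gr_gen) (frag_cmul n p)
        \<otimes>\<^bsub>?K\<^esub> lie_eval ?K (outer_part gr_gen) (frag_cmul n r) = y [^]\<^bsub>?K\<^esub> n"
      using K.int_pow_distrib[OF K.lie_eval_simps(1)[OF S, of p] K.lie_eval_simps(1)[OF T, of r], of n]
          image[of p r]
      by (simp add: pow[OF S] pow[OF T] a(2) pr(3))
    then have "frag_cmul n p = 0" "frag_cmul n r = 0"
      using gr_McCool3_independence[of "frag_cmul n p"
          "frag_cmul n r"] yn pr(1,2) keys_cmul[of n p] keys_cmul[of n r] by auto
    then have "p = 0" "r = 0" using n by simp_all
    then show "y = \<one>\<^bsub>?K\<^esub>"
      using a(2) pr(3) Q.lie_eval_simps(3)[OF s] Q.lie_eval_simps(3)[OF t] h.hom_one by simp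
  qed
  ultimately show ?thesis by blast
qed

end
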